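(* Let $X$ be a complete metric space, $V$ a finite dimensional Banach space and $F\colon X\to V$ Lipschitz. For an integer $0\le d\le\dim V$ and a real number $s>d$, let $S\in\tilde A(F,d)$ have finite $\mathcal H^s$ measure. Then for any $\varepsilon>0$ there exists a $(\tilde K(V,d)\operatorname{Lip}F+\varepsilon)$-Lipschitz $\sigma\colon X\to V$ such that (1) $\|\sigma(x)-F(x)\|<\varepsilon$ for each $x\in X$, and $\sigma(x)=F(x)$ whenever $d(x,S)>\varepsilon$; (2) $\mathcal H^s(\sigma(S))<\varepsilon$.
   Context: Banach spaces are real. $\operatorname{Lip}F$ is the least Lipschitz constant of $F$. $d(x,S)$ is the infimal distance from $x$ to points of $S$. $\mathcal H^s$ is the $s$-dimensional Hausdorff measure, $\mathcal H^s(S)=\lim_{\delta\to0}\inf\{\sum_{i\in\mathbb N}\operatorname{diam}(S_i)^s: S\subset\bigcup_i S_i,\ \operatorname{diam}(S_i)\le\delta\}$. $\Gamma(X)$ is the set of biLipschitz maps $\gamma\colon\operatorname{Dom}\gamma\to X$ with $\operatorname{Dom}\gamma\subset\mathbb R$ compact; $\gamma$ also denotes its image. For a subspace $W\le V$ and $0<\theta<1$, $E(W,\theta)=\{v\in V:\operatorname{dist}(v,W)\ge(1-\theta)\|v\|\}$. $\gamma\in\Gamma(X)$ is in the $F$-direction of $E(W,\theta)$ if $(F\circ\gamma)'(t)\in E(W,\theta)\setminus\{0\}$ for $\mathcal H^1$-a.e. $t\in\operatorname{Dom}\gamma$. For an integer $0\le d\le\dim V$, $\tilde A(F,d,\theta)$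 is the set of all $S\subset X$ for which there is a finite Borel decomposition $S=S_1\cup\dots\cup S_M$ and $d$-dimensional subspaces $W_i\le V$ such that, for each $i$, $\mathcal H^1(\gamma\cap S_i)=0$ for every $\gamma\in\Gamma(X)$ in the $F$-direction of $E(W_i,\theta)$. $\tilde A(F,d)=\bigcap_{0<\theta<1}\tilde A(F,d,\theta)$. $\tilde K(V,d)$ is the least $K\ge1$ for which the following is true: there exist $K_d,K_p>0$ and, for any $d$-dimensional subspace $W$ of $V$, a basis $b_1,\dots,b_m$ of $V$ consisting of unit vectors (with coordinate functionals $b_i^*$) and linear projections $P\colon V\to W$ (onto $W$) and $Q\colon V\to\ker P$ such that: $P(x)+Q(x)=x$ for all $x\in V$; $\|b_i^*\|\le K_p$ for each $i$; $\|P\|,\|Q\|\le K_d$; and for each $x\in V$ and $l\in\ell_\infty^m$ with $\|l\|_\infty\le1$, $\left\|P(x)+\sum_{i=1}^ml_ib_i^*(Q(x))b_i\right\|\le K\|x\|$. *)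

theory Defs
  imports "HOL-Analysis.Analysis"
begin

definition finite_dimensional :: "'v::real_vector itself \<Rightarrow> bool" where
  "finite_dimensional _ \<longleftrightarrow> (\<exists>B::'v set. finite B \<and> span B = UNIV)"

text \<open>For a Lipschitz map the infimum is attained, so this is the least Lipschitz constant.\<close>

definition lip_const :: "('a::metric_space \<Rightarrow> 'b::metric_space) \<Rightarrow> real" where
  "lip_const F = Inf {L. L-lipschitz_on UNIV F}"

text \<open>
  The library constant \<open>diameter\<close> is only meaningful on bounded sets, hence the explicit
  \<open>bounded\<close>. As \<open>0 powr s = 0\<close> for every \<open>s\<close>, the definition is meant for \<open>s > 0\<close>.
\<close>

definition hausdorff_content :: "real \<Rightarrow> real \<Rightarrow> 'a::metric_space set \<Rightarrow> ennreal" where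
  "hausdorff_content s \<delta> S =
     Inf {(\<Sum>i. ennreal (diameter (U i) powr s)) | U :: nat \<Rightarrow> 'a set.
            S \<subseteq> (\<Union>i. U i) \<and> (\<forall>i. bounded (U i) \<and> diameter (U i) \<le> \<delta>)}"

definition hausdorff_measure :: "real \<Rightarrow> 'a::metric_space set \<Rightarrow> ennreal" where
  "hausdorff_measure s S = Lim (at_right 0) (\<lambda>\<delta>. hausdorff_content s \<delta> S)"

lemma hausdorff_content_antimono:
  assumes "\<delta> \<le> \<delta>'"
  shows "hausdorff_content s \<delta>' S \<le> hausdorff_content s \<delta> S"
proof -
  have "bounded U \<and> diameter U \<le> \<delta>'" if "bounded U \<and> diameter U \<le> \<delta>" for U :: "'a set"
    using that assms by linarith
  then show ?thesis
    unfolding hausdorff_content_def by (intro Inf_superset_mono Collect_mono) blast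
qed

lemma hausdorff_content_tendsto:
  "((\<lambda>\<delta>. hausdorff_content s \<delta> S) \<longlongrightarrow> (SUP \<delta>\<in>{0<..}. hausdorff_content s \<delta> S)) (at_right 0)"
proof (rule order_tendstoI)
  fix a assume "a < (SUP \<delta>\<in>{0<..}. hausdorff_content s \<delta> S)"
  then obtain \<eta> :: real where \<eta>: "\<eta> > 0" "a < hausdorff_content s \<eta> S"
    by (auto simp: less_SUP_iff)
  then show "\<forall>\<^sub>F \<delta> in at_right 0. a < hausdorff_content s \<delta> S"
    unfolding eventually_at_right_field
    by (intro exI[of _ \<eta>] conjI allI impI
          order_less_le_trans[OF \<eta>(2) hausdorff_content_antimono]) simp_all
next
  fix a assume a: "(SUP \<delta>\<in>{0<..}. hausdorff_content s \<delta> S) < a"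
  have "hausdorff_content s \<delta> S < a" if "\<delta> > 0" for \<delta>
    using that by (intro le_less_trans[OF _ a] SUP_upper) auto
  then show "\<forall>\<^sub>F \<delta> in at_right 0. hausdorff_content s \<delta> S < a"
    unfolding eventually_at_right_field by (intro exI[of _ 1]) auto
qed

lemma hausdorff_measure_eq_SUP:
  "hausdorff_measure s S = (SUP \<delta>\<in>{0<..}. hausdorff_content s \<delta> S)"
  unfolding hausdorff_measure_def
  by (rule tendsto_Lim[OF _ hausdorff_content_tendsto]) simp

text \<open>
  An element of \<open>\<Gamma>(X)\<close> is given by its domain \<open>D\<close> together with a total function \<open>\<gamma>\<close>, of which
  only the values on \<open>D\<close> are used; the image of the curve is \<open>\<gamma> ` D\<close>.
\<close>

definition biLipschitz_curve :: "real set \<Rightarrow> (real \<Rightarrow> 'a::metric_space) \<Rightarrow> bool" where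
  "biLipschitz_curve D \<gamma> \<longleftrightarrow> compact D \<and>
     (\<exists>L>0. \<forall>t\<in>D. \<forall>u\<in>D. \<bar>t - u\<bar> / L \<le> dist (\<gamma> t) (\<gamma> u) \<and> dist (\<gamma> t) (\<gamma> u) \<le> L * \<bar>t - u\<bar>)"

definition cone_off :: "'v::real_normed_vector set \<Rightarrow> real \<Rightarrow> 'v set" where
  "cone_off W \<theta> = {v. infdist v W \<ge> (1 - \<theta>) * norm v}"

text \<open>
  The derivative is taken relative to \<open>D\<close>. It is unique except at the isolated points of \<open>D\<close>,
  which are countably many and hence \<open>\<H>\<^sup>1\<close>-negligible.
\<close>

definition in_direction ::
  "('a::metric_space \<Rightarrow> 'v::real_normed_vector) \<Rightarrow> 'v set \<Rightarrow> real set \<Rightarrow> (real \<Rightarrow> 'a) \<Rightarrow> bool" where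
  "in_direction F C D \<gamma> \<longleftrightarrow>
     hausdorff_measure 1
       {t \<in> D. \<not> (\<exists>v \<in> C - {0}. ((F \<circ> \<gamma>) has_vector_derivative v) (at t within D))} = 0"

definition A_tilde_theta ::
  "('a::metric_space \<Rightarrow> 'v::real_normed_vector) \<Rightarrow> nat \<Rightarrow> real \<Rightarrow> 'a set set" where
  "A_tilde_theta F d \<theta> =
     {S. \<exists>(M::nat) (T :: nat \<Rightarrow> 'a set) (W :: nat \<Rightarrow> 'v set).
           S = (\<Union>i<M. T i) \<and>
           (\<forall>i<M. T i \<in> sets borel \<and> subspace (W i) \<and> dim (W i) = d \<and>
              (\<forall>D \<gamma>. biLipschitz_curve D \<gamma> \<longrightarrow> in_direction F (cone_off (W i) \<theta>) D \<gamma> \<longrightarrow>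
                 hausdorff_measure 1 (\<gamma> ` D \<inter> T i) = 0))}"

definition A_tilde :: "('a::metric_space \<Rightarrow> 'v::real_normed_vector) \<Rightarrow> nat \<Rightarrow> 'a set set" where
  "A_tilde F d = (\<Inter>\<theta>\<in>{0<..<1}. A_tilde_theta F d \<theta>)"

text \<open>
  A basis of \<open>V\<close> is a set \<open>B\<close>; the coordinate functional of \<open>b \<in> B\<close> is
  \<open>\<lambda>x. representation B x b\<close>, and \<open>l \<in> \<ell>\<^sub>\<infinity>\<^sup>m\<close> is indexed by \<open>B\<close>.
\<close>

definition K_tilde_admissible :: "'v::real_normed_vector itself \<Rightarrow> nat \<Rightarrow> real \<Rightarrow> bool" where
  "K_tilde_admissible _ d K \<longleftrightarrow>
     (\<exists>Kd>0. \<exists>Kp>0. \<forall>W::'v set. subspace W \<and> dim W = d \<longrightarrow>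
        (\<exists>(B::'v set) (P::'v \<Rightarrow> 'v) (Q::'v \<Rightarrow> 'v).
           independent B \<and> span B = UNIV \<and> (\<forall>b\<in>B. norm b = 1) \<and>
           linear P \<and> P \<circ> P = P \<and> range P = W \<and>
           linear Q \<and> Q \<circ> Q = Q \<and> range Q = {x. P x = 0} \<and>
           (\<forall>x. P x + Q x = x) \<and>
           (\<forall>b\<in>B. onorm (\<lambda>x. representation B x b) \<le> Kp) \<and>
           onorm P \<le> Kd \<and> onorm Q \<le> Kd \<and>
           (\<forall>x. \<forall>l::'v \<Rightarrow> real. (\<forall>b\<in>B. \<bar>l b\<bar> \<le> 1) \<longrightarrow>
              norm (P x + (\<Sum>b\<in>B. (l b * representation B (Q x) b) *\<^sub>R b)) \<le> K * norm x)))"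

text \<open>
  The infimum is the least admissible constant whenever a least one exists; unlike \<open>LEAST\<close>,
  it does not presuppose that it is attained.
\<close>

definition K_tilde :: "'v::real_normed_vector itself \<Rightarrow> nat \<Rightarrow> real" where
  "K_tilde V d = Inf {K. K \<ge> 1 \<and> K_tilde_admissible V d K}"

lemma K_tilde_eq_least:
  assumes "K \<ge> 1" "K_tilde_admissible V d K"
    and "\<And>K'. K' \<ge> 1 \<Longrightarrow> K_tilde_admissible V d K' \<Longrightarrow> K \<le> K'"
  shows "K_tilde V d = K"
  unfolding K_tilde_def by (rule cInf_eq_minimum) (use assms in auto)

end

theory Submission
  imports Defs
begin

text \<open>
  Near most of \<open>S\<close> the map \<open>F\<close> can be flattened towards \<open>d\<close>-dimensional subspaces \<open>W\<close>, at almost no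
  cost in the Lipschitz constant beyond the factor \<open>K_tilde\<close>. A flattened image carries little
  \<open>s\<close>-dimensional measure because \<open>s > d\<close>: a set of diameter \<open>h\<close> that lies within \<open>\<eta> h\<close> of a translate of
  \<open>W\<close> is covered by about \<open>\<eta>\<close> to the power \<open>- d\<close> sets of diameter comparable to \<open>\<eta> h\<close>, so its
  \<open>s\<close>-dimensional content is at most a constant times \<open>\<eta> powr (s - d) * h powr s\<close>. Hence the measure of the
  image tends to \<open>0\<close> with \<open>\<eta>\<close> (lemma \<open>hausdorff_measure_locally_flat_image\<close>).

  The flattening is done one coordinate at a time. Let \<open>K\<close> be a compact set that is null for curves in the
  \<open>F\<close>-direction of the cone off \<open>W\<close>, and let \<open>f = \<phi> \<circ> F\<close> for a functional \<open>\<phi>\<close> vanishing on \<open>W\<close>. Replace \<open>f\<close> by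
  the function \<open>g\<close> whose value at \<open>z\<close> is the infimum of \<open>f x\<^sub>0\<close> plus the cost of a chain from \<open>x\<^sub>0\<close> to \<open>z\<close>. A
  step costs \<open>\<delta>\<close> times its length plus the rise of \<open>f\<close>, but the rise is free for short steps within \<open>K\<close>. Then
  \<open>g\<close> varies by at most \<open>\<delta>\<close> times the distance on small pieces of \<open>K\<close>, never by more than \<open>f\<close> does up to this
  error, and \<open>g \<le> f\<close>. What has to be shown is that \<open>g\<close> is uniformly close to \<open>f\<close> once the permitted steps are
  short enough (lemma \<open>real_perturbation\<close>).

  If it is not, there are chains with ever shorter free steps along which \<open>f\<close> gains more than \<open>\<epsilon>\<close> over the
  cost. Reading such a chain at the last moment at which its net gain is at most \<open>s\<close>, for each \<open>s\<close> between
  \<open>0\<close> and \<open>\<epsilon>\<close>, and passing to the limit by compactness of a power of \<open>K\<close> yields a map \<open>y\<close> from \<open>{0..\<epsilon>}\<close> to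
  \<open>K\<close> with \<open>f (y s') - f (y s) \<ge> (s' - s) + \<delta> * dist (y s) (y s')\<close>. On the closure of its image \<open>f\<close> has a
  Lipschitz inverse, and this inverse is a biLipschitz curve in \<open>K\<close> of positive length. Along it \<open>\<phi> \<circ> F\<close> is the
  identity, so a derivative \<open>v\<close> of \<open>F\<close> along the curve has \<open>\<phi> v = 1\<close>, while its norm is at most
  \<open>lip_const F / \<delta>\<close>. Hence \<open>v\<close> lies in the cone off \<open>W\<close> as soon as \<open>\<theta>\<close> is close to \<open>1\<close>, and the curve
  contradicts the nullity of \<open>K\<close> (lemma \<open>null_set_no_rising_fragment\<close>). The derivative exists almost everywhere
  by Rademacher's theorem on the line, which is derived here from the Vitali covering theorem.

  Flattening all coordinates of \<open>Q \<circ> F\<close> and keeping \<open>P \<circ> F\<close> gives a Lipschitz constant governed by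
  \<open>K_tilde\<close>, since the inequality defining an admissible constant allows each coordinate of \<open>Q\<close> to be
  contracted independently (lemma \<open>vector_perturbation\<close>). Inner regularity of the Hausdorff measure exhausts
  \<open>S\<close> up to a small remainder by finitely many disjoint compact sets of this kind
  (lemma \<open>A_tilde_theta_compact_pieces\<close>). They lie at positive distance from each other, so the perturbations
  can be glued by cut-off functions whose slopes are compensated by making the perturbations uniformly small
  (lemma \<open>glue_perturbations\<close>).

  The order of choice matters. The bounds \<open>Kd\<close> and \<open>Kp\<close> on projections and coordinates hold for all subspaces
  \<open>W\<close> at once, so the thinness \<open>\<eta>\<close>, then \<open>\<delta>\<close>, then \<open>\<theta>\<close> can be fixed before the decomposition of \<open>S\<close>, which
  depends on \<open>\<theta>\<close>, becomes known.
\<close>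

section \<open>Hausdorff contents and measures\<close>

lemma hausdorff_content_le:
  assumes "S \<subseteq> (\<Union>i. U i)" "\<And>i. bounded (U i)" "\<And>i. diameter (U i) \<le> \<delta>"
  shows "hausdorff_content s \<delta> S \<le> (\<Sum>i. ennreal (diameter (U i) powr s))"
  unfolding hausdorff_content_def by (rule Inf_lower) (use assms in auto)

lemma hausdorff_content_approx:
  fixes S :: "'a::metric_space set"
  assumes "hausdorff_content s \<delta> S < c"
  obtains U :: "nat \<Rightarrow> 'a set" where "S \<subseteq> (\<Union>i. U i)" "\<And>i. bounded (U i)"
    "\<And>i. diameter (U i) \<le> \<delta>" "(\<Sum>i. ennreal (diameter (U i) powr s)) < c"
  using assms unfolding hausdorff_content_def Inf_less_iff by auto

lemma hausdorff_content_empty [simp]: "\<delta> \<ge> 0 \<Longrightarrow> hausdorff_content s \<delta> {} = 0"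
  using hausdorff_content_le[of "{}" "\<lambda>_. {}" \<delta> s] by simp

lemma hausdorff_content_mono: "A \<subseteq> B \<Longrightarrow> hausdorff_content s \<delta> A \<le> hausdorff_content s \<delta> B"
  unfolding hausdorff_content_def by (intro Inf_superset_mono Collect_mono) blast

lemma hausdorff_content_le_measure: "\<delta> > 0 \<Longrightarrow> hausdorff_content s \<delta> A \<le> hausdorff_measure s A"
  unfolding hausdorff_measure_eq_SUP by (rule SUP_upper) auto

lemma hausdorff_measure_le_if:
  assumes "r > 0" "\<And>\<delta>. 0 < \<delta> \<Longrightarrow> \<delta> \<le> r \<Longrightarrow> hausdorff_content s \<delta> A \<le> c"
  shows "hausdorff_measure s A \<le> c"
  unfolding hausdorff_measure_eq_SUP
proof (rule SUP_least)
  fix \<delta> :: real assume "\<delta> \<in> {0<..}"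
  have "hausdorff_content s \<delta> A \<le> hausdorff_content s (min \<delta> r) A"
    by (rule hausdorff_content_antimono) auto
  also have "\<dots> \<le> c" using assms \<open>\<delta> \<in> _\<close> by auto
  finally show "hausdorff_content s \<delta> A \<le> c" .
qed

lemma hausdorff_measure_mono: "A \<subseteq> B \<Longrightarrow> hausdorff_measure s A \<le> hausdorff_measure s B"
  unfolding hausdorff_measure_eq_SUP by (intro SUP_mono) (auto intro: hausdorff_content_mono)

lemma hausdorff_measure_empty [simp]: "hausdorff_measure s {} = 0"
  using hausdorff_measure_le_if[of 1 s "{}" 0] by simp

text \<open>
  A family of nearly optimal covers, with errors that form a geometric series, is merged into one cover by
  enumerating pairs of indices.
\<close>

lemma hausdorff_content_UN_le:
  fixes A :: "nat \<Rightarrow> 'a::metric_space set"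
  shows "hausdorff_content s \<delta> (\<Union>i. A i) \<le> (\<Sum>i. hausdorff_content s \<delta> (A i))"
proof (rule ennreal_le_epsilon)
  fix e :: real assume e: "e > 0" and fin: "(\<Sum>i. hausdorff_content s \<delta> (A i)) < top"
  have "\<exists>U. A i \<subseteq> (\<Union>j. U j) \<and> (\<forall>j. bounded (U j) \<and> diameter (U j) \<le> \<delta>) \<and>
      (\<Sum>j. ennreal (diameter (U j) powr s)) < hausdorff_content s \<delta> (A i) + ennreal (e * (1/2)^Suc i)"
    for i
  proof -
    have "hausdorff_content s \<delta> (A i) < top"
      by (rule ennreal_suminf_lessD[OF fin])
    then have "hausdorff_content s \<delta> (A i) < hausdorff_content s \<delta> (A i) + ennreal (e * (1/2)^Suc i)"
      using e by (simp add: ennreal_add_left_cancel_less[of _ 0, simplified])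
    then show ?thesis by (elim hausdorff_content_approx) blast
  qed
  then obtain U where U: "\<And>i. A i \<subseteq> (\<Union>j. U i j)" "\<And>i j. bounded (U i j)" "\<And>i j. diameter (U i j) \<le> \<delta>"
    "\<And>i. (\<Sum>j. ennreal (diameter (U i j) powr s)) < hausdorff_content s \<delta> (A i) + ennreal (e * (1/2)^Suc i)"
    by metis
  let ?V = "\<lambda>k. U (fst (prod_decode k)) (snd (prod_decode k))"
  have "hausdorff_content s \<delta> (\<Union>i. A i) \<le> (\<Sum>k. ennreal (diameter (?V k) powr s))"
  proof (rule hausdorff_content_le)
    show "(\<Union>i. A i) \<subseteq> (\<Union>k. ?V k)"
    proof safe
      fix x i assume "x \<in> A i"
      then obtain j where "x \<in> U i j" using U(1) by blast
      then show "x \<in> (\<Union>k. ?V k)" by (intro UN_I[of "prod_encode (i,j)"]) auto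
    qed
  qed (use U in auto)
  also have "\<dots> = (\<Sum>i. \<Sum>j. ennreal (diameter (U i j) powr s))"
  proof -
    have "(\<Sum>k. (\<lambda>(i,j). ennreal (diameter (U i j) powr s)) (prod_decode k)) = (\<Sum>i. \<Sum>j. ennreal (diameter (U i j) powr s))"
      by (rule suminf_ennreal_2dimen) simp
    then show ?thesis by (simp only: case_prod_beta)
  qed
  also have "\<dots> \<le> (\<Sum>i. hausdorff_content s \<delta> (A i) + ennreal (e * (1/2)^Suc i))"
    by (intro suminf_le allI less_imp_le U(4)) auto
  also have "\<dots> = (\<Sum>i. hausdorff_content s \<delta> (A i)) + (\<Sum>i. ennreal (e * (1/2)^Suc i))"
    by (rule suminf_add[symmetric]) auto
  also have "(\<Sum>i. ennreal (e * (1/2)^Suc i)) = ennreal e"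
    using e power_half_series by (intro suminf_ennreal_eq) (auto dest: sums_mult[of _ _ e])
  finally show "hausdorff_content s \<delta> (\<Union>i. A i) \<le> (\<Sum>i. hausdorff_content s \<delta> (A i)) + ennreal e" .
qed

lemma hausdorff_measure_UN_le:
  fixes A :: "nat \<Rightarrow> 'a::metric_space set"
  shows "hausdorff_measure s (\<Union>i. A i) \<le> (\<Sum>i. hausdorff_measure s (A i))"
proof (rule hausdorff_measure_le_if[of 1])
  fix \<delta> :: real assume "0 < \<delta>"
  then show "hausdorff_content s \<delta> (\<Union>i. A i) \<le> (\<Sum>i. hausdorff_measure s (A i))"
    by (intro order_trans[OF hausdorff_content_UN_le] suminf_le hausdorff_content_le_measure) auto
qed auto

lemma hausdorff_content_finite_UN_le:
  assumes "finite I" "\<delta> \<ge> 0"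
  shows "hausdorff_content s \<delta> (\<Union>i\<in>I. A i) \<le> (\<Sum>i\<in>I. hausdorff_content s \<delta> (A i))"
proof -
  obtain h where h: "bij_betw h {..<card I} I"
    using ex_bij_betw_nat_finite[OF assms(1)] by (auto simp: atLeast0LessThan)
  let ?B = "\<lambda>k. if k < card I then A (h k) else {}"
  have "(\<Union>i\<in>I. A i) = (\<Union>k<card I. A (h k))"
    using bij_betw_imp_surj_on[OF h] by (metis image_image)
  also have "\<dots> = (\<Union>k. ?B k)" by (auto split: if_splits)
  finally have "hausdorff_content s \<delta> (\<Union>i\<in>I. A i) \<le> (\<Sum>k. hausdorff_content s \<delta> (?B k))"
    using hausdorff_content_UN_le[of s \<delta> ?B] by simp
  also have "\<dots> = (\<Sum>k<card I. hausdorff_content s \<delta> (?B k))"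
    by (rule suminf_finite) (use assms in auto)
  also have "\<dots> = (\<Sum>k<card I. hausdorff_content s \<delta> (A (h k)))" by simp
  also have "\<dots> = (\<Sum>i\<in>I. hausdorff_content s \<delta> (A i))"
    by (rule sum.reindex_bij_betw[OF h])
  finally show ?thesis .
qed

lemma hausdorff_measure_finite_UN_le:
  assumes "finite I"
  shows "hausdorff_measure s (\<Union>i\<in>I. A i) \<le> (\<Sum>i\<in>I. hausdorff_measure s (A i))"
proof (rule hausdorff_measure_le_if[of 1])
  fix \<delta> :: real assume "0 < \<delta>"
  then show "hausdorff_content s \<delta> (\<Union>i\<in>I. A i) \<le> (\<Sum>i\<in>I. hausdorff_measure s (A i))"
    by (intro order_trans[OF hausdorff_content_finite_UN_le] sum_mono hausdorff_content_le_measure assms) auto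
qed auto

lemma hausdorff_measure_Un_le:
  "hausdorff_measure s (A \<union> B) \<le> hausdorff_measure s A + hausdorff_measure s B"
  using hausdorff_measure_finite_UN_le[of "UNIV::bool set" s "\<lambda>b. if b then A else B"]
  by (simp add: UNIV_bool Un_commute add.commute)

lemma diameter_le_if:
  assumes "0 \<le> d" "\<And>x y. x \<in> U \<Longrightarrow> y \<in> U \<Longrightarrow> dist x y \<le> d"
  shows "diameter U \<le> d"
  using assms by (force simp: diameter_def intro: cSUP_least)

lemma diameter_image_le:
  assumes "bounded U" "c \<ge> 0" "\<And>x y. x \<in> U \<Longrightarrow> y \<in> U \<Longrightarrow> dist (g x) (g y) \<le> c * dist x y"
  shows "bounded (g ` U)" "diameter (g ` U) \<le> c * diameter U"
proof -
  have *: "dist (g x) (g y) \<le> c * diameter U" if "x \<in> U" "y \<in> U" for x y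
    using assms(3)[OF that] diameter_bounded_bound[OF assms(1) that] assms(2)
    by (meson mult_left_mono order_trans)
  show "bounded (g ` U)"
    unfolding bounded_two_points using * by blast
  have "diameter U \<ge> 0" by (rule diameter_ge_0[OF assms(1)])
  then show "diameter (g ` U) \<le> c * diameter U"
    using * assms(2) by (intro diameter_le_if) auto
qed

lemma hausdorff_content_single_le:
  assumes "bounded U" "diameter U \<le> \<delta>" "\<delta> \<ge> 0"
  shows "hausdorff_content s \<delta> U \<le> ennreal (diameter U powr s)"
proof -
  let ?U = "\<lambda>n::nat. if n = 0 then U else {}"
  have "hausdorff_content s \<delta> U \<le> (\<Sum>n. ennreal (diameter (?U n) powr s))"
    by (rule hausdorff_content_le) (use assms in auto)
  also have "\<dots> = (\<Sum>n\<in>{0}. ennreal (diameter (?U n) powr s))"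
    by (rule suminf_finite) auto
  finally show ?thesis by simp
qed

text \<open>
  It is enough to control the content of the images of small sets, because a cover of \<open>S\<close> is then transported
  set by set. The bound on each image may come from a cover by many smaller sets, which is what makes this
  stronger than a statement about Lipschitz maps.
\<close>

lemma hausdorff_measure_image_le:
  fixes g :: "'a::metric_space \<Rightarrow> 'b::metric_space"
  assumes c: "c > 0" and s: "s \<ge> 0"
    and g: "\<And>\<rho>. \<rho> > 0 \<Longrightarrow> \<exists>\<delta>>0. \<forall>A\<subseteq>S. bounded A \<longrightarrow> diameter A \<le> \<delta> \<longrightarrow>
        hausdorff_content s \<rho> (g ` A) \<le> ennreal (c * diameter A powr s)"
  shows "hausdorff_measure s (g ` S) \<le> ennreal c * hausdorff_measure s S"
proof (rule hausdorff_measure_le_if[of 1])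
  fix \<rho> :: real assume \<rho>: "0 < \<rho>"
  obtain \<delta> where \<delta>: "\<delta> > 0"
    and gA: "\<And>A. A \<subseteq> S \<Longrightarrow> bounded A \<Longrightarrow> diameter A \<le> \<delta> \<Longrightarrow> hausdorff_content s \<rho> (g ` A) \<le> ennreal (c * diameter A powr s)"
    using g[OF \<rho>] by metis
  have "hausdorff_content s \<rho> (g ` S) \<le> ennreal c * hausdorff_content s \<delta> S"
  proof (cases "hausdorff_content s \<delta> S = top")
    case True
    then show ?thesis using c by (simp add: ennreal_mult_top)
  next
    case False
    show ?thesis
    proof (rule ennreal_le_epsilon)
      fix e :: real assume e: "e > 0"
      have "hausdorff_content s \<delta> S < hausdorff_content s \<delta> S + ennreal (e / c)"
        using False e c by (simp add: ennreal_add_left_cancel_less[of _ 0, simplified] less_top)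
      then obtain U where U: "S \<subseteq> (\<Union>i. U i)" "\<And>i. bounded (U i)" "\<And>i. diameter (U i) \<le> \<delta>"
        "(\<Sum>i. ennreal (diameter (U i) powr s)) < hausdorff_content s \<delta> S + ennreal (e / c)"
        by (rule hausdorff_content_approx) blast
      have b: "bounded (U i \<inter> S)" for i using U(2) by (meson bounded_subset Int_lower1)
      have d: "diameter (U i \<inter> S) \<le> diameter (U i)" for i
        by (rule diameter_subset[OF Int_lower1 U(2)])
      have "S = (\<Union>i. U i \<inter> S)" using U(1) by blast
      then have "hausdorff_content s \<rho> (g ` S) = hausdorff_content s \<rho> (\<Union>i. g ` (U i \<inter> S))"
        by (metis image_UN)
      also have "\<dots> \<le> (\<Sum>i. hausdorff_content s \<rho> (g ` (U i \<inter> S)))" by (rule hausdorff_content_UN_le)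
      also have "\<dots> \<le> (\<Sum>i. ennreal c * ennreal (diameter (U i) powr s))"
      proof (intro suminf_le allI)
        fix i
        have "hausdorff_content s \<rho> (g ` (U i \<inter> S)) \<le> ennreal (c * diameter (U i \<inter> S) powr s)"
          using gA[OF _ b] d[of i] U(3)[of i] by (meson Int_lower2 order_trans)
        also have "\<dots> \<le> ennreal (c * diameter (U i) powr s)"
          using c s d[of i] diameter_ge_0[OF b] by (intro ennreal_leI mult_left_mono powr_mono2) auto
        finally show "hausdorff_content s \<rho> (g ` (U i \<inter> S)) \<le> ennreal c * ennreal (diameter (U i) powr s)"
          using c by (simp add: ennreal_mult)
      qed auto
      also have "\<dots> = ennreal c * (\<Sum>i. ennreal (diameter (U i) powr s))" by simp
      also have "\<dots> \<le> ennreal c * (hausdorff_content s \<delta> S + ennreal (e / c))"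
        by (rule mult_left_mono[OF less_imp_le[OF U(4)]]) auto
      also have "\<dots> = ennreal c * hausdorff_content s \<delta> S + ennreal e"
        using c e by (simp add: distrib_left ennreal_mult[symmetric])
      finally show "hausdorff_content s \<rho> (g ` S) \<le> ennreal c * hausdorff_content s \<delta> S + ennreal e" .
    qed
  qed
  also have "\<dots> \<le> ennreal c * hausdorff_measure s S"
    using \<delta> by (intro mult_left_mono hausdorff_content_le_measure) auto
  finally show "hausdorff_content s \<rho> (g ` S) \<le> ennreal c * hausdorff_measure s S" .
qed auto

lemma hausdorff_measure_lipschitz_image:
  fixes g :: "'a::metric_space \<Rightarrow> 'b::metric_space"
  assumes c: "c > 0" and s: "s \<ge> 0" and g: "\<And>x y. x \<in> S \<Longrightarrow> y \<in> S \<Longrightarrow> dist (g x) (g y) \<le> c * dist x y"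
  shows "hausdorff_measure s (g ` S) \<le> ennreal (c powr s) * hausdorff_measure s S"
proof (rule hausdorff_measure_image_le)
  show "c powr s > 0" using c by simp
  fix \<rho> :: real assume \<rho>: "\<rho> > 0"
  have "hausdorff_content s \<rho> (g ` A) \<le> ennreal (c powr s * diameter A powr s)"
    if A: "A \<subseteq> S" "bounded A" "diameter A \<le> \<rho> / c" for A
  proof -
    have c0: "c \<ge> 0" using c by simp
    have gA: "dist (g x) (g y) \<le> c * dist x y" if "x \<in> A" "y \<in> A" for x y
      using A(1) that by (intro g) auto
    have b: "bounded (g ` A)" by (rule diameter_image_le(1)[OF A(2) c0 gA])
    have d: "diameter (g ` A) \<le> c * diameter A" by (rule diameter_image_le(2)[OF A(2) c0 gA])
    have "c * diameter A \<le> \<rho>" using A(3) c by (simp add: le_divide_eq mult.commute)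
    then have "hausdorff_content s \<rho> (g ` A) \<le> ennreal (diameter (g ` A) powr s)"
      using b d \<rho> by (intro hausdorff_content_single_le) auto
    also have "\<dots> \<le> ennreal ((c * diameter A) powr s)"
      using d diameter_ge_0[OF b] s by (intro ennreal_leI powr_mono2) auto
    also have "(c * diameter A) powr s = c powr s * diameter A powr s"
      using c diameter_ge_0[OF A(2)] by (simp add: powr_mult)
    finally show ?thesis .
  qed
  then show "\<exists>\<delta>>0. \<forall>A\<subseteq>S. bounded A \<longrightarrow> diameter A \<le> \<delta> \<longrightarrow>
      hausdorff_content s \<rho> (g ` A) \<le> ennreal (c powr s * diameter A powr s)"
    using \<rho> c by (intro exI[of _ "\<rho> / c"]) simp
qed (rule s)

text \<open>
  Once \<open>\<delta>\<close> is below the distance of \<open>A\<close> and \<open>B\<close>, no set of a \<open>\<delta>\<close>-cover meets both of them.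
\<close>

lemma hausdorff_measure_separated:
  fixes A B :: "'a::metric_space set"
  assumes s: "s \<ge> 0" and r: "r > 0" and sep: "\<And>x y. x \<in> A \<Longrightarrow> y \<in> B \<Longrightarrow> r \<le> dist x y"
  shows "hausdorff_measure s (A \<union> B) = hausdorff_measure s A + hausdorff_measure s B"
proof (rule antisym[OF hausdorff_measure_Un_le])
  have "hausdorff_content s \<delta> A + hausdorff_content s \<delta> B \<le> hausdorff_content s \<delta> (A \<union> B)"
    if \<delta>: "0 < \<delta>" "\<delta> < r" for \<delta>
  proof (rule dense_ge)
    fix c assume "hausdorff_content s \<delta> (A \<union> B) < c"
    then obtain U where U: "A \<union> B \<subseteq> (\<Union>i. U i)" "\<And>i. bounded (U i)" "\<And>i. diameter (U i) \<le> \<delta>"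
        "(\<Sum>i. ennreal (diameter (U i) powr s)) < c"
      by (rule hausdorff_content_approx) blast
    have "hausdorff_content s \<delta> C \<le> (\<Sum>i. ennreal (diameter (U i \<inter> C) powr s))" if "C \<subseteq> A \<union> B" for C
    proof (rule hausdorff_content_le)
      show "diameter (U i \<inter> C) \<le> \<delta>" for i
        using diameter_subset[OF Int_lower1 U(2), of i C] U(3)[of i] by linarith
    qed (use U that in \<open>auto intro: bounded_subset[OF U(2)]\<close>)
    then have "hausdorff_content s \<delta> A + hausdorff_content s \<delta> B \<le>
      (\<Sum>i. ennreal (diameter (U i \<inter> A) powr s)) + (\<Sum>i. ennreal (diameter (U i \<inter> B) powr s))"
      by (intro add_mono) auto
    also have "\<dots> = (\<Sum>i. ennreal (diameter (U i \<inter> A) powr s) + ennreal (diameter (U i \<inter> B) powr s))"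
      by (rule suminf_add) auto
    also have "\<dots> \<le> (\<Sum>i. ennreal (diameter (U i) powr s))"
    proof (intro suminf_le allI)
      fix i
      have "U i \<inter> A = {} \<or> U i \<inter> B = {}"
      proof (rule ccontr)
        assume "\<not> (U i \<inter> A = {} \<or> U i \<inter> B = {})"
        then obtain x y where "x \<in> U i" "x \<in> A" "y \<in> U i" "y \<in> B" by blast
        then show False
          using sep[of x y] U(3)[of i] \<delta> diameter_bounded_bound[OF U(2), of x i y] by linarith
      qed
      moreover have "ennreal (diameter (U i \<inter> C) powr s) \<le> ennreal (diameter (U i) powr s)" for C
        using diameter_subset[OF Int_lower1 U(2), of i C] s
          diameter_ge_0[OF bounded_subset[OF U(2) Int_lower1], of i C]
        by (intro ennreal_leI powr_mono2) auto
      ultimately show "ennreal (diameter (U i \<inter> A) powr s) + ennreal (diameter (U i \<inter> B) powr s)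
          \<le> ennreal (diameter (U i) powr s)" by auto
    qed auto
    also have "\<dots> \<le> c" using U(4) by simp
    finally show "hausdorff_content s \<delta> A + hausdorff_content s \<delta> B \<le> c" .
  qed
  then have ev: "\<forall>\<^sub>F \<delta> in at_right 0. hausdorff_content s \<delta> A + hausdorff_content s \<delta> B \<le> hausdorff_content s \<delta> (A \<union> B)"
    unfolding eventually_at_right_field using r by blast
  show "hausdorff_measure s A + hausdorff_measure s B \<le> hausdorff_measure s (A \<union> B)"
    unfolding hausdorff_measure_eq_SUP
    by (rule tendsto_le[OF _ hausdorff_content_tendsto tendsto_add[OF hausdorff_content_tendsto hausdorff_content_tendsto] ev]) simp
qed

lemma hausdorff_measure_separated_family:
  fixes R :: "nat \<Rightarrow> 'a::metric_space set"
  assumes s: "s \<ge> 0"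
    and sep: "\<And>j k. j < k \<Longrightarrow> \<exists>r>0. \<forall>x\<in>R j. \<forall>y\<in>R k. r \<le> dist x y"
  shows "(\<Sum>k<n. hausdorff_measure s (R k)) = hausdorff_measure s (\<Union>k<n. R k)"
proof (induction n)
  case (Suc n)
  have "\<forall>j. \<exists>r. j < n \<longrightarrow> r > 0 \<and> (\<forall>x\<in>R j. \<forall>y\<in>R n. r \<le> dist x y)"
    using sep by blast
  from choice[OF this] obtain r where r: "\<And>j. j < n \<Longrightarrow> r j > 0 \<and> (\<forall>x\<in>R j. \<forall>y\<in>R n. r j \<le> dist x y)"
    by blast
  define r0 where "r0 = Min (insert 1 (r ` {..<n}))"
  have r0: "r0 > 0" "\<And>j. j < n \<Longrightarrow> r0 \<le> r j"
    using r by (auto simp: r0_def)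
  have "hausdorff_measure s ((\<Union>k<n. R k) \<union> R n) = hausdorff_measure s (\<Union>k<n. R k) + hausdorff_measure s (R n)"
  proof (rule hausdorff_measure_separated[OF s r0(1)])
    fix x y assume "x \<in> (\<Union>k<n. R k)" "y \<in> R n"
    then obtain j where "j < n" "x \<in> R j" by blast
    then show "r0 \<le> dist x y" using r[of j] r0(2)[of j] \<open>y \<in> R n\<close> by force
  qed
  then show ?case using Suc by (simp add: lessThan_Suc Un_commute add.commute)
qed simp

section \<open>Inner regularity of Hausdorff measure\<close>

lemma LIMSEQ_0_less:
  fixes f :: "nat \<Rightarrow> real"
  assumes "f \<longlonglongrightarrow> 0" "0 < e"
  shows "\<exists>n. f n < e"
  using order_tendstoD(2)[OF assms] unfolding eventually_sequentially by blast

text \<open>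
  Caratheodory's criterion. The points of \<open>A\<close> at distance at least \<open>1 / (n + 1)\<close> from \<open>C\<close> are separated from
  \<open>C\<close>, so their measure adds to that of \<open>A \<inter> C\<close>. What is left of \<open>A - C\<close> consists of the shells \<open>R k\<close> with \<open>k \<ge> n\<close>.
  Shells whose indices have the same parity are separated from each other, so the measures of all shells have a
  finite sum and its tails tend to \<open>0\<close>.
\<close>

lemma hausdorff_measure_closed_split:
  fixes A C :: "'a::metric_space set"
  assumes s: "s \<ge> 0" and C: "closed C"
  shows "hausdorff_measure s (A \<inter> C) + hausdorff_measure s (A - C) \<le> hausdorff_measure s A"
proof (cases "C = {} \<or> hausdorff_measure s A = top")
  case True
  then show ?thesis by auto
next
  case False
  then have ne: "C \<noteq> {}" and fin: "hausdorff_measure s A < top" by (auto simp: less_top)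
  define m where "m = (hausdorff_measure s :: 'a set \<Rightarrow> ennreal)"
  define An where "An n = {x \<in> A. 1 / (real n + 1) \<le> infdist x C}" for n
  define R where "R k = {x \<in> A. 1 / (real k + 2) \<le> infdist x C \<and> infdist x C < 1 / (real k + 1)}" for k
  have tri: "infdist x C \<le> infdist y C + dist x y" for x y by (rule infdist_triangle)
  have sep: "\<exists>r>0. \<forall>x\<in>R (2*j+c). \<forall>y\<in>R (2*k+c). r \<le> dist x y" if "j < k" for j k c
  proof (intro exI conjI ballI)
    let ?r = "1 / (real (2*j+c) + 2) - 1 / (real (2*k+c) + 1)"
    have "real (2*j+c) + 2 < real (2*k+c) + 1" using that by simp
    then show "?r > 0" by (simp add: frac_less2)
    fix x y assume "x \<in> R (2*j+c)" "y \<in> R (2*k+c)"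
    then show "?r \<le> dist x y" using tri[of x y] unfolding R_def by simp
  qed
  \<comment> \<open>\<open>c\<close> selects the even or the odd shells\<close>
  have half: "(\<Sum>k<n. m (R (2*k+c))) \<le> m A" for n c
  proof -
    have "(\<Sum>k<n. m (R (2*k+c))) = m (\<Union>k<n. R (2*k+c))"
      unfolding m_def by (rule hausdorff_measure_separated_family[OF s sep])
    also have "\<dots> \<le> m A" unfolding m_def by (rule hausdorff_measure_mono) (auto simp: R_def)
    finally show ?thesis .
  qed
  have dbl: "(\<Sum>k<2*n. m (R k)) = (\<Sum>k<n. m (R (2*k+0))) + (\<Sum>k<n. m (R (2*k+1)))" for n
    by (induction n) (auto simp: algebra_simps)
  have "(\<Sum>k<n. m (R k)) \<le> m A + m A" for n
  proof -
    have "(\<Sum>k<n. m (R k)) \<le> (\<Sum>k<2*n. m (R k))" by (rule sum_mono2) auto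
    also have "\<dots> \<le> m A + m A" unfolding dbl by (intro add_mono half)
    finally show ?thesis .
  qed
  then have "(\<Sum>k. m (R k)) \<le> m A + m A" by (intro suminf_le_const) auto
  also have "\<dots> < top" using fin by (simp add: m_def ennreal_add_eq_top less_top[symmetric])
  finally have sfin: "(\<Sum>k. m (R k)) < top" .
  define g where "g k = enn2real (m (R k))" for k
  have mR: "m (R k) = ennreal (g k)" for k
    using ennreal_suminf_lessD[OF sfin] by (simp add: g_def)
  have g0: "g k \<ge> 0" for k by (simp add: g_def)
  have "summable g"
    using sfin by (intro summable_suminf_not_top) (auto simp: mR g0 less_top)
  have "m (A \<inter> C) + m (A - C) \<le> m A"
  proof (rule ennreal_le_epsilon)
    fix e :: real assume e: "e > 0"
    obtain n where n: "norm (\<Sum>i. g (i + n)) < e"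
      using suminf_exist_split[OF e \<open>summable g\<close>] by blast
    have "m (A \<inter> C \<union> An n) = m (A \<inter> C) + m (An n)"
      unfolding m_def
    proof (rule hausdorff_measure_separated[OF s, of "1 / (real n + 1)"])
      fix x y assume xy: "x \<in> A \<inter> C" "y \<in> An n"
      then have "infdist y C \<le> dist y x" by (intro infdist_le) auto
      then show "1 / (real n + 1) \<le> dist x y" using xy unfolding An_def by (simp add: dist_commute)
    qed simp
    then have le: "m (A \<inter> C) + m (An n) \<le> m A"
      unfolding m_def by (metis (mono_tags, lifting) An_def Un_least hausdorff_measure_mono inf_le1 mem_Collect_eq subsetI)
    have "A - C \<subseteq> An n \<union> (\<Union>i. R (i + n))"
    proof
      fix x assume x: "x \<in> A - C"
      then have pos: "infdist x C > 0"
        using C ne infdist_nonneg[of x C] in_closed_iff_infdist_zero[of C x] by fastforce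
      show "x \<in> An n \<union> (\<Union>i. R (i + n))"
      proof (cases "x \<in> An n")
        case False
        then have lt: "infdist x C < 1 / (real n + 1)" using x by (simp add: An_def)
        obtain N :: nat where N: "1 / (real N + 1) < infdist x C"
          using nat_approx_posE[OF pos] by (metis Suc_eq_plus1 of_nat_1 of_nat_add)
        have ex: "1 / (real N + 2) \<le> infdist x C" using N by (smt (verit) frac_le of_nat_0_le_iff)
        define k where "k = (LEAST k. 1 / (real k + 2) \<le> infdist x C)"
        have k: "1 / (real k + 2) \<le> infdist x C" unfolding k_def using ex by (rule LeastI[of "\<lambda>k. 1 / (real k + 2) \<le> infdist x C"])
        have kn: "n \<le> k"
        proof (rule ccontr)
          assume "\<not> n \<le> k"
          then have "1 / (real n + 1) \<le> 1 / (real k + 2)" by (intro frac_le) auto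
          then show False using k lt by linarith
        qed
        have "infdist x C < 1 / (real k + 1)"
        proof (cases "k = n")
          case True
          then show ?thesis using lt by simp
        next
          case False
          then have "k - 1 < k" using kn by simp
          then have "\<not> 1 / (real (k - 1) + 2) \<le> infdist x C" unfolding k_def by (rule not_less_Least)
          moreover have "real (k - 1) + 2 = real k + 1" using \<open>k - 1 < k\<close> by (simp add: of_nat_diff)
          ultimately show ?thesis by (simp only: not_le)
        qed
        then have "x \<in> R ((k - n) + n)" using x k kn by (simp add: R_def)
        then show ?thesis by blast
      qed simp
    qed
    then have "m (A - C) \<le> m (An n) + m (\<Union>i. R (i + n))"
      unfolding m_def by (rule order_trans[OF hausdorff_measure_mono hausdorff_measure_Un_le])
    also have "m (\<Union>i. R (i + n)) \<le> (\<Sum>i. m (R (i + n)))"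
      unfolding m_def by (rule hausdorff_measure_UN_le)
    also have "(\<Sum>i. m (R (i + n))) = ennreal (\<Sum>i. g (i + n))"
      unfolding mR using g0 \<open>summable g\<close> by (intro suminf_ennreal2) (auto simp: summable_iff_shift)
    also have "\<dots> \<le> ennreal e" using n by (intro ennreal_leI) simp
    finally have "m (A - C) \<le> m (An n) + ennreal e" by (simp add: add_left_mono)
    then have "m (A \<inter> C) + m (A - C) \<le> m (A \<inter> C) + (m (An n) + ennreal e)" by (rule add_left_mono)
    also have "\<dots> \<le> m A + ennreal e" using le by (simp add: add.assoc[symmetric] add_right_mono)
    finally show "m (A \<inter> C) + m (A - C) \<le> m A + ennreal e" .
  qed
  then show ?thesis by (simp add: m_def)
qed

text \<open>
  By the criterion, closed sets are measurable for the outer measure \<open>\<lambda>A. hausdorff_measure s (A \<inter> T)\<close>, hence so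
  are all Borel sets.
\<close>

lemma hausdorff_measure_restricted_measure_space:
  fixes T :: "'a::metric_space set"
  assumes s: "s \<ge> 0"
  shows "measure_space UNIV (sets borel) (\<lambda>A. hausdorff_measure s (A \<inter> T))"
proof -
  let ?f = "\<lambda>A. hausdorff_measure s (A \<inter> T)"
  have oms: "outer_measure_space (Pow UNIV) ?f"
    unfolding outer_measure_space_def positive_def increasing_def countably_subadditive_def
  proof (intro conjI allI impI ballI)
    show "?f A \<le> ?f B" if "A \<subseteq> B" for A B by (rule hausdorff_measure_mono) (use that in auto)
    show "?f (\<Union>i. A i) \<le> (\<Sum>i. ?f (A i))" for A :: "nat \<Rightarrow> _"
      using hausdorff_measure_UN_le[of s "\<lambda>i. A i \<inter> T"] by simp
  qed simp
  interpret P: sigma_algebra UNIV "Pow (UNIV :: 'a set)" by (rule sigma_algebra_Pow)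
  have ms: "measure_space UNIV (lambda_system UNIV (Pow UNIV) ?f) ?f"
    by (rule P.caratheodory_lemma[OF oms])
  then interpret L: sigma_algebra UNIV "lambda_system UNIV (Pow UNIV) ?f"
    by (simp add: measure_space_def)
  have "C \<in> lambda_system UNIV (Pow UNIV) ?f" if "closed C" for C
  proof -
    have "?f (C \<inter> A) + ?f ((UNIV - C) \<inter> A) = ?f A" for A
    proof (rule antisym)
      have eq: "C \<inter> A \<inter> T = A \<inter> T \<inter> C" "(UNIV - C) \<inter> A \<inter> T = A \<inter> T - C" by auto
      show "?f (C \<inter> A) + ?f ((UNIV - C) \<inter> A) \<le> ?f A"
        unfolding eq by (rule hausdorff_measure_closed_split[OF s that])
      show "?f A \<le> ?f (C \<inter> A) + ?f ((UNIV - C) \<inter> A)"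
        unfolding eq using hausdorff_measure_Un_le[of s "A \<inter> T \<inter> C" "A \<inter> T - C"]
        by (simp add: Int_Diff_Un)
    qed
    then show ?thesis unfolding lambda_system_def by auto
  qed
  then have "sigma_sets UNIV (Collect closed) \<subseteq> lambda_system UNIV (Pow UNIV) ?f"
    by (intro L.sigma_sets_subset) auto
  then have "sets borel \<subseteq> lambda_system UNIV (Pow UNIV) ?f"
    by (simp add: borel_eq_closed)
  then show ?thesis
    using measure_down[OF ms, of "sets borel"] sets.sigma_algebra_axioms[of "borel :: 'a measure"] by simp
qed

text \<open>
  Approximation from both sides by a closed and an open set is stable under complements and countable unions.
  Open sets have the property because they are increasing unions of closed sets.
\<close>

lemma finite_borel_measure_regular:
  fixes M :: "'a::metric_space measure"
  assumes M: "finite_measure M" "sets M = sets borel" and A: "A \<in> sets borel" and e: "e > 0"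
  shows "\<exists>C U. closed C \<and> open U \<and> C \<subseteq> A \<and> A \<subseteq> U \<and> measure M (U - C) < e"
proof -
  interpret finite_measure M by fact
  have bM: "X \<in> sets borel \<Longrightarrow> X \<in> sets M" for X using M by simp
  have "A \<in> sigma_sets UNIV {S. open S}" using A by (simp add: borel_def)
  then have "\<forall>e>0. \<exists>C U. closed C \<and> open U \<and> C \<subseteq> A \<and> A \<subseteq> U \<and> measure M (U - C) < e"
  proof induction
    case (Basic A)
    show ?case
    proof (intro allI impI)
      fix e :: real assume e: "e > 0"
      show "\<exists>C U. closed C \<and> open U \<and> C \<subseteq> A \<and> A \<subseteq> U \<and> measure M (U - C) < e"
      proof (cases "A = UNIV")
        case True
        then show ?thesis using e by (intro exI[of _ UNIV]) auto
      next
        case False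
        then have ne: "- A \<noteq> {}" by auto
        have op: "open A" using Basic by simp
        define C where "C n = {x. 1 / (real n + 1) \<le> infdist x (- A)}" for n
        have cl: "closed (C n)" for n
          unfolding C_def by (intro closed_Collect_le continuous_intros)
        have sub: "C n \<subseteq> A" for n
        proof
          fix x assume x: "x \<in> C n"
          show "x \<in> A"
          proof (rule ccontr)
            assume "x \<notin> A"
            then have "infdist x (- A) = 0" by simp
            moreover have "1 / (real n + 1) > 0" by simp
            ultimately show False using x unfolding C_def by simp
          qed
        qed
        have "(\<lambda>n. measure M (A - C n)) \<longlonglongrightarrow> measure M (\<Inter>n. A - C n)"
        proof (rule finite_Lim_measure_decseq)
          show "range (\<lambda>n. A - C n) \<subseteq> sets M" using op cl by (auto intro!: bM)
          show "decseq (\<lambda>n. A - C n)"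
          proof (rule decseq_SucI)
            fix n
            have "1 / (real (Suc n) + 1) \<le> 1 / (real n + 1)" by (intro frac_le) auto
            then show "A - C (Suc n) \<subseteq> A - C n" unfolding C_def by auto
          qed
        qed
        moreover have "(\<Inter>n. A - C n) = {}"
        proof -
          have False if "x \<in> (\<Inter>n. A - C n)" for x
          proof -
            have "closed (- A)" "x \<notin> - A" using op that by auto
            then have "infdist x (- A) > 0"
              using ne infdist_nonneg[of x "- A"] in_closed_iff_infdist_zero[of "- A" x] by fastforce
            then obtain N :: nat where "1 / (real N + 1) < infdist x (- A)"
              using nat_approx_posE by (metis Suc_eq_plus1 of_nat_1 of_nat_add)
            then have "x \<in> C N" by (simp add: C_def)
            then show False using that by blast
          qed
          then show ?thesis by blast
        qed
        ultimately have "(\<lambda>n. measure M (A - C n)) \<longlonglongrightarrow> 0" by (simp only: measure_empty)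
        then obtain n where "measure M (A - C n) < e"
          using LIMSEQ_0_less[OF _ e] by blast
        then show ?thesis using op cl sub by blast
      qed
    qed
  next
    case Empty
    show ?case
    proof (intro allI impI)
      fix e :: real assume "e > 0"
      then show "\<exists>C U. closed C \<and> open U \<and> C \<subseteq> {} \<and> {} \<subseteq> U \<and> measure M (U - C) < e"
        by (rule_tac exI[of _ "{}"], rule_tac exI[of _ "{}"]) simp
    qed
  next
    case (Compl A)
    show ?case
    proof (intro allI impI)
      fix e :: real assume "e > 0"
      from Compl.IH[rule_format, OF this]
      obtain C U where *: "closed C" "open U" "C \<subseteq> A" "A \<subseteq> U" "measure M (U - C) < e"
        by (elim exE conjE)
      have eq: "- C - - U = U - C" "- C \<inter> U = U - C" by auto
      show "\<exists>C U. closed C \<and> open U \<and> C \<subseteq> UNIV - A \<and> UNIV - A \<subseteq> U \<and> measure M (U - C) < e"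
        by (rule exI[of _ "- U"], rule exI[of _ "- C"]) (use * in \<open>auto simp: eq\<close>)
    qed
  next
    case (Union A)
    show ?case
    proof (intro allI impI)
      fix e :: real assume e: "e > 0"
      have "\<forall>n. \<exists>C U. closed C \<and> open U \<and> C \<subseteq> A n \<and> A n \<subseteq> U \<and> measure M (U - C) < e / 2 * (1/2)^Suc n"
      proof
        fix n
        have "e / 2 * (1/2)^Suc n > 0" using e by simp
        then show "\<exists>C U. closed C \<and> open U \<and> C \<subseteq> A n \<and> A n \<subseteq> U \<and> measure M (U - C) < e / 2 * (1/2)^Suc n"
          by (rule Union.IH[rule_format])
      qed
      from choice[OF this] obtain C where "\<forall>n. \<exists>U. closed (C n) \<and> open U \<and> C n \<subseteq> A n \<and> A n \<subseteq> U \<and> measure M (U - C n) < e / 2 * (1/2)^Suc n" ..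
      from choice[OF this] obtain U where "\<forall>n. closed (C n) \<and> open (U n) \<and> C n \<subseteq> A n \<and> A n \<subseteq> U n \<and> measure M (U n - C n) < e / 2 * (1/2)^Suc n" ..
      then have CU: "\<And>n. closed (C n)" "\<And>n. open (U n)" "\<And>n. C n \<subseteq> A n" "\<And>n. A n \<subseteq> U n"
          "\<And>n. measure M (U n - C n) < e / 2 * (1/2)^Suc n"
        by auto
      define D where "D N = (\<Union>n<N. C n)" for N
      have cD: "closed (D N)" for N unfolding D_def using CU(1) by (intro closed_UN) auto
      have bC: "C n \<in> sets borel" "U n \<in> sets borel" for n using CU(1,2) by auto
      have "(\<lambda>N. measure M ((\<Union>n. C n) - D N)) \<longlonglongrightarrow> measure M (\<Inter>N. (\<Union>n. C n) - D N)"
      proof (rule finite_Lim_measure_decseq)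
        show "range (\<lambda>N. (\<Union>n. C n) - D N) \<subseteq> sets M" using cD bC by (auto intro!: bM)
        show "decseq (\<lambda>N. (\<Union>n. C n) - D N)"
          by (rule decseq_SucI) (auto simp: D_def lessThan_Suc)
      qed
      moreover have "(\<Inter>N. (\<Union>n. C n) - D N) = {}" by (auto simp: D_def)
      ultimately have "(\<lambda>N. measure M ((\<Union>n. C n) - D N)) \<longlonglongrightarrow> 0" by (simp only: measure_empty)
      moreover have "e / 2 > 0" using e by simp
      ultimately obtain N where N: "measure M ((\<Union>n. C n) - D N) < e / 2"
        using LIMSEQ_0_less by blast
      have sums: "(\<lambda>n. e / 2 * (1/2)^Suc n) sums (e / 2)"
        using sums_mult[OF power_half_series, of "e / 2"] by simp
      have summ: "summable (\<lambda>n. measure M (U n - C n))"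
        by (rule summable_comparison_test'[OF sums_summable[OF sums], of 0]) (use CU(5) in \<open>auto simp: less_imp_le\<close>)
      have sU: "(\<Union>n. U n - C n) \<in> sets M" using bC by (intro bM) auto
      have sC: "(\<Union>n. C n) - D N \<in> sets M" using bC cD[of N] by (intro bM) auto
      have "measure M ((\<Union>n. U n) - D N) \<le> measure M ((\<Union>n. U n - C n) \<union> ((\<Union>n. C n) - D N))"
        by (rule finite_measure_mono) (use sU sC in auto)
      also have "\<dots> \<le> measure M (\<Union>n. U n - C n) + measure M ((\<Union>n. C n) - D N)"
        by (rule measure_Un_le[OF sU sC])
      also have "measure M (\<Union>n. U n - C n) \<le> (\<Sum>n. measure M (U n - C n))"
        by (rule finite_measure_subadditive_countably[OF _ summ]) (use bC in \<open>auto intro!: bM\<close>)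
      also have "\<dots> \<le> (\<Sum>n. e / 2 * (1/2)^Suc n)"
        by (rule suminf_le[OF _ summ sums_summable[OF sums]]) (use CU(5) in \<open>auto simp: less_imp_le\<close>)
      also have "\<dots> = e / 2" using sums by (rule sums_unique[symmetric])
      finally have "measure M ((\<Union>n. U n) - D N) < e" using N by simp
      moreover have "D N \<subseteq> (\<Union>n. A n)" unfolding D_def using CU(3) by blast
      moreover have "(\<Union>n. A n) \<subseteq> (\<Union>n. U n)" using CU(4) by blast
      moreover have "open (\<Union>n. U n)" using CU(2) by auto
      ultimately show "\<exists>C U'. closed C \<and> open U' \<and> C \<subseteq> (\<Union>n. A n) \<and> (\<Union>n. A n) \<subseteq> U' \<and> measure M (U' - C) < e"
        by (intro exI[of _ "D N"] exI[of _ "\<Union>n. U n"] conjI cD)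
    qed
  qed
  from this[rule_format, OF e] show ?thesis .
qed

text \<open>
  Finite measure makes \<open>T\<close> separable: it has countable covers by sets of arbitrarily small diameter. Finitely
  many closures of each such cover exhaust \<open>T\<close> up to a small error. Their intersection over all scales is totally
  bounded, and intersected with a closed approximation of \<open>T\<close> it is compact because the space is complete.
\<close>

lemma hausdorff_measure_inner_compact:
  fixes T :: "'a::complete_space set"
  assumes s: "s \<ge> 0" and T: "T \<in> sets borel" and fin: "hausdorff_measure s T < top" and e: "e > 0"
  obtains K where "compact K" "K \<subseteq> T" "hausdorff_measure s (T - K) < ennreal e"
proof -
  let ?f = "\<lambda>A. hausdorff_measure s (A \<inter> T)"
  define M where "M = measure_of UNIV (sets borel) ?f"
  have ms: "measure_space UNIV (sets borel) ?f" by (rule hausdorff_measure_restricted_measure_space[OF s])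
  have setsM [simp]: "sets M = sets borel"
    unfolding M_def using sets.sets_measure_of_eq[of "borel :: 'a measure"] by simp
  have spM [simp]: "space M = UNIV" unfolding M_def by (simp add: space_measure_of_conv)
  have em: "emeasure M A = ?f A" if "A \<in> sets borel" for A
    unfolding M_def using ms that unfolding measure_space_def
    by (intro emeasure_measure_of_sigma) auto
  have "finite_measure M"
    by (rule finite_measureI) (use fin in \<open>simp add: em\<close>)
  then interpret finite_measure M .
  have bM: "X \<in> sets borel \<Longrightarrow> X \<in> sets M" for X by simp
  obtain C where C: "closed C" "C \<subseteq> T" "measure M (T - C) < e / 2"
  proof -
    obtain C U where CU: "closed C" "open U" "C \<subseteq> T" "T \<subseteq> U" "measure M (U - C) < e / 2"
      using finite_borel_measure_regular[OF \<open>finite_measure M\<close> setsM T, of "e / 2"] e by auto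
    have "measure M (T - C) \<le> measure M (U - C)"
      by (rule finite_measure_mono) (use CU in auto)
    then show ?thesis using that[of C] CU by auto
  qed
  have "\<exists>V. closed V \<and> (\<exists>F. finite F \<and> V \<subseteq> (\<Union>x\<in>F. ball x (2 / (real k + 1)))) \<and> measure M (T - V) < e / 2 * (1/2)^Suc k"
    for k :: nat
  proof -
    have "hausdorff_content s (1 / (real k + 1)) T < top"
      by (rule le_less_trans[OF hausdorff_content_le_measure fin]) simp
    then have "\<exists>U. T \<subseteq> (\<Union>j::nat. U j) \<and> (\<forall>j. bounded (U j) \<and> diameter (U j) \<le> 1 / (real k + 1))"
      unfolding hausdorff_content_def Inf_less_iff by auto
    then obtain U :: "nat \<Rightarrow> 'a set" where U0: "T \<subseteq> (\<Union>j. U j)" "\<forall>j. bounded (U j) \<and> diameter (U j) \<le> 1 / (real k + 1)"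
      by (elim exE conjE)
    then have U: "T \<subseteq> (\<Union>j. U j)" "\<And>j. bounded (U j)" "\<And>j. diameter (U j) \<le> 1 / (real k + 1)" by simp_all
    define V where "V n = (\<Union>j<n. closure (U j))" for n :: nat
    have cV: "closed (V n)" for n unfolding V_def by (intro closed_UN) auto
    have "(\<lambda>n. measure M (T - V n)) \<longlonglongrightarrow> measure M (\<Inter>n. T - V n)"
    proof (rule finite_Lim_measure_decseq)
      show "range (\<lambda>n. T - V n) \<subseteq> sets M" using cV T by auto
      show "decseq (\<lambda>n. T - V n)"
        by (rule decseq_SucI) (auto simp: V_def lessThan_Suc)
    qed
    moreover have "(\<Inter>n. T - V n) = {}"
    proof -
      have "x \<in> V (Suc j)" if "x \<in> U j" for x j
        unfolding V_def using that closure_subset[of "U j"] by auto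
      note inV = this
      have "\<exists>n. x \<in> V n" if "x \<in> T" for x
      proof -
        from subsetD[OF U0(1) that] obtain j where "x \<in> U j" by (rule UN_E)
        from inV[OF this] show ?thesis by (rule exI)
      qed
      then show ?thesis by auto
    qed
    ultimately have "(\<lambda>n. measure M (T - V n)) \<longlonglongrightarrow> 0" by (simp only: measure_empty)
    moreover have "e / 2 * (1/2)^Suc k > 0" using e by simp
    ultimately obtain n where n: "measure M (T - V n) < e / 2 * (1/2)^Suc k"
      using LIMSEQ_0_less by blast
    have "\<exists>F. finite F \<and> V n \<subseteq> (\<Union>x\<in>F. ball x (2 / (real k + 1)))"
    proof -
      define p where "p j = (SOME x. x \<in> closure (U j))" for j
      have "closure (U j) \<subseteq> ball (p j) (2 / (real k + 1))" for j
      proof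
        fix x assume x: "x \<in> closure (U j)"
        then have "p j \<in> closure (U j)" unfolding p_def by (rule someI)
        then have "dist (p j) x \<le> diameter (closure (U j))"
          using x U(2) by (intro diameter_bounded_bound) auto
        also have "\<dots> \<le> 1 / (real k + 1)" using U(2,3) by (simp add: diameter_closure)
        also have "\<dots> < 2 / (real k + 1)" by (simp add: divide_strict_right_mono)
        finally show "x \<in> ball (p j) (2 / (real k + 1))" by simp
      qed
      then have "V n \<subseteq> (\<Union>x\<in>p ` {..<n}. ball x (2 / (real k + 1)))" unfolding V_def by blast
      then show ?thesis by (intro exI[of _ "p ` {..<n}"]) auto
    qed
    then show ?thesis using n cV by blast
  qed
  then obtain V where V: "\<And>k. closed (V k)" "\<And>k. \<exists>F. finite F \<and> V k \<subseteq> (\<Union>x\<in>F. ball x (2 / (real k + 1)))"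
      "\<And>k. measure M (T - V k) < e / 2 * (1/2)^Suc k"
    by metis
  define K where "K = C \<inter> (\<Inter>k. V k)"
  have "closed K" unfolding K_def using C V by auto
  have "compact K"
    unfolding compact_eq_totally_bounded
  proof (intro conjI allI impI)
    show "complete K" using \<open>closed K\<close> by (simp add: complete_eq_closed)
    fix r :: real assume r: "r > 0"
    then obtain k :: nat where "1 / (real k + 1) < r / 2"
      using nat_approx_posE[of "r / 2"] by (metis Suc_eq_plus1 half_gt_zero of_nat_1 of_nat_add)
    then have k: "2 / (real k + 1) \<le> r" by simp
    obtain F where F: "finite F" "V k \<subseteq> (\<Union>x\<in>F. ball x (2 / (real k + 1)))" using V(2) by blast
    have "K \<subseteq> V k" unfolding K_def by blast
    also have "\<dots> \<subseteq> (\<Union>x\<in>F. ball x r)"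
      using F(2) subset_ball[OF k] by blast
    finally show "\<exists>F. finite F \<and> K \<subseteq> (\<Union>x\<in>F. ball x r)" using F(1) by blast
  qed
  moreover have "K \<subseteq> T" using C unfolding K_def by blast
  moreover have "hausdorff_measure s (T - K) < ennreal e"
  proof -
    have sums: "(\<lambda>n. e / 2 * (1/2)^Suc n) sums (e / 2)"
      using sums_mult[OF power_half_series, of "e / 2"] by simp
    have summ: "summable (\<lambda>n. measure M (T - V n))"
      by (rule summable_comparison_test'[OF sums_summable[OF sums], of 0]) (use V(3) in \<open>auto simp: less_imp_le\<close>)
    have sV: "(\<Union>n. T - V n) \<in> sets M" using T V(1) by (intro bM) auto
    have sC: "T - C \<in> sets M" using T C by (intro bM) auto
    have "measure M (T - K) \<le> measure M ((\<Union>n. T - V n) \<union> (T - C))"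
      by (rule finite_measure_mono) (use sV sC in \<open>auto simp: K_def\<close>)
    also have "\<dots> \<le> measure M (\<Union>n. T - V n) + measure M (T - C)"
      by (rule measure_Un_le[OF sV sC])
    also have "measure M (\<Union>n. T - V n) \<le> (\<Sum>n. measure M (T - V n))"
      by (rule finite_measure_subadditive_countably[OF _ summ]) (use V(1) T in auto)
    also have "\<dots> \<le> (\<Sum>n. e / 2 * (1/2)^Suc n)"
      by (rule suminf_le[OF _ summ sums_summable[OF sums]]) (use V(3) in \<open>auto simp: less_imp_le\<close>)
    also have "\<dots> = e / 2" using sums by (rule sums_unique[symmetric])
    finally have "measure M (T - K) < e" using C(3) by simp
    moreover have "T - K \<in> sets borel" using T \<open>closed K\<close> by auto
    then have "hausdorff_measure s (T - K) = ennreal (measure M (T - K))"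
      using em[of "T - K"] emeasure_eq_measure[of "T - K"] by (simp add: Int_absorb2 Diff_subset)
    ultimately show ?thesis using e by (simp add: ennreal_lessI)
  qed
  ultimately show ?thesis by (rule that)
qed

section \<open>One-dimensional Hausdorff measure on the line\<close>

lemma hausdorff_content_countable_UN_le:
  fixes A :: "'i \<Rightarrow> 'a::metric_space set"
  assumes I: "countable I" and \<delta>: "\<delta> \<ge> 0"
  shows "hausdorff_content s \<delta> (\<Union>i\<in>I. A i) \<le> (\<integral>\<^sup>+ i. hausdorff_content s \<delta> (A i) \<partial>count_space I)"
proof -
  define N where "N = to_nat_on I ` I"
  have bij: "bij_betw (from_nat_into I) N I"
    unfolding N_def by (rule bij_betw_byWitness[where f' = "to_nat_on I"]) (use I in auto)
  let ?B = "\<lambda>n. if n \<in> N then A (from_nat_into I n) else {}"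
  have "(\<Union>i\<in>I. A i) = (\<Union>i\<in>from_nat_into I ` N. A i)" using bij by (simp add: bij_betw_def)
  also have "\<dots> = (\<Union>n. ?B n)" by (auto split: if_splits)
  finally have "hausdorff_content s \<delta> (\<Union>i\<in>I. A i) \<le> (\<Sum>n. hausdorff_content s \<delta> (?B n))"
    using hausdorff_content_UN_le[of s \<delta> ?B] by simp
  also have "\<dots> = (\<integral>\<^sup>+ n. hausdorff_content s \<delta> (?B n) \<partial>count_space UNIV)"
    by (rule nn_integral_count_space_nat[symmetric])
  also have "\<dots> = (\<integral>\<^sup>+ n. hausdorff_content s \<delta> (A (from_nat_into I n)) * indicator N n \<partial>count_space UNIV)"
    by (intro nn_integral_cong) (auto simp: \<delta> indicator_def)
  also have "\<dots> = (\<integral>\<^sup>+ n. hausdorff_content s \<delta> (A (from_nat_into I n)) \<partial>count_space N)"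
    by (rule nn_integral_count_space_indicator[symmetric]) simp
  also have "\<dots> = (\<integral>\<^sup>+ i. hausdorff_content s \<delta> (A i) \<partial>count_space I)"
    by (rule nn_integral_bij_count_space[OF bij])
  finally show ?thesis .
qed

text \<open>
  A null set is contained in an open set of small measure. The five-times covering lemma turns a cover by small
  balls inside that open set into a cover whose total diameter is controlled by disjoint balls.
\<close>

lemma negligible_imp_hausdorff_measure_1_null:
  fixes N :: "real set"
  assumes N: "negligible N"
  shows "hausdorff_measure 1 N = 0"
proof -
  have "hausdorff_content 1 \<delta> N \<le> 0" if \<delta>: "\<delta> > 0" for \<delta>
  proof (rule ennreal_le_epsilon)
    fix e :: real assume e: "e > 0"
    have "e / 5 > 0" using e by simp
    then obtain T where T: "open T" "N \<subseteq> T" "T - N \<in> lmeasurable" "emeasure lebesgue (T - N) < ennreal (e / 5)"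
      by (rule sets_lebesgue_outer_open[OF negligible_imp_sets[OF N]])
    have eT: "emeasure lebesgue T < ennreal (e / 5)"
    proof -
      have "emeasure lebesgue T \<le> emeasure lebesgue ((T - N) \<union> N)"
        using T N by (intro emeasure_mono) (auto simp: negligible_imp_sets fmeasurableD)
      also have "\<dots> \<le> emeasure lebesgue (T - N) + emeasure lebesgue N"
        using T N by (intro emeasure_subadditive) (auto simp: negligible_imp_sets fmeasurableD)
      also have "emeasure lebesgue N = 0"
        using N by (simp add: negligible_iff_null_sets null_sets_def)
      finally show ?thesis using T(4) by simp
    qed
    define J where "J = {(x, r). x \<in> N \<and> 0 < r \<and> r \<le> \<delta> / 10 \<and> cball x r \<subseteq> T}"
    obtain C where C: "countable C" "C \<subseteq> J" "pairwise (\<lambda>i j. disjnt (cball (fst i) (snd i)) (cball (fst j) (snd j))) C"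
        "N \<subseteq> (\<Union>i\<in>C. cball (fst i) (5 * snd i))"
    proof (rule Vitali_covering_lemma_cballs[where S = N and K = J and a = fst and r = snd and B = "\<delta> / 10"])
      show "N \<subseteq> (\<Union>i\<in>J. cball (fst i) (snd i))"
      proof
        fix x assume x: "x \<in> N"
        then obtain r where r: "r > 0" "cball x r \<subseteq> T"
          using T open_contains_cball by (metis subsetD)
        then have "(x, min r (\<delta> / 10)) \<in> J"
          using x \<delta> unfolding J_def by (auto intro: order_trans[OF subset_cball])
        then show "x \<in> (\<Union>i\<in>J. cball (fst i) (snd i))"
          using r \<delta> by (intro UN_I[of "(x, min r (\<delta> / 10))"]) auto
      qed
      show "0 < snd i \<and> snd i \<le> \<delta> / 10" if "i \<in> J" for i using that by (auto simp: J_def)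
    qed (use that in blast)
    have "hausdorff_content 1 \<delta> N \<le> hausdorff_content 1 \<delta> (\<Union>i\<in>C. cball (fst i) (5 * snd i))"
      by (rule hausdorff_content_mono[OF C(4)])
    also have "\<dots> \<le> (\<integral>\<^sup>+ i. hausdorff_content 1 \<delta> (cball (fst i) (5 * snd i)) \<partial>count_space C)"
      using C(1) \<delta> by (intro hausdorff_content_countable_UN_le) auto
    also have "\<dots> \<le> (\<integral>\<^sup>+ i. 5 * emeasure lebesgue (cball (fst i) (snd i)) \<partial>count_space C)"
    proof (rule nn_integral_mono)
      fix i assume "i \<in> space (count_space C)"
      then have i: "0 < snd i" "snd i \<le> \<delta> / 10" using C(2) by (auto simp: J_def)
      have d: "diameter (cball (fst i) (5 * snd i)) = 10 * snd i" using i by (simp add: diameter_cball)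
      have "hausdorff_content 1 \<delta> (cball (fst i) (5 * snd i)) \<le> ennreal (10 * snd i)"
        using hausdorff_content_single_le[of "cball (fst i) (5 * snd i)" \<delta> 1] i \<delta> by (simp add: d)
      also have "10 * snd i = 5 * (2 * snd i)" by simp
      also have "ennreal (5 * (2 * snd i)) = 5 * ennreal (2 * snd i)"
        using i by (subst ennreal_mult) auto
      also have "ennreal (2 * snd i) = emeasure lebesgue (cball (fst i) (snd i))"
        using i by (simp add: cball_eq_atLeastAtMost)
      finally show "hausdorff_content 1 \<delta> (cball (fst i) (5 * snd i)) \<le> 5 * emeasure lebesgue (cball (fst i) (snd i))" .
    qed
    also have "\<dots> = 5 * (\<integral>\<^sup>+ i. emeasure lebesgue (cball (fst i) (snd i)) \<partial>count_space C)"
      by (rule nn_integral_cmult) simp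
    also have "(\<integral>\<^sup>+ i. emeasure lebesgue (cball (fst i) (snd i)) \<partial>count_space C)
        = emeasure lebesgue (\<Union>i\<in>C. cball (fst i) (snd i))"
      by (rule emeasure_UN_countable[symmetric])
        (use C in \<open>auto simp: disjoint_family_on_def pairwise_def disjnt_def\<close>)
    also have "\<dots> \<le> emeasure lebesgue T"
    proof (rule emeasure_mono)
      have "cball (fst i) (snd i) \<subseteq> T" if "i \<in> C" for i using subsetD[OF C(2) that] unfolding J_def by (cases i) auto
      then show "(\<Union>i\<in>C. cball (fst i) (snd i)) \<subseteq> T" by (rule UN_least)
    qed (use T in auto)
    also have "5 * emeasure lebesgue T \<le> 5 * ennreal (e / 5)"
      using eT by (intro mult_left_mono) auto
    also have "5 * ennreal (e / 5) = ennreal (5 * (e / 5))"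
      using e by (subst ennreal_mult) auto
    finally show "hausdorff_content 1 \<delta> N \<le> 0 + ennreal e" by (simp add: mult_left_mono)
  qed
  then show ?thesis
    using hausdorff_measure_le_if[of 1 1 N 0] by (simp add: le_zero_eq)
qed

text \<open>
  A set of diameter \<open>h\<close> lies in a ball of radius \<open>h\<close>, which has Lebesgue measure \<open>2 * h\<close>; the factor \<open>2\<close> is
  harmless for positivity.
\<close>

lemma hausdorff_measure_1_interval_pos:
  assumes e: "e > 0"
  shows "hausdorff_measure 1 {0..e::real} > 0"
proof -
  have "ennreal (e / 2) \<le> hausdorff_content 1 1 {0..e}"
    unfolding hausdorff_content_def
  proof (rule Inf_greatest, safe)
    fix U :: "nat \<Rightarrow> real set"
    assume U: "{0..e} \<subseteq> (\<Union>i. U i)" "\<forall>i. bounded (U i) \<and> diameter (U i) \<le> 1"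
    define I where "I i = (if U i = {} then {} else cball (SOME x. x \<in> U i) (diameter (U i)))" for i
    have bI: "I i \<in> sets lborel" for i by (simp add: I_def)
    have UI: "U i \<subseteq> I i" for i
    proof
      fix x assume x: "x \<in> U i"
      then have "(SOME x. x \<in> U i) \<in> U i" by (rule someI)
      then have "dist (SOME x. x \<in> U i) x \<le> diameter (U i)"
        using x U(2) by (intro diameter_bounded_bound) auto
      then show "x \<in> I i" using x by (auto simp: I_def)
    qed
    have mI: "emeasure lborel (I i) \<le> 2 * ennreal (diameter (U i) powr 1)" for i
    proof (cases "U i = {}")
      case False
      have "diameter (U i) \<ge> 0" using U(2) by (intro diameter_ge_0) auto
      then show ?thesis using False
        by (simp add: I_def cball_eq_atLeastAtMost) (subst ennreal_mult, auto)
    qed (simp add: I_def)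
    have "ennreal e = emeasure lborel {0..e}" using e by simp
    also have "\<dots> \<le> emeasure lborel (\<Union>i. I i)"
      using U(1) UI bI by (intro emeasure_mono) blast+
    also have "\<dots> \<le> (\<Sum>i. emeasure lborel (I i))"
      by (rule emeasure_subadditive_countably) (use bI in auto)
    also have "\<dots> \<le> (\<Sum>i. 2 * ennreal (diameter (U i) powr 1))"
      by (intro suminf_le allI mI) auto
    also have "\<dots> = 2 * (\<Sum>i. ennreal (diameter (U i) powr 1))" by simp
    finally have "ennreal e / 2 \<le> (2 * (\<Sum>i. ennreal (diameter (U i) powr 1))) / 2"
      by (rule divide_right_mono_ennreal)
    also have "\<dots> = (\<Sum>i. ennreal (diameter (U i) powr 1))"
      by (simp add: ennreal_mult_divide_eq mult.commute[of 2])
    also have "ennreal e / 2 = ennreal (e / 2)" using e by (subst divide_ennreal[symmetric]) auto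
    finally show "ennreal (e / 2) \<le> (\<Sum>i. ennreal (diameter (U i) powr 1))" .
  qed
  also have "\<dots> \<le> hausdorff_measure 1 {0..e}" by (rule hausdorff_content_le_measure) simp
  finally show ?thesis using e by (metis ennreal_less_zero_iff half_gt_zero order_less_le_trans)
qed

section \<open>Differentiability of Lipschitz functions on the line\<close>

text \<open>
  The Vitali covering theorem for intervals given by their endpoints. The endpoints form a countable set, so the
  open intervals already cover up to a null set.
\<close>

lemma Vitali_covering_intervals:
  fixes A G :: "real set"
  assumes G: "open G" "A \<subseteq> G"
    and R: "\<And>t r. t \<in> A \<Longrightarrow> 0 < r \<Longrightarrow> \<exists>a b. a < b \<and> a \<le> t \<and> t \<le> b \<and> b - a < r \<and> R a b"
  obtains C where "countable C" "\<And>i. i \<in> C \<Longrightarrow> fst i < snd i \<and> {fst i..snd i} \<subseteq> G \<and> R (fst i) (snd i)"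
    "disjoint_family_on (\<lambda>i. {fst i..snd i}) C"
    "negligible (A - (\<Union>i\<in>C. {fst i<..<snd i}))"
proof -
  define J where "J = {i. fst i < snd i \<and> {fst i..snd i} \<subseteq> G \<and> R (fst i) (snd i)}"
  define c where "c i = (fst i + snd i) / 2" for i :: "real \<times> real"
  define \<rho> where "\<rho> i = (snd i - fst i) / 2" for i :: "real \<times> real"
  have cb: "cball (c i) (\<rho> i) = {fst i..snd i}" for i
    unfolding cball_eq_atLeastAtMost c_def \<rho>_def by (simp add: field_simps)
  obtain C where C: "countable C" "C \<subseteq> J" "pairwise (\<lambda>i j. disjnt (cball (c i) (\<rho> i)) (cball (c j) (\<rho> j))) C"
     "negligible (A - (\<Union>i \<in> C. cball (c i) (\<rho> i)))"
  proof (rule Vitali_covering_theorem_cballs[of J \<rho> A c])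
    show "0 < \<rho> i" if "i \<in> J" for i using that by (auto simp: J_def \<rho>_def)
    fix t d :: real assume t: "t \<in> A" and d: "0 < d"
    obtain e where e: "e > 0" "cball t e \<subseteq> G" using G t open_contains_cball by (metis subsetD)
    obtain a b where ab: "a < b" "a \<le> t" "t \<le> b" "b - a < min d e" "R a b"
      using R[OF t, of "min d e"] d e by auto
    have "{a..b} \<subseteq> cball t e" using ab by (auto simp: cball_eq_atLeastAtMost)
    then have "(a, b) \<in> J" using ab e by (auto simp: J_def)
    moreover have "t \<in> cball (c (a, b)) (\<rho> (a, b))" unfolding cb using ab by simp
    moreover have "\<rho> (a, b) < d" using ab by (simp add: \<rho>_def)
    ultimately show "\<exists>i. i \<in> J \<and> t \<in> cball (c i) (\<rho> i) \<and> \<rho> i < d" by blast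
  qed
  have "A - (\<Union>i\<in>C. {fst i<..<snd i}) \<subseteq> (A - (\<Union>i \<in> C. cball (c i) (\<rho> i))) \<union> (fst ` C \<union> snd ` C)"
    unfolding cb by force
  moreover have "negligible (fst ` C \<union> snd ` C)"
    using C(1) by (simp add: negligible_iff_null_sets countable_imp_null_set_lborel null_sets_completionI)
  ultimately have "negligible (A - (\<Union>i\<in>C. {fst i<..<snd i}))"
    using C(4) negligible_Un negligible_subset by metis
  moreover have "disjoint_family_on (\<lambda>i. {fst i..snd i}) C"
    using C(3) unfolding cb disjoint_family_on_def pairwise_def disjnt_def by blast
  ultimately show ?thesis using C(1,2) by (intro that[of C]) (auto simp: J_def)
qed

text \<open>
  The set \<open>E\<close> is covered first by disjoint intervals on which \<open>w\<close> has slope less than \<open>p\<close>, and then, inside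
  those, by disjoint intervals on which it has slope more than \<open>q\<close>. Comparing both families with the
  Lebesgue-Stieltjes measure of \<open>w\<close> shows that the second family is shorter by the factor \<open>p / q\<close>.
\<close>

lemma slopes_contraction:
  fixes w :: "real \<Rightarrow> real"
  assumes mono: "\<And>x y. x \<le> y \<Longrightarrow> w x \<le> w y" and cont: "continuous_on UNIV w"
    and pq: "0 < p" "p < q"
    and lo: "\<And>t r. t \<in> E \<Longrightarrow> 0 < r \<Longrightarrow> \<exists>a b. a < b \<and> a \<le> t \<and> t \<le> b \<and> b - a < r \<and> w b - w a < p * (b - a)"
    and hi: "\<And>t r. t \<in> E \<Longrightarrow> 0 < r \<Longrightarrow> \<exists>a b. a < b \<and> a \<le> t \<and> t \<le> b \<and> b - a < r \<and> w b - w a > q * (b - a)"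
    and G: "open G" "negligible (E - G)"
  shows "\<exists>G'. open G' \<and> negligible (E - G') \<and> ennreal q * emeasure lborel G' \<le> ennreal p * emeasure lborel G"
proof -
  let ?\<nu> = "interval_measure w"
  have icc: "emeasure ?\<nu> {a..b} = ennreal (w b - w a)" if "a \<le> b" for a b
    by (rule emeasure_interval_measure_Icc[OF that mono cont])
  obtain C where C: "countable C" "\<And>i. i \<in> C \<Longrightarrow> fst i < snd i \<and> {fst i..snd i} \<subseteq> G \<and> w (snd i) - w (fst i) < p * (snd i - fst i)"
    "disjoint_family_on (\<lambda>i. {fst i..snd i}) C" "negligible (E \<inter> G - (\<Union>i\<in>C. {fst i<..<snd i}))"
    using Vitali_covering_intervals[OF G(1), of "E \<inter> G" "\<lambda>a b. w b - w a < p * (b - a)"] lo by auto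
  define H where "H = (\<Union>i\<in>C. {fst i<..<snd i})"
  have H: "open H" unfolding H_def by auto
  obtain D where D: "countable D" "\<And>i. i \<in> D \<Longrightarrow> fst i < snd i \<and> {fst i..snd i} \<subseteq> H \<and> w (snd i) - w (fst i) > q * (snd i - fst i)"
    "disjoint_family_on (\<lambda>i. {fst i..snd i}) D" "negligible (E \<inter> H - (\<Union>i\<in>D. {fst i<..<snd i}))"
    using Vitali_covering_intervals[OF H, of "E \<inter> H" "\<lambda>a b. w b - w a > q * (b - a)"] hi by auto
  define G' where "G' = (\<Union>i\<in>D. {fst i<..<snd i})"
  have oG': "open G'" unfolding G'_def by auto
  have "E - G' \<subseteq> (E - G) \<union> (E \<inter> G - H) \<union> (E \<inter> H - G')" by auto
  moreover have "negligible ((E - G) \<union> (E \<inter> G - H) \<union> (E \<inter> H - G'))"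
    using G(2) C(4) D(4) unfolding H_def G'_def by (intro negligible_Un)
  ultimately have neg: "negligible (E - G')" using negligible_subset by blast
  have "ennreal q * emeasure lborel G' \<le> ennreal q * emeasure lborel (\<Union>i\<in>D. {fst i..snd i})"
  proof (intro mult_left_mono emeasure_mono)
    show "G' \<subseteq> (\<Union>i\<in>D. {fst i..snd i})" unfolding G'_def by fastforce
    show "(\<Union>i\<in>D. {fst i..snd i}) \<in> sets lborel" using D(1) by (intro sets.countable_UN'') auto
  qed simp
  also have "\<dots> = ennreal q * (\<integral>\<^sup>+ i. emeasure lborel {fst i..snd i} \<partial>count_space D)"
    using D by (subst emeasure_UN_countable) auto
  also have "\<dots> = (\<integral>\<^sup>+ i. ennreal q * emeasure lborel {fst i..snd i} \<partial>count_space D)"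
    by (rule nn_integral_cmult[symmetric]) simp
  also have "\<dots> \<le> (\<integral>\<^sup>+ i. emeasure ?\<nu> {fst i..snd i} \<partial>count_space D)"
  proof (rule nn_integral_mono)
    fix i assume "i \<in> space (count_space D)"
    then have i: "fst i < snd i" "q * (snd i - fst i) < w (snd i) - w (fst i)" using D(2)[of i] by auto
    have "ennreal q * emeasure lborel {fst i..snd i} = ennreal (q * (snd i - fst i))"
      using i pq by (simp add: ennreal_mult)
    also have "\<dots> \<le> ennreal (w (snd i) - w (fst i))" using i by (intro ennreal_leI) simp
    finally show "ennreal q * emeasure lborel {fst i..snd i} \<le> emeasure ?\<nu> {fst i..snd i}"
      using i by (simp add: icc)
  qed
  also have "\<dots> = emeasure ?\<nu> (\<Union>i\<in>D. {fst i..snd i})"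
    using D by (subst emeasure_UN_countable) auto
  also have "\<dots> \<le> emeasure ?\<nu> (\<Union>i\<in>C. {fst i..snd i})"
  proof (rule emeasure_mono)
    have "(\<Union>i\<in>D. {fst i..snd i}) \<subseteq> H" using D(2) by blast
    also have "H \<subseteq> (\<Union>i\<in>C. {fst i..snd i})" unfolding H_def by fastforce
    finally show "(\<Union>i\<in>D. {fst i..snd i}) \<subseteq> (\<Union>i\<in>C. {fst i..snd i})" .
    show "(\<Union>i\<in>C. {fst i..snd i}) \<in> sets ?\<nu>" using C(1) by (intro sets.countable_UN'') auto
  qed
  also have "\<dots> = (\<integral>\<^sup>+ i. emeasure ?\<nu> {fst i..snd i} \<partial>count_space C)"
    using C by (subst emeasure_UN_countable) auto
  also have "\<dots> \<le> (\<integral>\<^sup>+ i. ennreal p * emeasure lborel {fst i..snd i} \<partial>count_space C)"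
  proof (rule nn_integral_mono)
    fix i assume "i \<in> space (count_space C)"
    then have i: "fst i < snd i" "w (snd i) - w (fst i) < p * (snd i - fst i)" using C(2)[of i] by auto
    have "emeasure ?\<nu> {fst i..snd i} = ennreal (w (snd i) - w (fst i))" using i by (simp add: icc)
    also have "\<dots> \<le> ennreal (p * (snd i - fst i))" using i by (intro ennreal_leI) simp
    also have "\<dots> = ennreal p * emeasure lborel {fst i..snd i}"
      using i pq by (simp add: ennreal_mult)
    finally show "emeasure ?\<nu> {fst i..snd i} \<le> ennreal p * emeasure lborel {fst i..snd i}" .
  qed
  also have "\<dots> = ennreal p * (\<integral>\<^sup>+ i. emeasure lborel {fst i..snd i} \<partial>count_space C)"
    by (rule nn_integral_cmult) simp
  also have "\<dots> = ennreal p * emeasure lborel (\<Union>i\<in>C. {fst i..snd i})"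
    using C by (subst emeasure_UN_countable) auto
  also have "\<dots> \<le> ennreal p * emeasure lborel G"
  proof (intro mult_left_mono emeasure_mono)
    show "(\<Union>i\<in>C. {fst i..snd i}) \<subseteq> G" using C(2) by blast
  qed (use G in auto)
  finally show ?thesis using oG' neg by blast
qed

text \<open>
  Iterating the contraction gives open sets of arbitrarily small measure that contain \<open>E\<close> up to null sets.
\<close>

lemma negligible_two_slopes:
  fixes w :: "real \<Rightarrow> real"
  assumes mono: "\<And>x y. x \<le> y \<Longrightarrow> w x \<le> w y" and cont: "continuous_on UNIV w"
    and pq: "0 < p" "p < q" and E: "bounded E"
    and lo: "\<And>t r. t \<in> E \<Longrightarrow> 0 < r \<Longrightarrow> \<exists>a b. a < b \<and> a \<le> t \<and> t \<le> b \<and> b - a < r \<and> w b - w a < p * (b - a)"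
    and hi: "\<And>t r. t \<in> E \<Longrightarrow> 0 < r \<Longrightarrow> \<exists>a b. a < b \<and> a \<le> t \<and> t \<le> b \<and> b - a < r \<and> w b - w a > q * (b - a)"
  shows "negligible E"
proof -
  obtain B where B: "B > 0" "E \<subseteq> ball 0 B" using E bounded_subset_ballD[of E 0] by blast
  have iter: "\<exists>G. open G \<and> negligible (E - G) \<and> emeasure lborel G \<le> ennreal ((p / q) ^ n * (2 * B))" for n
  proof (induction n)
    case 0
    have "E - ball 0 B = {}" using B by blast
    then show ?case
      using B by (intro exI[of _ "ball 0 B"]) (simp add: ball_eq_greaterThanLessThan)
  next
    case (Suc n)
    then obtain G where G: "open G" "negligible (E - G)" "emeasure lborel G \<le> ennreal ((p / q) ^ n * (2 * B))" by blast
    have "\<exists>G'. open G' \<and> negligible (E - G') \<and> ennreal q * emeasure lborel G' \<le> ennreal p * emeasure lborel G"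
      by (rule slopes_contraction[OF _ cont pq _ _ G(1,2)]) (fact mono | fact lo | fact hi)+
    then obtain G' where G': "open G'" "negligible (E - G')" "ennreal q * emeasure lborel G' \<le> ennreal p * emeasure lborel G"
      by (elim exE conjE)
    have "emeasure lborel G' = ennreal (1 / q) * (ennreal q * emeasure lborel G')"
      using pq by (simp add: mult.assoc[symmetric] ennreal_mult[symmetric])
    also have "\<dots> \<le> ennreal (1 / q) * (ennreal p * ennreal ((p / q) ^ n * (2 * B)))"
      by (intro mult_left_mono order_trans[OF G'(3)] G(3)) auto
    also have "\<dots> = ennreal ((p / q) ^ Suc n * (2 * B))"
      using pq B by (simp add: ennreal_mult[symmetric] field_simps)
    finally show ?case using G' by blast
  qed
  have "(\<lambda>n. (p / q) ^ n * (2 * B)) \<longlonglongrightarrow> 0 * (2 * B)"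
    using pq by (intro tendsto_mult LIMSEQ_realpow_zero tendsto_const) auto
  then have lim: "(\<lambda>n. (p / q) ^ n * (2 * B)) \<longlonglongrightarrow> 0" by simp
  show ?thesis
    unfolding negligible_outer_le
  proof (intro allI impI)
    fix e :: real assume "e > 0"
    then obtain n where n: "(p / q) ^ n * (2 * B) < e"
      using order_tendstoD(2)[OF lim] unfolding eventually_sequentially by blast
    obtain G where G: "open G" "negligible (E - G)" "emeasure lborel G \<le> ennreal ((p / q) ^ n * (2 * B))"
      using iter by blast
    have Gm: "G \<in> lmeasurable"
      using G(1,3) by (intro fmeasurableI) (auto simp: less_top[symmetric] top_unique)
    have pos: "(p / q) ^ n * (2 * B) \<ge> 0" using pq B by simp
    have "measure lebesgue (G \<union> (E - G)) \<le> measure lebesgue G + measure lebesgue (E - G)"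
      using Gm G(2) by (intro measure_Un_le) (auto simp: negligible_imp_sets fmeasurableD)
    also have "\<dots> = measure lebesgue G" using G(2) by (simp add: negligible_imp_measure0)
    also have "\<dots> \<le> (p / q) ^ n * (2 * B)"
    proof -
      have "emeasure lebesgue G = emeasure lborel G" using G(1) by simp
      then show ?thesis unfolding measure_def using G(3) pos by (simp add: enn2real_leI)
    qed
    finally have "measure lebesgue (G \<union> (E - G)) \<le> e" using n by simp
    moreover have "G \<union> (E - G) \<in> lmeasurable"
      using Gm G(2) by (intro fmeasurable.Un) (auto simp: negligible_imp_measurable)
    ultimately show "\<exists>T. E \<subseteq> T \<and> T \<in> lmeasurable \<and> measure lebesgue T \<le> e"
      by (intro exI[of _ "G \<union> (E - G)"]) auto
  qed
qed

text \<open>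
  Failure of convergence leaves a gap between the lower and the upper limit, and two rationals fit into it.
\<close>

lemma tendsto_if_not_two_slopes:
  fixes f :: "'a \<Rightarrow> real"
  assumes F: "F \<noteq> bot" and b: "\<And>x. 0 \<le> f x" "\<And>x. f x \<le> B"
    and two: "\<And>p q. p \<in> \<rat> \<Longrightarrow> q \<in> \<rat> \<Longrightarrow> 0 < p \<Longrightarrow> p < q \<Longrightarrow>
       (\<forall>\<^sub>F x in F. p \<le> f x) \<or> (\<forall>\<^sub>F x in F. f x \<le> q)"
  shows "\<exists>l. (f \<longlongrightarrow> l) F"
proof -
  define S where "S = {p. \<forall>\<^sub>F x in F. p \<le> f x}"
  have S0: "0 \<in> S" using b by (auto simp: S_def)
  have SB: "p \<le> B" if "p \<in> S" for p
  proof -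
    have "\<exists>x. p \<le> f x" using that eventually_happens'[OF F] by (auto simp: S_def)
    then show ?thesis using b(2) order_trans by blast
  qed
  have bdd: "bdd_above S" using SB by (auto simp: bdd_above_def)
  define c where "c = Sup S"
  have c0: "c \<ge> 0" unfolding c_def using S0 bdd by (rule cSup_upper)
  have "(f \<longlongrightarrow> c) F"
  proof (rule order_tendstoI)
    fix a assume "a < c"
    then obtain p where "p \<in> S" "a < p" unfolding c_def using less_cSupE S0 by (metis empty_iff)
    then show "\<forall>\<^sub>F x in F. a < f x" unfolding S_def by (auto elim: eventually_mono)
  next
    fix a assume "c < a"
    then obtain q where q: "q \<in> \<rat>" "c < q" "q < a" using Rats_dense_in_real by blast
    then obtain p where p: "p \<in> \<rat>" "c < p" "p < q" using Rats_dense_in_real by blast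
    have "p \<notin> S" using p(2) cSup_upper[OF _ bdd] unfolding c_def by (meson not_le)
    then have "\<forall>\<^sub>F x in F. f x \<le> q" using two[OF p(1) q(1)] p c0 by (auto simp: S_def)
    then show "\<forall>\<^sub>F x in F. f x < a" using q(3) by (auto elim: eventually_mono)
  qed
  then show ?thesis by blast
qed

text \<open>
  Rademacher's theorem on the line. Adding \<open>L * t\<close> makes the function monotone. Where it is not differentiable,
  its difference quotients, which are bounded, oscillate across two positive rationals, and each of the countably
  many sets of such points is null.
\<close>

lemma Lipschitz_real_differentiable_ae:
  fixes h :: "real \<Rightarrow> real"
  assumes L: "\<And>x y. \<bar>h x - h y\<bar> \<le> L * \<bar>x - y\<bar>"
  shows "negligible {t. \<not> (\<exists>d. (h has_real_derivative d) (at t))}"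
proof -
  have L0: "L \<ge> 0" using L[of 0 1] by simp
  define w where "w t = h t + L * t" for t
  have mono: "w x \<le> w y" if "x \<le> y" for x y
    using L[of x y] that by (simp add: w_def algebra_simps abs_le_iff)
  have wL: "\<bar>w x - w y\<bar> \<le> (2 * L) * \<bar>x - y\<bar>" for x y
  proof -
    have "\<bar>w x - w y\<bar> \<le> \<bar>h x - h y\<bar> + \<bar>L * (x - y)\<bar>" by (simp add: w_def algebra_simps abs_if)
    also have "\<bar>L * (x - y)\<bar> = L * \<bar>x - y\<bar>" using L0 by (simp add: abs_mult)
    finally show ?thesis using L[of x y] by simp
  qed
  have cont: "continuous_on UNIV w"
    by (rule lipschitz_on_continuous_on[of "2 * L"], rule lipschitz_onI) (use wL L0 in \<open>auto simp: dist_real_def\<close>)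
  define lo where "lo p t \<longleftrightarrow> (\<forall>r>0. \<exists>a b. a < b \<and> a \<le> t \<and> t \<le> b \<and> b - a < r \<and> w b - w a < p * (b - a))" for p t
  define hi where "hi q t \<longleftrightarrow> (\<forall>r>0. \<exists>a b. a < b \<and> a \<le> t \<and> t \<le> b \<and> b - a < r \<and> w b - w a > q * (b - a))" for q t
  define E where "E p q n = {t. \<bar>t\<bar> < real n \<and> lo p t \<and> hi q t}" for p q n
  have negE: "negligible (E p q n)" if "0 < p" "p < q" for p q n
  proof (rule negligible_two_slopes[OF mono cont that])
    show "bounded (E p q n)"
      by (rule bounded_subset[OF bounded_ball[of 0 "real n"]]) (auto simp: E_def)
  qed (auto simp: E_def lo_def hi_def)
  define PQ :: "(real \<times> real \<times> nat) set" where "PQ = {(p, q, n). p \<in> \<rat> \<and> q \<in> \<rat> \<and> 0 < p \<and> p < q \<and> (n::nat) \<in> UNIV}"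
  have "countable PQ"
    by (rule countable_subset[of _ "\<rat> \<times> \<rat> \<times> UNIV"]) (auto simp: PQ_def countable_rat)
  then have neg: "negligible (\<Union>((\<lambda>(p, q, n). E p q n) ` PQ))"
    by (intro negligible_countable_Union) (auto simp: PQ_def negE)
  have "\<exists>d. (h has_real_derivative d) (at t)" if t: "t \<notin> \<Union>((\<lambda>(p, q, n). E p q n) ` PQ)" for t
  proof -
    define f where "f u = (if u = t then 0 else (w u - w t) / (u - t))" for u
    have f0: "0 \<le> f u" for u
      using mono[of u t] mono[of t u] by (cases "u < t") (auto simp: f_def intro: divide_nonpos_neg)
    have fB: "f u \<le> 2 * L" for u
    proof (cases "u = t")
      case False
      have "f u \<le> \<bar>w u - w t\<bar> / \<bar>u - t\<bar>" using False f0[of u] by (simp add: f_def flip: abs_divide)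
      also have "\<dots> \<le> 2 * L" using wL[of u t] False by (simp add: divide_le_eq)
      finally show ?thesis .
    qed (use L0 in \<open>simp add: f_def\<close>)
    have slope: "f u * (max u t - min u t) = w (max u t) - w (min u t)" for u
      by (auto simp: f_def max_def min_def field_simps)
    have "\<exists>l. (f \<longlongrightarrow> l) (at t)"
    proof (rule tendsto_if_not_two_slopes[of "at t" f "2 * L"])
      fix p q :: real assume pq: "p \<in> \<rat>" "q \<in> \<rat>" "0 < p" "p < q"
      show "(\<forall>\<^sub>F x in at t. p \<le> f x) \<or> (\<forall>\<^sub>F x in at t. f x \<le> q)"
      proof (rule ccontr)
        assume "\<not> ?thesis"
        then have fr: "\<exists>\<^sub>F x in at t. f x < p" "\<exists>\<^sub>F x in at t. f x > q"
          by (auto simp: not_eventually not_le)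
        have near: "\<exists>u. u \<noteq> t \<and> \<bar>u - t\<bar> < r \<and> Q u" if "\<exists>\<^sub>F x in at t. Q x" "r > 0" for Q r
        proof -
          have ev: "\<forall>\<^sub>F x in at t. x \<noteq> t \<and> \<bar>x - t\<bar> < r"
            unfolding eventually_at using that(2) by (intro exI[of _ r]) (auto simp: dist_real_def)
          show ?thesis
            using frequently_ex[OF frequently_eventually_conj[OF that(1) ev]] by blast
        qed
        have "lo p t"
          unfolding lo_def
        proof (intro allI impI)
          fix r :: real assume "r > 0"
          then obtain u where u: "u \<noteq> t" "\<bar>u - t\<bar> < r" "f u < p" using near[OF fr(1)] by blast
          have "w (max u t) - w (min u t) < p * (max u t - min u t)"
            unfolding slope[symmetric] using u by (intro mult_strict_right_mono) auto
          then show "\<exists>a b. a < b \<and> a \<le> t \<and> t \<le> b \<and> b - a < r \<and> w b - w a < p * (b - a)"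
            using u by (intro exI[of _ "min u t"] exI[of _ "max u t"]) auto
        qed
        moreover have "hi q t"
          unfolding hi_def
        proof (intro allI impI)
          fix r :: real assume "r > 0"
          then obtain u where u: "u \<noteq> t" "\<bar>u - t\<bar> < r" "f u > q" using near[OF fr(2)] by blast
          have "w (max u t) - w (min u t) > q * (max u t - min u t)"
            unfolding slope[symmetric] using u by (intro mult_strict_right_mono) auto
          then show "\<exists>a b. a < b \<and> a \<le> t \<and> t \<le> b \<and> b - a < r \<and> w b - w a > q * (b - a)"
            using u by (intro exI[of _ "min u t"] exI[of _ "max u t"]) auto
        qed
        moreover obtain n :: nat where "\<bar>t\<bar> < real n" using reals_Archimedean2 by blast
        ultimately have "t \<in> E p q n" by (simp add: E_def)
        then show False using t pq by (force simp: PQ_def)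
      qed
    qed (use f0 fB in auto)
    then obtain l where l: "(f \<longlongrightarrow> l) (at t)" by blast
    have "((\<lambda>u. (w u - w t) / (u - t)) \<longlongrightarrow> l) (at t)"
      by (rule Lim_transform_eventually[OF l]) (auto simp: f_def eventually_at intro: exI[of _ 1])
    then have "(w has_real_derivative l) (at t)" by (simp add: has_field_derivative_iff)
    then have "((\<lambda>u. w u - L * u) has_real_derivative (l - L)) (at t)"
      by (auto intro!: derivative_eq_intros)
    then show ?thesis by (auto simp: w_def)
  qed
  then show ?thesis by (intro negligible_subset[OF neg]) blast
qed

text \<open>
  McShane's formula.
\<close>

lemma Lipschitz_real_extension:
  fixes f :: "real \<Rightarrow> real"
  assumes L: "\<And>x y. x \<in> D \<Longrightarrow> y \<in> D \<Longrightarrow> \<bar>f x - f y\<bar> \<le> L * \<bar>x - y\<bar>" and L0: "L \<ge> 0"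
  obtains h where "\<And>x. x \<in> D \<Longrightarrow> h x = f x" "\<And>x y. \<bar>h x - h y\<bar> \<le> L * \<bar>x - y\<bar>"
proof (cases "D = {}")
  case True
  then show ?thesis using that[of "\<lambda>_. 0"] L0 by simp
next
  case False
  then obtain d where d: "d \<in> D" by blast
  define h where "h x = (INF y\<in>D. f y + L * \<bar>x - y\<bar>)" for x
  have low: "f d - L * \<bar>x - d\<bar> \<le> f y + L * \<bar>x - y\<bar>" if "y \<in> D" for x y
  proof -
    have "L * \<bar>d - y\<bar> \<le> L * (\<bar>x - d\<bar> + \<bar>x - y\<bar>)" using L0 by (intro mult_left_mono) auto
    then show ?thesis using L[OF d that] by (simp add: distrib_left)
  qed
  have bdd: "bdd_below ((\<lambda>y. f y + L * \<bar>x - y\<bar>) ` D)" for x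
    using low by (intro bdd_belowI2[of _ "f d - L * \<bar>x - d\<bar>"]) auto
  have up: "h x \<le> f y + L * \<bar>x - y\<bar>" if "y \<in> D" for x y
    unfolding h_def by (rule cINF_lower[OF bdd that])
  have ge: "c \<le> h x" if "\<And>y. y \<in> D \<Longrightarrow> c \<le> f y + L * \<bar>x - y\<bar>" for c x
    unfolding h_def using False that by (rule cINF_greatest)
  have "h x = f x" if x: "x \<in> D" for x
  proof (rule antisym)
    show "h x \<le> f x" using up[OF x, of x] by simp
    show "f x \<le> h x"
    proof (rule ge)
      fix y assume "y \<in> D"
      then show "f x \<le> f y + L * \<bar>x - y\<bar>" using L[OF x] by (simp add: abs_le_iff algebra_simps)
    qed
  qed
  moreover have half: "h x - L * \<bar>x - z\<bar> \<le> h z" for x z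
  proof (rule ge)
    fix y assume y: "y \<in> D"
    have "L * \<bar>x - y\<bar> \<le> L * (\<bar>x - z\<bar> + \<bar>z - y\<bar>)" using L0 by (intro mult_left_mono) auto
    then show "h x - L * \<bar>x - z\<bar> \<le> f y + L * \<bar>z - y\<bar>" using up[OF y, of x] by (simp add: distrib_left)
  qed
  have "\<bar>h x - h z\<bar> \<le> L * \<bar>x - z\<bar>" for x z
    using half[of x z] half[of z x] by (simp add: abs_le_iff abs_minus_commute)
  ultimately show ?thesis using that by blast
qed

section \<open>Bases of finite-dimensional normed spaces\<close>

text \<open>
  If \<open>b\<close> is not yet in the span of \<open>B\<close>, its coefficient is a bounded function of the vector, because \<open>b\<close> has
  positive distance from that closed subspace. So the coefficients of a convergent sequence converge.
\<close>

lemma closed_span_insert: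
  fixes B :: "'v::real_normed_vector set"
  assumes "closed (span B)"
  shows "closed (span (insert b B))"
proof (cases "b \<in> span B")
  case True
  then show ?thesis using assms by (simp add: span_redundant)
next
  case False
  define r where "r = infdist b (span B)"
  have ne: "span B \<noteq> {}" using span_zero by blast
  have r: "r > 0"
    using False assms ne infdist_nonneg[of b "span B"] in_closed_iff_infdist_zero[of "span B" b]
    unfolding r_def by fastforce
  have bnd: "\<bar>t\<bar> * r \<le> norm (u + t *\<^sub>R b)" if "u \<in> span B" for u t
  proof (cases "t = 0")
    case False
    have "- (inverse t) *\<^sub>R u \<in> span B" using that by (rule span_scale)
    then have "r \<le> dist b (- (inverse t) *\<^sub>R u)" unfolding r_def by (rule infdist_le)
    then have "\<bar>t\<bar> * r \<le> \<bar>t\<bar> * norm (b + inverse t *\<^sub>R u)"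
      by (intro mult_left_mono) (auto simp: dist_norm)
    also have "\<dots> = norm (t *\<^sub>R (b + inverse t *\<^sub>R u))" by simp
    also have "t *\<^sub>R (b + inverse t *\<^sub>R u) = u + t *\<^sub>R b"
      using False by (simp add: scaleR_add_right)
    finally show ?thesis .
  qed simp
  show ?thesis
    unfolding closed_sequential_limits
  proof (intro allI impI, elim conjE)
    fix z l assume z: "\<forall>n. z n \<in> span (insert b B)" and l: "z \<longlonglongrightarrow> l"
    have "\<forall>n. \<exists>t. z n - t *\<^sub>R b \<in> span B" using z by (simp add: span_insert)
    then obtain t where t: "\<And>n. z n - t n *\<^sub>R b \<in> span B" by metis
    have tb: "\<bar>t n - t m\<bar> * r \<le> norm (z n - z m)" for n m
    proof -
      have "(z n - t n *\<^sub>R b) - (z m - t m *\<^sub>R b) \<in> span B" by (rule span_diff[OF t t])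
      from bnd[OF this, of "t n - t m"] show ?thesis by (simp add: algebra_simps)
    qed
    have "Cauchy t"
    proof (rule CauchyI)
      fix e :: real assume "e > 0"
      then obtain M where M: "\<And>m n. m \<ge> M \<Longrightarrow> n \<ge> M \<Longrightarrow> norm (z m - z n) < e * r"
        using CauchyD[OF LIMSEQ_imp_Cauchy[OF l], of "e * r"] r by auto
      have "norm (t m - t n) < e" if "m \<ge> M" "n \<ge> M" for m n
        using le_less_trans[OF tb M[OF that]] r by simp
      then show "\<exists>M. \<forall>m\<ge>M. \<forall>n\<ge>M. norm (t m - t n) < e" by blast
    qed
    then obtain \<tau> where \<tau>: "t \<longlonglongrightarrow> \<tau>" using Cauchy_convergent convergent_def by blast
    have "(\<lambda>n. z n - t n *\<^sub>R b) \<longlonglongrightarrow> l - \<tau> *\<^sub>R b" by (intro tendsto_intros l \<tau>)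
    then have "l - \<tau> *\<^sub>R b \<in> span B"
      by (rule closed_sequentially[OF assms t])
    then show "l \<in> span (insert b B)" by (auto simp: span_insert)
  qed
qed

lemma closed_span_finite:
  fixes B :: "'v::real_normed_vector set"
  shows "finite B \<Longrightarrow> closed (span B)"
  by (induction B rule: finite_induct) (auto intro: closed_span_insert)

text \<open>
  Riesz's lemma: normalise \<open>x - u0\<close> for some \<open>u0\<close> in \<open>U\<close> that realises the distance of \<open>x\<close> from \<open>U\<close> up to the
  factor \<open>2\<close>.
\<close>

lemma exists_almost_orthogonal:
  fixes U :: "'v::real_normed_vector set"
  assumes U: "subspace U" "closed U" and W: "subspace W" and x: "x \<in> W" "x \<notin> U" "U \<subseteq> W"
  obtains b where "b \<in> W" "norm b = 1" "\<And>u t. u \<in> U \<Longrightarrow> \<bar>t\<bar> / 2 \<le> norm (u + t *\<^sub>R b)" "b \<notin> U"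
proof -
  define r where "r = infdist x U"
  have ne: "U \<noteq> {}" using subspace_0[OF U(1)] by blast
  have r: "r > 0"
    using x ne U infdist_nonneg[of x U] in_closed_iff_infdist_zero[of U x]
    unfolding r_def by fastforce
  obtain u0 where u0: "u0 \<in> U" "dist x u0 < 2 * r"
  proof -
    have "(INF a\<in>U. dist x a) < 2 * r"
      using r ne by (simp add: r_def infdist_notempty)
    then show ?thesis
      using cInf_lessD[of "dist x ` U" "2 * r"] ne that by blast
  qed
  define n where "n = norm (x - u0)"
  have n: "n > 0" "n < 2 * r"
    using u0 x by (auto simp: n_def dist_norm)
  define b where "b = (1 / n) *\<^sub>R (x - u0)"
  have xb: "x = u0 + n *\<^sub>R b" using n by (simp add: b_def)
  show ?thesis
  proof
    show "b \<in> W" unfolding b_def using W x u0 by (intro subspace_scale subspace_diff) auto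
    show "norm b = 1" using n by (simp add: b_def n_def[symmetric])
    show "b \<notin> U"
      using xb u0 U x by (metis subspace_add subspace_scale)
    show "\<bar>t\<bar> / 2 \<le> norm (u + t *\<^sub>R b)" if u: "u \<in> U" for u t
    proof (cases "t = 0")
      case False
      have "u0 - (n / t) *\<^sub>R u \<in> U" using U u u0 by (intro subspace_scale subspace_diff)
      then have "r \<le> dist x (u0 - (n / t) *\<^sub>R u)" unfolding r_def by (rule infdist_le)
      also have "\<dots> = norm ((n / t) *\<^sub>R (u + t *\<^sub>R b))"
        using False unfolding dist_norm xb by (simp add: scaleR_add_right add.commute)
      also have "\<dots> = n / \<bar>t\<bar> * norm (u + t *\<^sub>R b)" using n by simp
      also have "\<dots> \<le> 2 * r / \<bar>t\<bar> * norm (u + t *\<^sub>R b)"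
        using n by (intro mult_right_mono divide_right_mono) auto
      finally have "r * \<bar>t\<bar> \<le> r * (2 * norm (u + t *\<^sub>R b))"
        using False by (simp add: field_simps)
      then show ?thesis using r by simp
    qed simp
  qed
qed

text \<open>
  A quantitative form of linear independence. The bound \<open>C\<close> has to be uniform over all subspaces of a given
  dimension, so it is part of the notion.
\<close>

definition coords_bounded :: "'v::real_normed_vector set \<Rightarrow> real \<Rightarrow> bool" where
  "coords_bounded B C \<longleftrightarrow> (\<forall>a. \<forall>b\<in>B. \<bar>a b\<bar> \<le> C * norm (\<Sum>b\<in>B. a b *\<^sub>R b))"

text \<open>
  The coordinate at the new vector is at most \<open>2\<close> times the norm. Removing that component multiplies the norm by at
  most \<open>3\<close>, and the old coordinates are bounded in terms of what remains.
\<close>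

lemma coords_bounded_insert:
  fixes B :: "'v::real_normed_vector set"
  assumes B: "finite B" "coords_bounded B C" "b \<notin> B" "C \<ge> 1"
    and nb: "norm b = 1" and sep: "\<And>u t. u \<in> span B \<Longrightarrow> \<bar>t\<bar> / 2 \<le> norm (u + t *\<^sub>R b)"
  shows "coords_bounded (insert b B) (3 * C)"
  unfolding coords_bounded_def
proof (intro allI ballI)
  fix a b' assume b': "b' \<in> insert b B"
  let ?u = "\<Sum>b\<in>B. a b *\<^sub>R b" and ?x = "\<Sum>b\<in>insert b B. a b *\<^sub>R b"
  have x: "?x = ?u + a b *\<^sub>R b" using B by simp
  have "?u \<in> span B" by (intro span_sum span_scale span_base)
  from sep[OF this, of "a b"] have ab: "\<bar>a b\<bar> \<le> 2 * norm ?x" by (simp add: x)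
  have "norm ?u = norm (?x - a b *\<^sub>R b)" by (simp add: x)
  also have "\<dots> \<le> norm ?x + norm (a b *\<^sub>R b)" by (rule norm_triangle_ineq4)
  also have "\<dots> \<le> 3 * norm ?x" using ab nb by simp
  finally have u: "norm ?u \<le> 3 * norm ?x" .
  show "\<bar>a b'\<bar> \<le> 3 * C * norm ?x"
  proof (cases "b' = b")
    case True
    have "2 * norm ?x \<le> 3 * C * norm ?x" using B(4) by (intro mult_right_mono) auto
    then have "\<bar>a b\<bar> \<le> 3 * C * norm ?x" using ab by (rule order_trans[rotated])
    then show ?thesis using True by simp
  next
    case False
    then have "\<bar>a b'\<bar> \<le> C * norm ?u" using B(2) b' unfolding coords_bounded_def by blast
    also have "\<dots> \<le> C * (3 * norm ?x)" using B(4) u by (intro mult_left_mono) auto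
    finally show ?thesis by simp
  qed
qed

lemma independent_finite_dimensional:
  assumes "finite_dimensional TYPE('v::real_vector)" "independent (B::'v set)"
  shows "finite B"
  using assms independent_span_bound unfolding finite_dimensional_def by blast

text \<open>
  Almost orthogonal unit vectors are added until the whole subspace is spanned. This also provides a basis of the
  whole space that extends a given basis of \<open>W\<close>.
\<close>

lemma extend_to_bounded_basis:
  fixes W :: "'v::real_normed_vector set"
  assumes fd: "finite_dimensional TYPE('v)" and W: "subspace W"
    and B: "independent B" "B \<subseteq> W" "\<forall>b\<in>B. norm b = 1" "coords_bounded B (3 ^ card B)"
  shows "\<exists>B'. B \<subseteq> B' \<and> B' \<subseteq> W \<and> independent B' \<and> W \<subseteq> span B' \<and> (\<forall>b\<in>B'. norm b = 1) \<and>
           coords_bounded B' (3 ^ card B')"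
  using B
proof (induction "dim W - card B" arbitrary: B rule: less_induct)
  case less
  show ?case
  proof (cases "W \<subseteq> span B")
    case True
    then show ?thesis using less.prems by blast
  next
    case False
    have fin: "finite B" by (rule independent_finite_dimensional[OF fd less.prems(1)])
    obtain x where x: "x \<in> W" "x \<notin> span B" using False by blast
    obtain b where b: "b \<in> W" "norm b = 1" "\<And>u t. u \<in> span B \<Longrightarrow> \<bar>t\<bar> / 2 \<le> norm (u + t *\<^sub>R b)" "b \<notin> span B"
      using exists_almost_orthogonal[OF subspace_span closed_span_finite[OF fin] W x span_minimal[OF less.prems(2) W]]
      by blast
    have bB: "b \<notin> B" using b(4) span_base by blast
    have ind: "independent (insert b B)" using less.prems(1) b(4) by (simp add: independent_insert)
    have "card (insert b B) \<le> dim W"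
    proof -
      obtain C where C: "C \<subseteq> W" "independent C" "W \<subseteq> span C" "card C = dim W" by (rule basis_exists)
      then show ?thesis
        using independent_span_bound[OF independent_finite_dimensional[OF fd C(2)] ind] b(1) less.prems(2) by auto
    qed
    then have "dim W - card (insert b B) < dim W - card B" using bB fin by auto
    moreover have "coords_bounded (insert b B) (3 ^ card (insert b B))"
      using coords_bounded_insert[OF fin less.prems(4) bB _ b(2,3)] bB fin by simp
    moreover have "insert b B \<subseteq> W" "\<forall>b\<in>insert b B. norm b = 1" using b less.prems by auto
    ultimately have "\<exists>B'. insert b B \<subseteq> B' \<and> B' \<subseteq> W \<and> independent B' \<and> W \<subseteq> span B' \<and>
        (\<forall>b\<in>B'. norm b = 1) \<and> coords_bounded B' (3 ^ card B')"
      using less.hyps ind by metis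
    then show ?thesis by (elim ex_forward) simp
  qed
qed

lemma exists_bounded_basis:
  fixes W :: "'v::real_normed_vector set"
  assumes fd: "finite_dimensional TYPE('v)" and W: "subspace W"
  obtains B where "B \<subseteq> W" "independent B" "span B = W" "card B = dim W" "finite B" "\<forall>b\<in>B. norm b = 1"
    "coords_bounded B (3 ^ dim W)"
proof -
  have "coords_bounded {} (3 ^ card ({}::'v set))" by (simp add: coords_bounded_def)
  then have "\<exists>B. {} \<subseteq> B \<and> B \<subseteq> W \<and> independent B \<and> W \<subseteq> span B \<and> (\<forall>b\<in>B. norm b = 1) \<and>
           coords_bounded B (3 ^ card B)"
    by (intro extend_to_bounded_basis[OF fd W independent_empty]) auto
  then obtain B where B: "B \<subseteq> W" "independent B" "W \<subseteq> span B" "\<forall>b\<in>B. norm b = 1"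
           "coords_bounded B (3 ^ card B)" by blast
  have "card B = dim W" using B by (intro basis_card_eq_dim)
  moreover have "span B = W" using B W by (intro antisym span_minimal)
  moreover have "finite B" using fd B(2) by (rule independent_finite_dimensional)
  ultimately show ?thesis using B that[of B] by metis
qed

lemma coords_bounded_representation:
  fixes B :: "'v::real_normed_vector set"
  assumes "coords_bounded B C" "independent B" "finite B" "x \<in> span B" "b \<in> B"
  shows "\<bar>representation B x b\<bar> \<le> C * norm x"
  using assms sum_representation_eq[OF assms(2,4,3) order_refl] unfolding coords_bounded_def by metis

lemma linear_finite_dimensional_bounded_linear:
  fixes f :: "'v::real_normed_vector \<Rightarrow> 'w::real_normed_vector"
  assumes fd: "finite_dimensional TYPE('v)" and f: "linear f"
  shows "bounded_linear f"
proof -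
  obtain B :: "'v set" where B: "independent B" "span B = UNIV" "finite B" "\<forall>b\<in>B. norm b = 1"
      "coords_bounded B (3 ^ dim (UNIV::'v set))"
    using exists_bounded_basis[OF fd subspace_UNIV] by metis
  let ?C = "3 ^ dim (UNIV::'v set) :: real"
  have "norm (f x) \<le> norm x * (\<Sum>b\<in>B. ?C * norm (f b))" for x
  proof -
    have x: "x = (\<Sum>b\<in>B. representation B x b *\<^sub>R b)"
      using sum_representation_eq[OF B(1) _ B(3) order_refl, of x] B(2) by simp
    have "norm (f x) = norm (\<Sum>b\<in>B. representation B x b *\<^sub>R f b)"
      by (subst x) (simp add: linear_sum[OF f] linear_scale[OF f])
    also have "\<dots> \<le> (\<Sum>b\<in>B. norm (representation B x b *\<^sub>R f b))" by (rule norm_sum)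
    also have "\<dots> \<le> (\<Sum>b\<in>B. (?C * norm x) * norm (f b))"
      using coords_bounded_representation[OF B(5,1,3)] B(2)
      by (intro sum_mono) (auto intro: mult_right_mono)
    finally show ?thesis by (simp add: sum_distrib_left mult_ac)
  qed
  then show ?thesis
    using f by (intro bounded_linear_intro[of f]) (auto simp: linear_add linear_scale)
qed

lemma norm_sum_scaleR_le:
  assumes "\<And>b. b \<in> B \<Longrightarrow> norm b = 1" "\<And>b. b \<in> B \<Longrightarrow> \<bar>a b\<bar> \<le> c"
  shows "norm (\<Sum>b\<in>B. a b *\<^sub>R b) \<le> real (card B) * c"
proof -
  have "norm (\<Sum>b\<in>B. a b *\<^sub>R b) \<le> (\<Sum>b\<in>B. norm (a b *\<^sub>R b))" by (rule norm_sum)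
  also have "\<dots> \<le> (\<Sum>b\<in>B. c)" using assms by (intro sum_mono) auto
  finally show ?thesis by simp
qed

text \<open>
  The data that the definition of \<open>K_tilde\<close> asks for at a single subspace \<open>W\<close>. The constants
  \<open>Kd\<close>, \<open>Kp\<close> and \<open>K\<close> are to be shared by all \<open>W\<close> of the same dimension.
\<close>

definition adapted_splitting ::
  "'v::real_normed_vector set \<Rightarrow> real \<Rightarrow> real \<Rightarrow> real \<Rightarrow> 'v set \<Rightarrow> ('v \<Rightarrow> 'v) \<Rightarrow> ('v \<Rightarrow> 'v) \<Rightarrow> bool" where
  "adapted_splitting W Kd Kp K B P Q \<longleftrightarrow>
     independent B \<and> span B = UNIV \<and> (\<forall>b\<in>B. norm b = 1) \<and>
     linear P \<and> P \<circ> P = P \<and> range P = W \<and>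
     linear Q \<and> Q \<circ> Q = Q \<and> range Q = {x. P x = 0} \<and>
     (\<forall>x. P x + Q x = x) \<and>
     (\<forall>b\<in>B. onorm (\<lambda>x. representation B x b) \<le> Kp) \<and>
     onorm P \<le> Kd \<and> onorm Q \<le> Kd \<and>
     (\<forall>x. \<forall>l::'v \<Rightarrow> real. (\<forall>b\<in>B. \<bar>l b\<bar> \<le> 1) \<longrightarrow>
        norm (P x + (\<Sum>b\<in>B. (l b * representation B (Q x) b) *\<^sub>R b)) \<le> K * norm x)"

lemma K_tilde_admissible_iff:
  "K_tilde_admissible TYPE('v::real_normed_vector) d K \<longleftrightarrow>
     (\<exists>Kd>0. \<exists>Kp>0. \<forall>W::'v set. subspace W \<and> dim W = d \<longrightarrow> (\<exists>B P Q. adapted_splitting W Kd Kp K B P Q))"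
  unfolding K_tilde_admissible_def adapted_splitting_def by (rule refl)

text \<open>
  A basis of \<open>W\<close> with bounded coordinates is extended to one of \<open>V\<close>, and \<open>P\<close> and \<open>Q\<close> are the two coordinate
  projections. All bounds depend on the dimension of \<open>V\<close> only. So the set in the definition of \<open>K_tilde\<close> is
  nonempty, and \<open>K_tilde\<close> can be approximated by admissible constants.
\<close>

lemma K_tilde_admissible_exists:
  assumes fd: "finite_dimensional TYPE('v::real_normed_vector)"
  shows "\<exists>K\<ge>1. K_tilde_admissible TYPE('v) d K"
proof -
  define m where "m = dim (UNIV :: 'v set)"
  define C :: real where "C = 3 ^ m"
  define K where "K = 1 + real m * C"
  have C: "C \<ge> 1" by (simp add: C_def)
  have K: "K \<ge> 1" using C by (simp add: K_def)
  have main: "\<exists>B P Q. adapted_splitting W K C K B P Q" if W: "subspace W" for W :: "'v set"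
  proof -
    obtain B0 where B0: "B0 \<subseteq> W" "independent B0" "span B0 = W" "card B0 = dim W" "finite B0" "\<forall>b\<in>B0. norm b = 1"
      "coords_bounded B0 (3 ^ dim W)"
      by (rule exists_bounded_basis[OF fd W])
    then obtain B where B: "B0 \<subseteq> B" "independent B" "UNIV \<subseteq> span B" "\<forall>b\<in>B. norm b = 1"
        "coords_bounded B (3 ^ card B)"
      using extend_to_bounded_basis[OF fd subspace_UNIV, of B0] by auto
    have spB: "span B = UNIV" using B(3) by blast
    have finB: "finite B" by (rule independent_finite_dimensional[OF fd B(2)])
    have cardB: "card B = m" unfolding m_def using B by (intro basis_card_eq_dim) auto
    define rep where "rep x b = representation B x b" for x b
    have rep: "\<bar>rep x b\<bar> \<le> C * norm x" if "b \<in> B" for x b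
      unfolding rep_def C_def cardB[symmetric]
      by (rule coords_bounded_representation[OF B(5,2) finB _ that]) (simp add: spB)
    have rep_add: "rep (x + y) b = rep x b + rep y b" for x y b
      by (simp add: rep_def representation_add[OF B(2)] spB)
    have rep_scale: "rep (c *\<^sub>R x) b = c * rep x b" for c x b
      by (simp add: rep_def representation_scale[OF B(2)] spB)
    have rep_b: "rep b' b = (if b = b' then 1 else 0)" if "b' \<in> B" for b b'
      by (simp add: rep_def representation_basis[OF B(2) that])
    have rep_x: "(\<Sum>b\<in>B. rep x b *\<^sub>R b) = x" for x
      unfolding rep_def using sum_representation_eq[OF B(2) _ finB order_refl] spB by simp
    have rep_sum: "rep (\<Sum>b\<in>A. c b *\<^sub>R b) b' = (if b' \<in> A then c b' else 0)" if "A \<subseteq> B" for A c b'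
    proof -
      have "finite A" using that finB finite_subset by blast
      then show ?thesis using that
      proof (induction A rule: finite_induct)
        case empty
        then show ?case by (simp add: rep_def representation_zero)
      next
        case (insert a A)
        then show ?case by (auto simp: rep_add rep_scale rep_b)
      qed
    qed
    define T where "T A x = (\<Sum>b\<in>A. rep x b *\<^sub>R b)" for A x
    have linT: "linear (T A)" for A
      by (rule linearI) (simp_all add: T_def rep_add rep_scale scaleR_add_left sum.distrib scaleR_sum_right)
    have TT: "T A (T A' x) = T (A \<inter> A') x" if "A' \<subseteq> B" "A \<subseteq> B" for A A' x
    proof -
      have "finite A" using that finB finite_subset by blast
      then show ?thesis
        using that by (simp add: T_def rep_sum sum.inter_restrict if_distrib[of "\<lambda>c. c *\<^sub>R _"] cong: if_cong)
    qed
    have Tb: "norm (\<Sum>b\<in>B. c b *\<^sub>R b) \<le> real m * C * norm x" if "\<And>b. b \<in> B \<Longrightarrow> \<bar>c b\<bar> \<le> C * norm x" for c x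
      using norm_sum_scaleR_le[of B c "C * norm x"] that B(4) cardB by (simp add: mult_ac)
    define P where "P = T B0"
    define Q where "Q = T (B - B0)"
    have fin0: "finite B0" using B0 by blast
    have eqP: "P x = (\<Sum>b\<in>B. (if b \<in> B0 then rep x b else 0) *\<^sub>R b)" for x
    proof -
      have "P x = (\<Sum>b\<in>B \<inter> B0. rep x b *\<^sub>R b)" using B(1) by (simp add: P_def T_def Int_absorb1)
      also have "\<dots> = (\<Sum>b\<in>B. if b \<in> B0 then rep x b *\<^sub>R b else 0)" by (rule sum.inter_restrict[OF finB])
      also have "\<dots> = (\<Sum>b\<in>B. (if b \<in> B0 then rep x b else 0) *\<^sub>R b)" by (intro sum.cong) auto
      finally show ?thesis .
    qed
    have PQ: "P x + Q x = x" for x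
      using sum.subset_diff[OF B(1) finB, of "\<lambda>b. rep x b *\<^sub>R b"] rep_x[of x]
      by (simp add: P_def Q_def T_def add.commute)
    have repQ: "rep (Q x) b = (if b \<in> B0 then 0 else rep x b)" if "b \<in> B" for x b
      using that unfolding Q_def T_def by (subst rep_sum) auto
    have key: "norm (P x + (\<Sum>b\<in>B. (l b * rep (Q x) b) *\<^sub>R b)) \<le> real m * C * norm x"
      if l: "\<forall>b\<in>B. \<bar>l b\<bar> \<le> 1" for x l
    proof -
      have "P x + (\<Sum>b\<in>B. (l b * rep (Q x) b) *\<^sub>R b)
          = (\<Sum>b\<in>B. ((if b \<in> B0 then rep x b else 0) + l b * rep (Q x) b) *\<^sub>R b)"
        by (simp add: eqP scaleR_add_left sum.distrib)
      also have "\<dots> = (\<Sum>b\<in>B. ((if b \<in> B0 then 1 else l b) * rep x b) *\<^sub>R b)"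
        by (intro sum.cong) (auto simp: repQ)
      also have "norm \<dots> \<le> real m * C * norm x"
      proof (rule Tb)
        fix b assume b: "b \<in> B"
        have "\<bar>(if b \<in> B0 then 1 else l b) * rep x b\<bar> \<le> 1 * \<bar>rep x b\<bar>"
          unfolding abs_mult using l b by (intro mult_right_mono) auto
        then show "\<bar>(if b \<in> B0 then 1 else l b) * rep x b\<bar> \<le> C * norm x" using rep[OF b, of x] by linarith
      qed
      finally show ?thesis .
    qed
    have nP: "norm (P x) \<le> K * norm x" for x
      using key[of "\<lambda>_. 0" x] by (simp add: K_def distrib_right add_increasing)
    have nQ: "norm (Q x) \<le> K * norm x" for x
    proof -
      have "Q x = x - P x" using PQ[of x] by (simp add: eq_diff_eq add.commute)
      also have "norm \<dots> \<le> norm x + norm (P x)" by (rule norm_triangle_ineq4)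
      also have "\<dots> \<le> norm x + real m * C * norm x" using key[of "\<lambda>_. 0" x] by simp
      finally show ?thesis by (simp add: K_def algebra_simps)
    qed
    have "range P = W"
    proof
      show "range P \<subseteq> W"
        unfolding P_def T_def B0(3)[symmetric] by (blast intro: span_sum span_scale span_base)
      show "W \<subseteq> range P"
      proof
        fix w assume "w \<in> W"
        then have "w = (\<Sum>b\<in>B0. representation B0 w b *\<^sub>R b)"
          using sum_representation_eq[OF B0(2) _ fin0 order_refl, of w] B0(3) by simp
        then have "rep w b = (if b \<in> B0 then representation B0 w b else 0)" for b
          using rep_sum[OF B(1)] by metis
        then have "P w = w" using \<open>w = _\<close> by (simp add: P_def T_def)
        then show "w \<in> range P" by (metis rangeI)
      qed
    qed
    moreover have "range Q = {x. P x = 0}"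
    proof safe
      show "P (Q x) = 0" for x
        using B(1) by (simp add: P_def Q_def TT) (simp add: T_def)
      show "x \<in> range Q" if "P x = 0" for x
        using PQ[of x] that by (metis add_0 rangeI)
    qed
    moreover have "P \<circ> P = P" "Q \<circ> Q = Q"
      using B(1) by (auto simp: P_def Q_def TT fun_eq_iff)
    moreover have "onorm (\<lambda>x. representation B x b) \<le> C" if "b \<in> B" for b
      using rep[OF that] C by (intro onorm_bound) (auto simp: rep_def)
    moreover have "onorm P \<le> K" "onorm Q \<le> K"
      using nP nQ K by (auto intro!: onorm_bound)
    moreover have "norm (P x + (\<Sum>b\<in>B. (l b * rep (Q x) b) *\<^sub>R b)) \<le> K * norm x"
      if "\<forall>b\<in>B. \<bar>l b\<bar> \<le> 1" for x l
      using key[OF that, of x] by (simp add: K_def distrib_right add_increasing)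
    ultimately show ?thesis
      using B(2,4) spB PQ linT
      unfolding rep_def P_def[symmetric] Q_def[symmetric] adapted_splitting_def
      by (intro exI[of _ B] exI[of _ P] exI[of _ Q]) (auto simp: P_def Q_def)
  qed
  have "K_tilde_admissible TYPE('v) d K"
    unfolding K_tilde_admissible_iff
    by (rule exI[of _ K], rule conjI[OF _ exI[of _ C]], use K C in simp, use C main in simp)
  then show ?thesis using K by blast
qed

section \<open>Rising fragments of a real-valued function\<close>

text \<open>
  The coordinates of \<open>G\<close> are extended from \<open>D\<close> to the whole line, and there Rademacher's theorem applies.
\<close>

lemma Lipschitz_vector_differentiable_within_ae:
  fixes G :: "real \<Rightarrow> 'v::real_normed_vector"
  assumes fd: "finite_dimensional TYPE('v)" and M: "M \<ge> 0"
    and G: "\<And>x y. x \<in> D \<Longrightarrow> y \<in> D \<Longrightarrow> norm (G x - G y) \<le> M * \<bar>x - y\<bar>"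
  shows "negligible {t \<in> D. \<not> (\<exists>v. (G has_vector_derivative v) (at t within D))}"
proof -
  obtain B :: "'v set" where B: "independent B" "span B = UNIV" "finite B"
      "coords_bounded B (3 ^ dim (UNIV::'v set))"
    using exists_bounded_basis[OF fd subspace_UNIV] by metis
  let ?C = "3 ^ dim (UNIV::'v set) :: real"
  define c where "c b x = representation B (G x) b" for b x
  have cL: "\<bar>c b x - c b y\<bar> \<le> (?C * M) * \<bar>x - y\<bar>" if "b \<in> B" "x \<in> D" "y \<in> D" for b x y
  proof -
    have "\<bar>c b x - c b y\<bar> = \<bar>representation B (G x - G y) b\<bar>"
      unfolding c_def using B by (simp add: representation_diff)
    also have "\<dots> \<le> ?C * norm (G x - G y)"
      using coords_bounded_representation[OF B(4,1,3) _ that(1)] B(2) by simp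
    also have "\<dots> \<le> ?C * (M * \<bar>x - y\<bar>)" using G[OF that(2,3)] by (intro mult_left_mono) auto
    finally show ?thesis by simp
  qed
  have "\<forall>b\<in>B. \<exists>h. (\<forall>x\<in>D. h x = c b x) \<and> (\<forall>x y. \<bar>h x - h y\<bar> \<le> (?C * M) * \<bar>x - y\<bar>)"
  proof
    fix b assume b: "b \<in> B"
    obtain h where "\<And>x. x \<in> D \<Longrightarrow> h x = c b x" "\<And>x y. \<bar>h x - h y\<bar> \<le> (?C * M) * \<bar>x - y\<bar>"
      using Lipschitz_real_extension[of D "c b" "?C * M"] cL[OF b] M by auto
    then show "\<exists>h. (\<forall>x\<in>D. h x = c b x) \<and> (\<forall>x y. \<bar>h x - h y\<bar> \<le> (?C * M) * \<bar>x - y\<bar>)" by blast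
  qed
  from bchoice[OF this] obtain h where
    h: "\<forall>b\<in>B. (\<forall>x\<in>D. h b x = c b x) \<and> (\<forall>x y. \<bar>h b x - h b y\<bar> \<le> (?C * M) * \<bar>x - y\<bar>)" ..
  define bad where "bad b = {t. \<not> (\<exists>d. (h b has_real_derivative d) (at t))}" for b
  have "negligible (bad b)" if "b \<in> B" for b
    unfolding bad_def by (rule Lipschitz_real_differentiable_ae[of "h b" "?C * M"]) (use h that in blast)
  then have neg: "negligible (\<Union>b\<in>B. bad b)" using B(3) by (intro negligible_Union) auto
  have "\<exists>v. (G has_vector_derivative v) (at t within D)" if t: "t \<in> D" "t \<notin> (\<Union>b\<in>B. bad b)" for t
  proof -
    have "\<forall>b\<in>B. \<exists>d. (h b has_real_derivative d) (at t)" using t(2) by (auto simp: bad_def)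
    from bchoice[OF this] obtain d where d: "\<forall>b\<in>B. (h b has_real_derivative d b) (at t)" ..
    have "((\<lambda>x. \<Sum>b\<in>B. h b x *\<^sub>R b) has_vector_derivative (\<Sum>b\<in>B. d b *\<^sub>R b)) (at t within D)"
    proof (rule has_vector_derivative_sum)
      fix b assume "b \<in> B"
      then have "(h b has_vector_derivative d b) (at t within D)"
        using d by (auto simp: has_real_derivative_iff_has_vector_derivative intro: has_vector_derivative_at_within)
      then show "((\<lambda>x. h b x *\<^sub>R b) has_vector_derivative d b *\<^sub>R b) (at t within D)"
        by (rule bounded_linear.has_vector_derivative[OF bounded_linear_scaleR_left])
    qed
    then have "(G has_vector_derivative (\<Sum>b\<in>B. d b *\<^sub>R b)) (at t within D)"
    proof (rule has_vector_derivative_transform[OF t(1), rotated])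
      fix x assume "x \<in> D"
      then have "(\<Sum>b\<in>B. h b x *\<^sub>R b) = (\<Sum>b\<in>B. representation B (G x) b *\<^sub>R b)"
        using h by (intro sum.cong) (auto simp: c_def)
      also have "\<dots> = G x" using sum_representation_eq[OF B(1) _ B(3) order_refl] B(2) by simp
      finally show "G x = (\<Sum>b\<in>B. h b x *\<^sub>R b)" by simp
    qed
    then show ?thesis by blast
  qed
  then show ?thesis by (intro negligible_subset[OF neg]) blast
qed

text \<open>
  The obstruction to flattening \<open>f\<close> on \<open>K\<close>: a map into \<open>K\<close>, in general discontinuous, along which \<open>f\<close> grows at
  least as fast as the parameter and at least \<open>\<delta>\<close> times as fast as the distance covered. The two growth
  rates enter as a sum because this is what chains provide, and because it is preserved under pointwise limits.
\<close>

definition rising_fragment :: "('a::metric_space \<Rightarrow> real) \<Rightarrow> real \<Rightarrow> real \<Rightarrow> 'a set \<Rightarrow> (real \<Rightarrow> 'a) \<Rightarrow> bool" where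
  "rising_fragment f \<delta> \<epsilon> K y \<longleftrightarrow> (\<forall>s\<in>{0..\<epsilon>}. y s \<in> K) \<and>
     (\<forall>s\<in>{0..\<epsilon>}. \<forall>s'\<in>{0..\<epsilon>}. s \<le> s' \<longrightarrow> (s' - s) + \<delta> * dist (y s) (y s') \<le> f (y s') - f (y s))"

text \<open>
  Steps of length at most \<open>r\<close> within \<open>K\<close> are charged for their length only; every other step is charged for
  the increase of \<open>f\<close> as well. Only increases count: a bound from one side for both orders of \<open>x\<close> and \<open>y\<close> gives the
  Lipschitz estimates below.
\<close>

definition chain_cost :: "('a::metric_space \<Rightarrow> real) \<Rightarrow> real \<Rightarrow> 'a set \<Rightarrow> real \<Rightarrow> 'a \<Rightarrow> 'a \<Rightarrow> real" where
  "chain_cost f \<delta> K r x y = \<delta> * dist x y + (if x \<in> K \<and> y \<in> K \<and> dist x y \<le> r then 0 else max 0 (f y - f x))"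

lemma dist_le_chain:
  fixes x :: "nat \<Rightarrow> 'a::metric_space"
  assumes "i \<le> j"
  shows "dist (x i) (x j) \<le> (\<Sum>k\<in>{i..<j}. dist (x k) (x (Suc k)))"
  using assms
proof (induction j rule: dec_induct)
  case (step n)
  have "dist (x i) (x (Suc n)) \<le> dist (x i) (x n) + dist (x n) (x (Suc n))" by (rule dist_triangle)
  then show ?case using step by simp
qed simp

text \<open>
  Let \<open>P j\<close> be the gain of \<open>f\<close> along the first \<open>j\<close> steps minus their cost, and let \<open>J s\<close> be the last index with
  \<open>P j \<le> s\<close>. The step from \<open>J s\<close> to its successor increases \<open>P\<close>, so it is a free step. Therefore
  \<open>x (J s)\<close> belongs to \<open>K\<close> and \<open>P (J s)\<close> differs from \<open>s\<close> by at most \<open>L * r\<close>. Between two such indices \<open>f\<close> gains the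
  increment of \<open>P\<close> plus the cost, which is at least \<open>\<delta>\<close> times the distance.
\<close>

lemma cheap_chain_approx_fragment:
  fixes f :: "'a::metric_space \<Rightarrow> real"
  assumes f: "\<And>x y. \<bar>f x - f y\<bar> \<le> L * dist x y" and L: "L \<ge> 0" and \<delta>: "\<delta> > 0" and r: "r \<ge> 0" and \<epsilon>: "\<epsilon> > 0"
    and chain: "f (x 0) + (\<Sum>j<N. chain_cost f \<delta> K r (x j) (x (Suc j))) < f (x N) - \<epsilon>"
  shows "\<exists>y. (\<forall>s\<in>{0..\<epsilon>}. y s \<in> K) \<and> (\<forall>s\<in>{0..\<epsilon>}. \<forall>s'\<in>{0..\<epsilon>}. s \<le> s' \<longrightarrow>
    (s' - s) - L * r + \<delta> * dist (y s) (y s') \<le> f (y s') - f (y s))"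
proof -
  define c where "c j = chain_cost f \<delta> K r (x j) (x (Suc j))" for j
  define P where "P j = f (x j) - f (x 0) - (\<Sum>i<j. c i)" for j
  have P0: "P 0 = 0" by (simp add: P_def)
  have PN: "P N > \<epsilon>" using chain by (simp add: P_def c_def)
  define A where "A s = {j. j \<le> N \<and> P j \<le> s}" for s
  define J where "J s = Max (A s)" for s
  have fin: "finite (A s)" for s unfolding A_def by (rule finite_subset[of _ "{..N}"]) auto
  have ne: "A s \<noteq> {}" if "s \<in> {0..\<epsilon>}" for s using that P0 by (auto simp: A_def intro!: exI[of _ 0])
  have J: "J s < N" "P (J s) \<le> s" "s < P (Suc (J s))" if s: "s \<in> {0..\<epsilon>}" for s
  proof -
    have "J s \<in> A s" unfolding J_def using fin ne[OF s] by (rule Max_in)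
    then have *: "J s \<le> N" "P (J s) \<le> s" by (auto simp: A_def)
    have "J s \<noteq> N" using * PN s by auto
    then show "J s < N" using * by simp
    show "P (J s) \<le> s" by fact
    show "s < P (Suc (J s))"
    proof (rule ccontr)
      assume "\<not> ?thesis"
      then have "Suc (J s) \<in> A s" using \<open>J s < N\<close> by (simp add: A_def)
      then have "Suc (J s) \<le> J s" unfolding J_def using fin by (intro Max_ge)
      then show False by simp
    qed
  qed
  have short: "x (J s) \<in> K \<and> P (J s) \<ge> s - L * r" if s: "s \<in> {0..\<epsilon>}" for s
  proof -
    let ?a = "x (J s)" and ?b = "x (Suc (J s))"
    have step: "P (Suc (J s)) - P (J s) = f ?b - f ?a - c (J s)" by (simp add: P_def)
    have pos: "f ?b - f ?a - c (J s) > 0" using step J(2,3)[OF s] by linarith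
    have dpos: "\<delta> * dist ?a ?b \<ge> 0" using \<delta> by simp
    have sh: "?a \<in> K \<and> ?b \<in> K \<and> dist ?a ?b \<le> r"
    proof (rule ccontr)
      assume "\<not> ?thesis"
      then have "c (J s) = \<delta> * dist ?a ?b + max 0 (f ?b - f ?a)" by (auto simp: c_def chain_cost_def)
      then show False using pos dpos by linarith
    qed
    have "c (J s) \<ge> 0" using dpos by (simp add: c_def chain_cost_def)
    moreover have "f ?b - f ?a \<le> L * dist ?a ?b" using f[of ?b ?a] by (simp add: dist_commute abs_le_iff)
    moreover have "L * dist ?a ?b \<le> L * r" using sh L by (intro mult_left_mono) auto
    ultimately show ?thesis using step J(3)[OF s] sh by linarith
  qed
  have cl: "c j \<ge> \<delta> * dist (x j) (x (Suc j))" for j by (simp add: c_def chain_cost_def)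
  have "(s' - s) - L * r + \<delta> * dist (x (J s)) (x (J s')) \<le> f (x (J s')) - f (x (J s))"
    if s: "s \<in> {0..\<epsilon>}" "s' \<in> {0..\<epsilon>}" "s \<le> s'" for s s'
  proof -
    have "A s \<subseteq> A s'" using s by (auto simp: A_def)
    then have le: "J s \<le> J s'" unfolding J_def using fin ne s by (intro Max_mono) auto
    have "\<delta> * dist (x (J s)) (x (J s')) \<le> \<delta> * (\<Sum>k\<in>{J s..<J s'}. dist (x k) (x (Suc k)))"
      using \<delta> dist_le_chain[OF le] by (intro mult_left_mono) auto
    also have "\<dots> \<le> (\<Sum>k\<in>{J s..<J s'}. c k)"
      unfolding sum_distrib_left by (rule sum_mono) (rule cl)
    also have "\<dots> = (\<Sum>i<J s'. c i) - (\<Sum>i<J s. c i)"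
      using sum_diff_nat_ivl[of 0 "J s" "J s'" c] le by (simp add: atLeast0LessThan)
    also have "\<dots> = f (x (J s')) - f (x (J s)) - (P (J s') - P (J s))" by (simp add: P_def)
    finally show ?thesis using short[OF s(2)] J(2)[OF s(1)] by linarith
  qed
  then show ?thesis using short by (intro exI[of _ "\<lambda>s. x (J s)"]) auto
qed

text \<open>
  The defining inequalities involve two parameters at a time, so they cut out closed subsets of the compact space of
  all maps into \<open>K\<close> with pointwise convergence.
\<close>

lemma approx_fragments_limit:
  fixes f :: "'a::metric_space \<Rightarrow> real"
  assumes K: "compact K" and f: "\<And>x y. \<bar>f x - f y\<bar> \<le> L * dist x y" and L: "L \<ge> 0" and \<epsilon>: "\<epsilon> > 0"
    and ex: "\<And>n::nat. \<exists>y. (\<forall>s\<in>{0..\<epsilon>}. y s \<in> K) \<and> (\<forall>s\<in>{0..\<epsilon>}. \<forall>s'\<in>{0..\<epsilon>}. s \<le> s' \<longrightarrow>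
    (s' - s) - L * (1 / (real n + 1)) + \<delta> * dist (y s) (y s') \<le> f (y s') - f (y s))"
  shows "\<exists>y. rising_fragment f \<delta> \<epsilon> K y"
proof -
  define S where "S = {y :: real \<Rightarrow> 'a. \<forall>s. y s \<in> K}"
  have "S = PiE UNIV (\<lambda>_. K)" by (auto simp: S_def PiE_def extensional_def)
  then have "compactin (product_topology (\<lambda>_. euclidean) UNIV) S"
    using K by (simp add: compactin_PiE)
  then have S: "compact S" by (simp add: euclidean_product_topology)
  define C where "C n = (\<Inter>s\<in>{0..\<epsilon>}. \<Inter>s'\<in>{s..\<epsilon>}. {y :: real \<Rightarrow> 'a.
     (s' - s) - L * (1 / (real n + 1)) + \<delta> * dist (y s) (y s') \<le> f (y s') - f (y s)})" for n :: nat
  have fc: "continuous_on UNIV f"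
    by (rule lipschitz_on_continuous_on[of L], rule lipschitz_onI) (use f L in \<open>auto simp: dist_real_def\<close>)
  have co: "continuous_on UNIV (\<lambda>y :: real \<Rightarrow> 'a. y s)" for s by (rule continuous_on_product_coordinates)
  have cf: "continuous_on UNIV (\<lambda>y :: real \<Rightarrow> 'a. f (y s))" for s
    by (rule continuous_on_compose2[OF fc co]) auto
  have cl: "closed (C n)" for n
    unfolding C_def by (intro closed_INT ballI closed_Collect_le continuous_intros co cf)
  have mono: "C n \<subseteq> C m" if "m \<le> n" for m n
  proof -
    have "1 / (real n + 1) \<le> 1 / (real m + 1)" using that by (intro frac_le) auto
    then have "L * (1 / (real n + 1)) \<le> L * (1 / (real m + 1))" using L by (rule mult_left_mono)
    then show ?thesis unfolding C_def by force
  qed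
  have ne: "S \<inter> C n \<noteq> {}" for n
  proof -
    obtain y where y: "\<forall>s\<in>{0..\<epsilon>}. y s \<in> K" "\<forall>s\<in>{0..\<epsilon>}. \<forall>s'\<in>{0..\<epsilon>}. s \<le> s' \<longrightarrow>
      (s' - s) - L * (1 / (real n + 1)) + \<delta> * dist (y s) (y s') \<le> f (y s') - f (y s)"
      using ex[of n] by (elim exE conjE)
    \<comment> \<open>outside \<open>{0..\<epsilon>}\<close> any value in \<open>K\<close> will do\<close>
    define y' where "y' s = (if s \<in> {0..\<epsilon>} then y s else y 0)" for s
    have "y' \<in> S" using y(1) \<epsilon> by (auto simp: S_def y'_def)
    moreover have "y' \<in> C n" using y(2) by (auto simp: C_def y'_def)
    ultimately show ?thesis by blast
  qed
  have "S \<inter> (\<Inter>n\<in>UNIV. C n) \<noteq> {}"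
  proof (rule compact_imp_fip_image[OF S cl])
    fix I :: "nat set" assume I: "finite I"
    have "C (Max (insert 0 I)) \<subseteq> (\<Inter>n\<in>I. C n)"
      using I by (intro INT_greatest mono Max_ge) auto
    then show "S \<inter> (\<Inter>n\<in>I. C n) \<noteq> {}" using ne[of "Max (insert 0 I)"] by blast
  qed
  then obtain y where y: "y \<in> S" "\<And>n. y \<in> C n" by blast
  have "(s' - s) + \<delta> * dist (y s) (y s') \<le> f (y s') - f (y s)"
    if s: "s \<in> {0..\<epsilon>}" "s' \<in> {0..\<epsilon>}" "s \<le> s'" for s s'
  proof (rule LIMSEQ_le_const2)
    have "(\<lambda>n. 1 / (real n + 1)) \<longlonglongrightarrow> 0"
      using LIMSEQ_inverse_real_of_nat by (simp add: inverse_eq_divide add.commute)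
    then have "(\<lambda>n. (s' - s) - L * (1 / (real n + 1)) + \<delta> * dist (y s) (y s')) \<longlonglongrightarrow>
      (s' - s) - L * 0 + \<delta> * dist (y s) (y s')"
      by (intro tendsto_intros)
    then show "(\<lambda>n. (s' - s) - L * (1 / (real n + 1)) + \<delta> * dist (y s) (y s')) \<longlonglongrightarrow>
      (s' - s) + \<delta> * dist (y s) (y s')" by simp
    show "\<exists>N. \<forall>n\<ge>N. (s' - s) - L * (1 / (real n + 1)) + \<delta> * dist (y s) (y s') \<le> f (y s') - f (y s)"
      using y(2) s unfolding C_def by auto
  qed
  then show ?thesis using y(1) unfolding rising_fragment_def S_def by blast
qed

text \<open>
  Closeness to \<open>f\<close> keeps the perturbed map near \<open>F\<close>, the bound on all increments keeps its Lipschitz constant under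
  control, and the bound on short increments within \<open>K\<close> makes the image of \<open>K\<close> thin.
\<close>

definition flattening ::
  "('a::metric_space \<Rightarrow> real) \<Rightarrow> real \<Rightarrow> real \<Rightarrow> 'a set \<Rightarrow> real \<Rightarrow> ('a \<Rightarrow> real) \<Rightarrow> bool" where
  "flattening f \<epsilon> \<delta> K r g \<longleftrightarrow> r > 0 \<and> (\<forall>x. \<bar>g x - f x\<bar> \<le> \<epsilon>) \<and>
     (\<forall>x y. \<bar>g x - g y\<bar> \<le> \<bar>f x - f y\<bar> + \<delta> * dist x y) \<and>
     (\<forall>x\<in>K. \<forall>y\<in>K. dist x y \<le> r \<longrightarrow> \<bar>g x - g y\<bar> \<le> \<delta> * dist x y)"

text \<open>
  Take for \<open>g z\<close> the infimum of \<open>f (x 0)\<close> plus the cost, over all chains \<open>x\<close> that end at \<open>z\<close>. Prolonging a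
  chain by one step gives \<open>g y \<le> g x + chain_cost f \<delta> K r x y\<close>, and the chain without steps gives \<open>g \<le> f\<close>. If
  \<open>g\<close> fell below \<open>f - \<epsilon>\<close> for every scale \<open>r = 1 / (n + 1)\<close>, the resulting chains would produce a fragment.
\<close>

lemma real_perturbation:
  fixes f :: "'a::metric_space \<Rightarrow> real"
  assumes K: "compact K" and f: "\<And>x y. \<bar>f x - f y\<bar> \<le> L * dist x y" and L: "L \<ge> 0" and \<delta>: "\<delta> > 0" and \<epsilon>: "\<epsilon> > 0"
    and no: "\<not> (\<exists>y. rising_fragment f \<delta> \<epsilon> K y)"
  shows "\<exists>g r. flattening f \<epsilon> \<delta> K r g"
proof -
  have "\<exists>n::nat. \<forall>x N. f (x N) - \<epsilon> \<le> f (x 0) + (\<Sum>j<N. chain_cost f \<delta> K (1 / (real n + 1)) (x j) (x (Suc j)))"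
  proof (rule ccontr)
    assume "\<not> ?thesis"
    then have viol: "\<exists>x N. f (x 0) + (\<Sum>j<N. chain_cost f \<delta> K (1 / (real n + 1)) (x j) (x (Suc j))) < f (x N) - \<epsilon>" for n :: nat
      by (auto simp: not_le)
    have "\<exists>y. rising_fragment f \<delta> \<epsilon> K y"
    proof (rule approx_fragments_limit[OF K f L \<epsilon>])
      fix n :: nat
      obtain x N where "f (x 0) + (\<Sum>j<N. chain_cost f \<delta> K (1 / (real n + 1)) (x j) (x (Suc j))) < f (x N) - \<epsilon>"
        using viol[of n] by blast
      then show "\<exists>y. (\<forall>s\<in>{0..\<epsilon>}. y s \<in> K) \<and> (\<forall>s\<in>{0..\<epsilon>}. \<forall>s'\<in>{0..\<epsilon>}. s \<le> s' \<longrightarrow>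
        (s' - s) - L * (1 / (real n + 1)) + \<delta> * dist (y s) (y s') \<le> f (y s') - f (y s))"
        by (rule cheap_chain_approx_fragment[OF f L \<delta> _ \<epsilon>, rotated]) simp
    qed
    then show False using no by contradiction
  qed
  then obtain n :: nat where n: "\<And>x N. f (x N) - \<epsilon> \<le> f (x 0) + (\<Sum>j<N. chain_cost f \<delta> K (1 / (real n + 1)) (x j) (x (Suc j)))"
    by blast
  define r where "r = 1 / (real n + 1)"
  have r: "r > 0" by (simp add: r_def)
  define c where "c = chain_cost f \<delta> K r"
  define V where "V z = {f (x 0) + (\<Sum>j<N. c (x j) (x (Suc j))) | x N. x N = z}" for z
  define g where "g z = Inf (V z)" for z
  have low: "f z - \<epsilon> \<le> v" if "v \<in> V z" for v z
    using that n unfolding V_def c_def r_def by auto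
  have bdd: "bdd_below (V z)" for z using low by (auto simp: bdd_below_def)
  have fV: "f z \<in> V z" for z
    unfolding V_def by (auto intro!: exI[of _ "\<lambda>_. z"] exI[of _ 0])
  have g1: "f x - \<epsilon> \<le> g x" for x
    unfolding g_def using fV low by (intro cInf_greatest) auto
  have g2: "g x \<le> f x" for x
    unfolding g_def using fV bdd by (rule cInf_lower)
  have gstep: "g y \<le> g x + c x y" for x y
  proof -
    have "g y - c x y \<le> v" if v: "v \<in> V x" for v
    proof -
      obtain p N where p: "v = f (p 0) + (\<Sum>j<N. c (p j) (p (Suc j)))" "p N = x" using v by (auto simp: V_def)
      define p' where "p' = p(Suc N := y)"
      have "(\<Sum>j<N. c (p' j) (p' (Suc j))) = (\<Sum>j<N. c (p j) (p (Suc j)))"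
        by (rule sum.cong) (auto simp: p'_def)
      then have "v + c x y = f (p' 0) + (\<Sum>j<Suc N. c (p' j) (p' (Suc j)))"
        using p by (simp add: p'_def)
      moreover have "p' (Suc N) = y" by (simp add: p'_def)
      ultimately have "v + c x y \<in> V y" unfolding V_def by blast
      then have "g y \<le> v + c x y" unfolding g_def using bdd by (intro cInf_lower)
      then show ?thesis by simp
    qed
    then have "g y - c x y \<le> g x" unfolding g_def[of x] using fV by (intro cInf_greatest) auto
    then show ?thesis by simp
  qed
  have c1: "c x y \<le> \<bar>f x - f y\<bar> + \<delta> * dist x y" for x y
    by (simp add: c_def chain_cost_def max_def abs_if)
  have c2: "c x y = \<delta> * dist x y" if "x \<in> K" "y \<in> K" "dist x y \<le> r" for x y
    using that by (simp add: c_def chain_cost_def)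
  have "\<bar>g x - g y\<bar> \<le> \<bar>f x - f y\<bar> + \<delta> * dist x y" for x y
  proof -
    have "c y x \<le> \<bar>f x - f y\<bar> + \<delta> * dist x y" using c1[of y x] by (simp add: dist_commute abs_minus_commute)
    then show ?thesis using gstep[of y x] gstep[of x y] c1[of x y] by linarith
  qed
  moreover have "\<bar>g x - g y\<bar> \<le> \<delta> * dist x y" if "x \<in> K" "y \<in> K" "dist x y \<le> r" for x y
  proof -
    have "c y x = \<delta> * dist x y" using c2[of y x] that by (simp add: dist_commute)
    then show ?thesis using gstep[of y x] gstep[of x y] c2[OF that] by linarith
  qed
  moreover have "\<bar>g x - f x\<bar> \<le> \<epsilon>" for x using g1[of x] g2[of x] \<epsilon> by linarith
  ultimately have "flattening f \<epsilon> \<delta> K r g" using r unfolding flattening_def by simp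
  then show ?thesis by (intro exI)
qed

lemma norm_vector_derivative_le:
  fixes G :: "real \<Rightarrow> 'v::real_normed_vector"
  assumes d: "(G has_vector_derivative v) (at t within D)" and nb: "at t within D \<noteq> bot" and t: "t \<in> D"
    and G: "\<And>x y. x \<in> D \<Longrightarrow> y \<in> D \<Longrightarrow> norm (G x - G y) \<le> M * \<bar>x - y\<bar>"
  shows "norm v \<le> M"
proof -
  let ?q = "\<lambda>y. norm ((1 / norm (y - t)) *\<^sub>R (G y - (G t + (y - t) *\<^sub>R v)))"
  have "(?q \<longlongrightarrow> 0) (at t within D)"
    using d unfolding has_vector_derivative_def has_derivative_within by (intro tendsto_norm_zero) simp
  moreover have "\<forall>\<^sub>F y in at t within D. norm v - M \<le> ?q y"
    unfolding eventually_at
  proof (intro exI[of _ 1] conjI ballI impI)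
    fix y assume y: "y \<in> D" "y \<noteq> t \<and> dist y t < 1"
    have "\<bar>y - t\<bar> * norm v = norm ((G y - G t) - (G y - (G t + (y - t) *\<^sub>R v)))" by simp
    also have "\<dots> \<le> norm (G y - G t) + norm (G y - (G t + (y - t) *\<^sub>R v))" by (rule norm_triangle_ineq4)
    also have "\<dots> \<le> M * \<bar>y - t\<bar> + norm (G y - (G t + (y - t) *\<^sub>R v))" using G[OF y(1) t] by simp
    finally have "(norm v - M) * \<bar>y - t\<bar> \<le> norm (G y - (G t + (y - t) *\<^sub>R v))" by (simp add: algebra_simps)
    then have "norm v - M \<le> norm (G y - (G t + (y - t) *\<^sub>R v)) / \<bar>y - t\<bar>"
      using y by (simp add: pos_le_divide_eq)
    then show "norm v - M \<le> ?q y" by (simp only: norm_scaleR) simp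
  qed simp
  ultimately have "norm v - M \<le> 0" by (rule tendsto_lowerbound[OF _ _ nb])
  then show ?thesis by simp
qed

text \<open>
  On the closure \<open>Y\<close> of the image of the fragment, \<open>f\<close> is injective with a Lipschitz inverse \<open>\<gamma>\<close>. The curve \<open>\<gamma>\<close> is
  parametrised by \<open>f\<close> itself, so \<open>\<phi> v = 1\<close> for every derivative \<open>v\<close> of \<open>F \<circ> \<gamma>\<close>. Such a \<open>v\<close> has distance at
  least \<open>1 / k\<close> from \<open>W\<close> and norm at most \<open>LF / \<delta>\<close>, which places it in the cone. By nullity \<open>Y\<close> has length zero;
  but the inverse of the fragment maps part of \<open>Y\<close> by a Lipschitz function onto an interval.
\<close>

lemma null_set_no_rising_fragment:
  fixes F :: "'a::metric_space \<Rightarrow> 'v::real_normed_vector" and \<phi> :: "'v \<Rightarrow> real"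
  assumes fd: "finite_dimensional TYPE('v)"
    and F: "\<And>x y. norm (F x - F y) \<le> LF * dist x y" and LF: "LF \<ge> 0"
    and \<phi>: "linear \<phi>" "\<And>v w. w \<in> W \<Longrightarrow> \<bar>\<phi> v\<bar> \<le> k * norm (v - w)" and k: "k > 0" and W: "subspace W"
    and \<delta>: "\<delta> > 0" and \<epsilon>: "\<epsilon> > 0" and \<theta>: "\<theta> < 1" "(1 - \<theta>) * k * LF \<le> \<delta>"
    and K: "compact K" "K \<subseteq> T"
    and null: "\<And>D \<gamma>. biLipschitz_curve D \<gamma> \<Longrightarrow> in_direction F (cone_off W \<theta>) D \<gamma> \<Longrightarrow> hausdorff_measure 1 (\<gamma> ` D \<inter> T) = 0"
  shows "\<not> rising_fragment (\<lambda>x. \<phi> (F x)) \<delta> \<epsilon> K y"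
proof
  assume frag: "rising_fragment (\<lambda>x. \<phi> (F x)) \<delta> \<epsilon> K y"
  define f where "f x = \<phi> (F x)" for x
  have yK: "y s \<in> K" if "s \<in> {0..\<epsilon>}" for s using frag that by (simp add: rising_fragment_def)
  have rise: "(s' - s) + \<delta> * dist (y s) (y s') \<le> f (y s') - f (y s)"
    if "s \<in> {0..\<epsilon>}" "s' \<in> {0..\<epsilon>}" "s \<le> s'" for s s'
    using frag that by (simp add: rising_fragment_def f_def)
  define Lf where "Lf = k * LF"
  have Lf0: "Lf \<ge> 0" using k LF by (simp add: Lf_def)
  have f_lip: "\<bar>f a - f b\<bar> \<le> Lf * dist a b" for a b
  proof -
    have "\<bar>f a - f b\<bar> = \<bar>\<phi> (F a - F b)\<bar>" by (simp add: f_def linear_diff[OF \<phi>(1)])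
    also have "\<dots> \<le> k * norm (F a - F b)" using \<phi>(2)[OF subspace_0[OF W], of "F a - F b"] by simp
    also have "\<dots> \<le> k * (LF * dist a b)" using F k by (intro mult_left_mono) auto
    finally show ?thesis by (simp add: Lf_def)
  qed
  have fc: "continuous_on S f" for S
    by (rule lipschitz_on_continuous_on[of Lf], rule lipschitz_onI) (use f_lip Lf0 in \<open>auto simp: dist_real_def\<close>)
  define A where "A = y ` {0..\<epsilon>}"
  define Y where "Y = closure A"
  have "A \<subseteq> K" unfolding A_def using yK by blast
  then have YK: "Y \<subseteq> K" unfolding Y_def using K(1) by (meson closure_minimal compact_imp_closed)
  have Y: "compact Y" using compact_Int_closed[OF K(1) closed_closure, of A] YK unfolding Y_def by (simp add: Int_absorb1)
  have sepA: "\<bar>s - s'\<bar> + \<delta> * dist (y s) (y s') \<le> \<bar>f (y s) - f (y s')\<bar>" if "s \<in> {0..\<epsilon>}" "s' \<in> {0..\<epsilon>}" for s s'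
  proof (cases "s \<le> s'")
    case True
    then show ?thesis using rise[OF that True] by linarith
  next
    case False
    then show ?thesis using rise[OF that(2,1)] by (simp add: dist_commute)
  qed
  have sepY: "\<delta> * dist a b \<le> \<bar>f a - f b\<bar>" if "a \<in> Y" "b \<in> Y" for a b
  proof -
    have "A \<times> A \<subseteq> {p. \<delta> * dist (fst p) (snd p) \<le> \<bar>f (fst p) - f (snd p)\<bar>}"
    proof safe
      fix a b assume "a \<in> A" "b \<in> A"
      then obtain s s' where "s \<in> {0..\<epsilon>}" "s' \<in> {0..\<epsilon>}" "a = y s" "b = y s'" by (auto simp: A_def)
      then show "\<delta> * dist (fst (a, b)) (snd (a, b)) \<le> \<bar>f (fst (a, b)) - f (snd (a, b))\<bar>"
        using sepA[of s s'] by simp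
    qed
    moreover have "closed {p. \<delta> * dist (fst p) (snd p) \<le> \<bar>f (fst p) - f (snd p)\<bar>}"
      by (intro closed_Collect_le continuous_intros continuous_on_compose2[OF fc]) auto
    ultimately have "closure (A \<times> A) \<subseteq> {p. \<delta> * dist (fst p) (snd p) \<le> \<bar>f (fst p) - f (snd p)\<bar>}"
      by (rule closure_minimal)
    then show ?thesis using that by (auto simp: closure_Times Y_def)
  qed
  have inj: "inj_on f Y"
  proof (rule inj_onI)
    fix a b assume "a \<in> Y" "b \<in> Y" "f a = f b"
    then have "\<delta> * dist a b \<le> 0" using sepY by fastforce
    then show "a = b" using \<delta> by (simp add: mult_le_0_iff)
  qed
  define D where "D = f ` Y"
  define \<gamma> where "\<gamma> = inv_into Y f"
  have \<gamma>Y: "\<gamma> t \<in> Y" "f (\<gamma> t) = t" if "t \<in> D" for t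
    using that unfolding D_def \<gamma>_def by (auto intro: inv_into_into f_inv_into_f)
  have img: "\<gamma> ` D = Y" unfolding D_def \<gamma>_def using inj by (simp add: inv_into_image_cancel)
  have dist\<gamma>: "dist (\<gamma> t) (\<gamma> u) \<le> \<bar>t - u\<bar> / \<delta>" if "t \<in> D" "u \<in> D" for t u
    using sepY[OF \<gamma>Y(1)[OF that(1)] \<gamma>Y(1)[OF that(2)]] \<gamma>Y(2)[OF that(1)] \<gamma>Y(2)[OF that(2)] \<delta>
    by (simp add: field_simps)
  have bil: "biLipschitz_curve D \<gamma>"
    unfolding biLipschitz_curve_def
  proof (intro conjI exI ballI)
    show "compact D" unfolding D_def using Y fc by (intro compact_continuous_image)
    let ?L = "Lf + 1 / \<delta> + 1"
    show L: "?L > 0" using Lf0 \<delta> by (simp add: add_nonneg_pos)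
    fix t u assume tu: "t \<in> D" "u \<in> D"
    have "\<bar>t - u\<bar> \<le> Lf * dist (\<gamma> t) (\<gamma> u)"
      using f_lip[of "\<gamma> t" "\<gamma> u"] \<gamma>Y(2)[OF tu(1)] \<gamma>Y(2)[OF tu(2)] by simp
    also have "\<dots> \<le> ?L * dist (\<gamma> t) (\<gamma> u)" using \<delta> by (intro mult_right_mono) auto
    finally show "\<bar>t - u\<bar> / ?L \<le> dist (\<gamma> t) (\<gamma> u)" using L by (simp add: divide_le_eq mult.commute)
    have "dist (\<gamma> t) (\<gamma> u) \<le> (1 / \<delta>) * \<bar>t - u\<bar>" using dist\<gamma>[OF tu] by simp
    also have "\<dots> \<le> ?L * \<bar>t - u\<bar>" using Lf0 by (intro mult_right_mono) auto
    finally show "dist (\<gamma> t) (\<gamma> u) \<le> ?L * \<bar>t - u\<bar>" .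
  qed
  have cone: "v \<in> cone_off W \<theta> - {0}" if v: "\<phi> v = 1" "norm v \<le> LF / \<delta>" for v
  proof -
    have "v \<noteq> 0" using v(1) linear_0[OF \<phi>(1)] by auto
    have ne: "W \<noteq> {}" using subspace_0[OF W] by blast
    \<comment> \<open>for \<open>w \<in> W\<close> the bound on \<open>\<phi>\<close> gives \<open>1 = \<bar>\<phi> v\<bar> \<le> k * norm (v - w)\<close>\<close>
    have "1 / k \<le> infdist v W"
      unfolding infdist_notempty[OF ne]
    proof (rule cINF_greatest[OF ne])
      fix w assume "w \<in> W"
      then show "1 / k \<le> dist v w" using \<phi>(2)[of w v] v(1) k by (simp add: dist_norm divide_le_eq mult.commute)
    qed
    moreover have "(1 - \<theta>) * norm v \<le> 1 / k"
    proof -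
      have "(1 - \<theta>) * norm v \<le> (1 - \<theta>) * (LF / \<delta>)" using \<theta>(1) v(2) by (intro mult_left_mono) auto
      also have "\<dots> \<le> 1 / k" using \<theta>(2) \<delta> k by (simp add: field_simps)
      finally show ?thesis .
    qed
    ultimately show ?thesis using \<open>v \<noteq> 0\<close> by (simp add: cone_off_def)
  qed
  define G where "G = F \<circ> \<gamma>"
  have GL: "norm (G t - G u) \<le> (LF / \<delta>) * \<bar>t - u\<bar>" if "t \<in> D" "u \<in> D" for t u
  proof -
    have "norm (G t - G u) \<le> LF * dist (\<gamma> t) (\<gamma> u)" unfolding G_def using F by simp
    also have "\<dots> \<le> LF * (\<bar>t - u\<bar> / \<delta>)" using dist\<gamma>[OF that] LF by (intro mult_left_mono) auto
    finally show ?thesis by simp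
  qed
  have \<phi>G: "\<phi> (G t) = t" if "t \<in> D" for t using \<gamma>Y(2)[OF that] by (simp add: G_def f_def)
  have good: "\<exists>v \<in> cone_off W \<theta> - {0}. (G has_vector_derivative v) (at t within D)"
    if t: "t \<in> D" and ex: "\<exists>v. (G has_vector_derivative v) (at t within D)" for t
  proof (cases "at t within D = bot")
    case True
    \<comment> \<open>at an isolated point of \<open>D\<close> every vector is a derivative; the mean slope of \<open>F\<close> over the whole fragment is one in the cone\<close>
    let ?a = "y 0" and ?b = "y \<epsilon>"
    define e where "e = f ?b - f ?a"
    have e: "e > 0" "\<delta> * dist ?a ?b \<le> e"
    proof -
      have "\<epsilon> + \<delta> * dist ?a ?b \<le> e" using rise[of 0 \<epsilon>] \<epsilon> by (simp add: e_def)
      moreover have "\<delta> * dist ?a ?b \<ge> 0" using \<delta> by simp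
      ultimately show "e > 0" "\<delta> * dist ?a ?b \<le> e" using \<epsilon> by linarith+
    qed
    define v where "v = (1 / e) *\<^sub>R (F ?b - F ?a)"
    have "\<phi> v = 1" using e by (simp add: v_def linear_scale[OF \<phi>(1)] linear_diff[OF \<phi>(1)] e_def f_def)
    moreover have "norm v \<le> LF / \<delta>"
    proof -
      have "norm v = norm (F ?b - F ?a) / e" using e by (simp add: v_def)
      also have "\<dots> \<le> LF * dist ?b ?a / e" using F e by (intro divide_right_mono) auto
      also have "\<dots> \<le> LF * (e / \<delta>) / e"
        using e \<delta> LF by (intro divide_right_mono mult_left_mono) (auto simp: field_simps dist_commute)
      finally show ?thesis using e by simp
    qed
    ultimately have "v \<in> cone_off W \<theta> - {0}" by (rule cone)
    moreover have "(G has_vector_derivative v) (at t within D)"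
      unfolding True has_vector_derivative_def has_derivative_def by (auto intro: bounded_linear_scaleR_left)
    ultimately show ?thesis by blast
  next
    case False
    obtain v where v: "(G has_vector_derivative v) (at t within D)" using ex by blast
    have "((\<lambda>u. \<phi> (G u)) has_vector_derivative \<phi> v) (at t within D)"
      by (rule bounded_linear.has_vector_derivative[OF linear_finite_dimensional_bounded_linear[OF fd \<phi>(1)] v])
    then have "((\<lambda>u. u) has_vector_derivative \<phi> v) (at t within D)"
      by (rule has_vector_derivative_transform[OF t, rotated]) (simp add: \<phi>G)
    moreover have "((\<lambda>u. u) has_vector_derivative 1) (at t within D)" by (rule has_vector_derivative_id)
    ultimately have "\<phi> v = 1" by (rule vector_derivative_unique_within[OF False])
    moreover have "norm v \<le> LF / \<delta>" by (rule norm_vector_derivative_le[OF v False t GL])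
    ultimately show ?thesis using cone v by blast
  qed
  have "in_direction F (cone_off W \<theta>) D \<gamma>"
    unfolding in_direction_def
  proof (rule negligible_imp_hausdorff_measure_1_null, rule negligible_subset)
    show "negligible {t \<in> D. \<not> (\<exists>v. (G has_vector_derivative v) (at t within D))}"
      by (rule Lipschitz_vector_differentiable_within_ae[OF fd _ GL]) (use LF \<delta> in auto)
    show "{t \<in> D. \<not> (\<exists>v\<in>cone_off W \<theta> - {0}. ((F \<circ> \<gamma>) has_vector_derivative v) (at t within D))}
        \<subseteq> {t \<in> D. \<not> (\<exists>v. (G has_vector_derivative v) (at t within D))}"
      using good unfolding G_def by blast
  qed
  from null[OF bil this] have "hausdorff_measure 1 Y = 0"
    using YK K(2) by (simp add: img Int_absorb2)
  then have A0: "hausdorff_measure 1 A = 0"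
    using hausdorff_measure_mono[of A Y 1] closure_subset unfolding Y_def by fastforce
  have injy: "inj_on y {0..\<epsilon>}"
  proof (rule inj_onI)
    fix s s' assume "s \<in> {0..\<epsilon>}" "s' \<in> {0..\<epsilon>}" "y s = y s'"
    then show "s = s'" using sepA[of s s'] by simp
  qed
  \<comment> \<open>\<open>\<bar>s - s'\<bar>\<close> is at most the increment of \<open>f\<close>, hence at most \<open>Lf\<close> times the distance; adding \<open>1\<close> makes the constant positive\<close>
  have "hausdorff_measure 1 (inv_into {0..\<epsilon>} y ` A) \<le> ennreal ((Lf + 1) powr 1) * hausdorff_measure 1 A"
  proof (rule hausdorff_measure_lipschitz_image)
    fix a b assume "a \<in> A" "b \<in> A"
    then obtain s s' where s: "s \<in> {0..\<epsilon>}" "s' \<in> {0..\<epsilon>}" "a = y s" "b = y s'" by (auto simp: A_def)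
    have "\<delta> * dist a b \<ge> 0" using \<delta> by simp
    then have "\<bar>s - s'\<bar> \<le> Lf * dist a b" using sepA[OF s(1,2)] f_lip[of a b] s by simp
    also have "\<dots> \<le> (Lf + 1) * dist a b" by (intro mult_right_mono) auto
    finally show "dist (inv_into {0..\<epsilon>} y a) (inv_into {0..\<epsilon>} y b) \<le> (Lf + 1) * dist a b"
      using s injy by (simp add: dist_real_def)
  qed (use Lf0 in auto)
  moreover have "inv_into {0..\<epsilon>} y ` A = {0..\<epsilon>}" unfolding A_def using injy by (simp add: inv_into_image_cancel)
  ultimately have "hausdorff_measure 1 {0..\<epsilon>} \<le> 0" by (simp add: A0)
  then show False using hausdorff_measure_1_interval_pos[OF \<epsilon>] by (simp add: le_zero_eq)
qed

section \<open>Flattening on one compact set\<close>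

lemma abs_le_imp_scaled:
  fixes a b c :: real
  assumes "\<bar>a\<bar> \<le> \<bar>b\<bar> + c" "c \<ge> 0"
  obtains l where "\<bar>l\<bar> \<le> 1" "\<bar>a - l * b\<bar> \<le> c"
proof (cases "\<bar>a\<bar> \<le> \<bar>b\<bar>")
  case True
  show ?thesis
  proof (cases "b = 0")
    case False
    then show ?thesis using True assms(2) by (intro that[of "a / b"]) (auto simp: divide_le_eq)
  qed (use True assms(2) in \<open>auto intro: that[of 0]\<close>)
next
  case False
  have "sgn a * sgn b * b = sgn a * \<bar>b\<bar>" by (simp add: abs_sgn mult.assoc mult.commute[of b])
  moreover have "a = sgn a * \<bar>a\<bar>" by (simp add: sgn_mult_abs)
  ultimately have "\<bar>a - sgn a * sgn b * b\<bar> = \<bar>sgn a\<bar> * \<bar>\<bar>a\<bar> - \<bar>b\<bar>\<bar>"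
    by (metis abs_mult right_diff_distrib)
  also have "\<dots> \<le> c" using False assms by (auto simp: abs_sgn_eq)
  finally show ?thesis by (intro that[of "sgn a * sgn b"]) (auto simp: abs_mult abs_sgn_eq)
qed

text \<open>
  Over short distances in \<open>K\<close> the increments of \<open>\<sigma>\<close> nearly lie in \<open>W\<close>, as if all tangent planes of the image were
  parallel to \<open>W\<close>. Smallness of the Hausdorff measure of the image, as opposed to its content at a fixed scale,
  requires all scales.
\<close>

definition flat_along ::
  "'v::real_normed_vector set \<Rightarrow> 'a::metric_space set \<Rightarrow> real \<Rightarrow> real \<Rightarrow> ('a \<Rightarrow> 'v) \<Rightarrow> bool" where
  "flat_along W K R \<eta> \<sigma> \<longleftrightarrow> (\<exists>r>0. \<forall>x\<in>K. \<forall>y\<in>K. dist x y \<le> r \<longrightarrow>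
     (\<exists>w\<in>W. norm w \<le> R * dist x y \<and> norm (\<sigma> x - \<sigma> y - w) \<le> \<eta> * dist x y))"

lemma flat_along_mono:
  assumes \<sigma>: "flat_along W K R \<eta> \<sigma>" and le: "\<eta> \<le> \<eta>'"
  shows "flat_along W K R \<eta>' \<sigma>"
proof -
  have "\<eta> * dist x y \<le> \<eta>' * dist x y" for x y using le by (rule mult_right_mono) simp
  then show ?thesis using \<sigma> unfolding flat_along_def by (meson order_trans)
qed

text \<open>
  The coordinates of \<open>Q \<circ> F\<close> are flattened and \<open>P \<circ> F\<close> is kept. An increment of a flattened coordinate is \<open>l\<close> times
  the original increment, with \<open>l\<close> of modulus at most \<open>1\<close>, up to an error \<open>\<delta> * dist x y\<close>; this is the situation
  covered by the inequality for \<open>Kc\<close>. On small pieces of \<open>K\<close> only the increment of \<open>P \<circ> F\<close>, which lies in \<open>W\<close>, is left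
  up to such errors.
\<close>

lemma vector_perturbation:
  fixes F :: "'a::metric_space \<Rightarrow> 'v::real_normed_vector" and P Q :: "'v \<Rightarrow> 'v"
  assumes fd: "finite_dimensional TYPE('v)"
    and F: "\<And>x y. norm (F x - F y) \<le> LF * dist x y" and LF: "LF \<ge> 0"
    and W: "subspace W"
    and split: "adapted_splitting W Kd Kp Kc B P Q" and pos: "Kp > 0" "Kd > 0"
    and Kc: "Kc \<ge> 0"
    and \<delta>: "\<delta> > 0" and \<epsilon>: "\<epsilon> > 0" and \<theta>: "\<theta> < 1" "(1 - \<theta>) * (Kp * Kd) * LF \<le> \<delta>"
    and K: "compact K" "K \<subseteq> T"
    and null: "\<And>D \<gamma>. biLipschitz_curve D \<gamma> \<Longrightarrow> in_direction F (cone_off W \<theta>) D \<gamma> \<Longrightarrow> hausdorff_measure 1 (\<gamma> ` D \<inter> T) = 0"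
  shows "\<exists>\<sigma>. (\<forall>x. norm (\<sigma> x - F x) \<le> real (card B) * \<epsilon>) \<and>
    (\<forall>x y. norm (\<sigma> x - \<sigma> y) \<le> (Kc * LF + real (card B) * \<delta>) * dist x y) \<and>
    flat_along W K (Kd * LF) (real (card B) * \<delta>) \<sigma>"
proof -
  note sp = split[unfolded adapted_splitting_def]
  have B: "independent B" "span B = UNIV" "\<forall>b\<in>B. norm b = 1"
    and P: "linear P" "P \<circ> P = P" "range P = W" "linear Q" "\<forall>x. P x + Q x = x"
    and nB: "\<forall>b\<in>B. onorm (\<lambda>x. representation B x b) \<le> Kp" and nPQ: "onorm P \<le> Kd" "onorm Q \<le> Kd"
    and adm: "\<forall>x. \<forall>l::'v \<Rightarrow> real. (\<forall>b\<in>B. \<bar>l b\<bar> \<le> 1) \<longrightarrow>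
              norm (P x + (\<Sum>b\<in>B. (l b * representation B (Q x) b) *\<^sub>R b)) \<le> Kc * norm x"
    using sp by - (elim conjE, assumption)+
  note Kp = pos(1) nB and Kd = pos(2) nPQ
  have finB: "finite B" by (rule independent_finite_dimensional[OF fd B(1)])
  define \<phi> where "\<phi> b v = representation B (Q v) b" for b v
  have nP: "norm (P v) \<le> Kd * norm v" for v
    using onorm[OF linear_finite_dimensional_bounded_linear[OF fd P(1)], of v] Kd(2)
    by (meson mult_right_mono norm_ge_zero order_trans)
  have nQ: "norm (Q v) \<le> Kd * norm v" for v
    using onorm[OF linear_finite_dimensional_bounded_linear[OF fd P(4)], of v] Kd(3)
    by (meson mult_right_mono norm_ge_zero order_trans)
  have lin_rep: "linear (\<lambda>x. representation B x b)" for b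
    using B by (intro linearI) (simp_all add: representation_add representation_scale)
  have nrep: "\<bar>representation B v b\<bar> \<le> Kp * norm v" if "b \<in> B" for b v
  proof -
    have "norm (representation B v b) \<le> onorm (\<lambda>x. representation B x b) * norm v"
      by (rule onorm[OF linear_finite_dimensional_bounded_linear[OF fd lin_rep]])
    also have "\<dots> \<le> Kp * norm v" using Kp(2) that by (intro mult_right_mono) auto
    finally show ?thesis by simp
  qed
  have lin\<phi>: "linear (\<phi> b)" for b
    unfolding \<phi>_def using linear_compose[OF P(4) lin_rep[of b]] by (simp add: o_def)
  have QW: "Q w = 0" if "w \<in> W" for w
  proof -
    obtain z where "w = P z" using P(3) \<open>w \<in> W\<close> by blast
    then have "P w = w" using P(2) by (metis comp_apply)
    then show ?thesis using P(5) by (metis add_cancel_right_right)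
  qed
  have \<phi>W: "\<bar>\<phi> b v\<bar> \<le> (Kp * Kd) * norm (v - w)" if "b \<in> B" "w \<in> W" for b v w
  proof -
    have "Q v = Q (v - w)" using QW[OF that(2)] by (simp add: linear_diff[OF P(4)])
    then have "\<bar>\<phi> b v\<bar> \<le> Kp * norm (Q (v - w))" unfolding \<phi>_def using nrep[OF that(1)] by simp
    also have "\<dots> \<le> Kp * (Kd * norm (v - w))" using nQ Kp by (intro mult_left_mono) auto
    finally show ?thesis by simp
  qed
  have sum\<phi>: "(\<Sum>b\<in>B. \<phi> b v *\<^sub>R b) = Q v" for v
    unfolding \<phi>_def using sum_representation_eq[OF B(1) _ finB order_refl] B(2) by simp
  have \<phi>diff: "\<phi> b u - \<phi> b v = \<phi> b (u - v)" for b u v by (simp add: linear_diff[OF lin\<phi>])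
  have "\<forall>b\<in>B. \<exists>g r. flattening (\<lambda>x. \<phi> b (F x)) \<epsilon> \<delta> K r g"
  proof
    fix b assume b: "b \<in> B"
    show "\<exists>g r. flattening (\<lambda>x. \<phi> b (F x)) \<epsilon> \<delta> K r g"
    proof (rule real_perturbation[OF K(1) _ _ \<delta> \<epsilon>])
      fix x y
      have "\<bar>\<phi> b (F x) - \<phi> b (F y)\<bar> \<le> (Kp * Kd) * norm (F x - F y)"
        unfolding \<phi>diff using \<phi>W[OF b subspace_0[OF W], of "F x - F y"] by simp
      also have "\<dots> \<le> (Kp * Kd) * (LF * dist x y)" using F Kp Kd by (intro mult_left_mono) auto
      finally show "\<bar>\<phi> b (F x) - \<phi> b (F y)\<bar> \<le> (Kp * Kd * LF) * dist x y" by simp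
    next
      show "0 \<le> Kp * Kd * LF" using Kp Kd LF by simp
      have "\<not> rising_fragment (\<lambda>x. \<phi> b (F x)) \<delta> \<epsilon> K y" for y
      proof (rule null_set_no_rising_fragment[OF fd F LF lin\<phi> _ _ W \<delta> \<epsilon> \<theta> K])
        show "Kp * Kd > 0" using Kp Kd by simp
        show "\<bar>\<phi> b v\<bar> \<le> Kp * Kd * norm (v - w)" if "w \<in> W" for v w by (rule \<phi>W[OF b that])
      qed (fact null)
      then show "\<not> (\<exists>y. rising_fragment (\<lambda>x. \<phi> b (F x)) \<delta> \<epsilon> K y)" by blast
    qed
  qed
  from bchoice[OF this] obtain g where "\<forall>b\<in>B. \<exists>r. flattening (\<lambda>x. \<phi> b (F x)) \<epsilon> \<delta> K r (g b)" ..
  from bchoice[OF this] obtain r where gr: "\<forall>b\<in>B. flattening (\<lambda>x. \<phi> b (F x)) \<epsilon> \<delta> K (r b) (g b)" ..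
  define r0 where "r0 = Min (insert 1 (r ` B))"
  have rpos: "r b > 0" and g_near: "\<bar>g b x - \<phi> b (F x)\<bar> \<le> \<epsilon>"
    and g_lip: "\<bar>g b x - g b y\<bar> \<le> \<bar>\<phi> b (F x - F y)\<bar> + \<delta> * dist x y" if "b \<in> B" for b x y
    using bspec[OF gr that] by (simp_all add: flattening_def \<phi>diff)
  have g_flat: "\<bar>g b x - g b y\<bar> \<le> \<delta> * dist x y" if "b \<in> B" "x \<in> K" "y \<in> K" "dist x y \<le> r b" for b x y
    using bspec[OF gr that(1)] that(2-4) by (simp add: flattening_def)
  have r0: "r0 > 0" "\<And>b. b \<in> B \<Longrightarrow> r0 \<le> r b" using rpos finB by (auto simp: r0_def)
  define \<sigma> where "\<sigma> x = P (F x) + (\<Sum>b\<in>B. g b x *\<^sub>R b)" for x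
  have \<sigma>diff: "\<sigma> x - \<sigma> y = P (F x - F y) + (\<Sum>b\<in>B. (g b x - g b y) *\<^sub>R b)" for x y
    by (simp add: \<sigma>_def linear_diff[OF P(1)] scaleR_diff_left sum_subtractf)
  have c1: "norm (\<sigma> x - F x) \<le> real (card B) * \<epsilon>" for x
  proof -
    have "(\<Sum>b\<in>B. (g b x - \<phi> b (F x)) *\<^sub>R b) = (\<Sum>b\<in>B. g b x *\<^sub>R b) - Q (F x)"
      by (simp only: scaleR_diff_left sum_subtractf sum\<phi>)
    also have "\<dots> = \<sigma> x - (P (F x) + Q (F x))" by (simp only: \<sigma>_def add_diff_cancel_left)
    also have "\<dots> = \<sigma> x - F x" by (simp only: P(5)[rule_format])
    finally have "\<sigma> x - F x = (\<Sum>b\<in>B. (g b x - \<phi> b (F x)) *\<^sub>R b)" ..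
    also have "norm \<dots> \<le> real (card B) * \<epsilon>"
      using B(3) g_near by (intro norm_sum_scaleR_le) auto
    finally show ?thesis .
  qed
  have c2: "norm (\<sigma> x - \<sigma> y) \<le> (Kc * LF + real (card B) * \<delta>) * dist x y" for x y
  proof -
    let ?v = "F x - F y"
    have "\<forall>b\<in>B. \<exists>l. \<bar>l\<bar> \<le> 1 \<and> \<bar>(g b x - g b y) - l * \<phi> b ?v\<bar> \<le> \<delta> * dist x y"
    proof
      fix b assume "b \<in> B"
      have "\<delta> * dist x y \<ge> 0" using \<delta> by simp
      with g_lip[OF \<open>b \<in> B\<close>] obtain l where "\<bar>l\<bar> \<le> 1" "\<bar>(g b x - g b y) - l * \<phi> b ?v\<bar> \<le> \<delta> * dist x y"
        by (rule abs_le_imp_scaled)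
      then show "\<exists>l. \<bar>l\<bar> \<le> 1 \<and> \<bar>(g b x - g b y) - l * \<phi> b ?v\<bar> \<le> \<delta> * dist x y" by blast
    qed
    from bchoice[OF this] obtain l where l: "\<forall>b\<in>B. \<bar>l b\<bar> \<le> 1 \<and> \<bar>(g b x - g b y) - l b * \<phi> b ?v\<bar> \<le> \<delta> * dist x y" ..
    have "\<sigma> x - \<sigma> y = (P ?v + (\<Sum>b\<in>B. (l b * \<phi> b ?v) *\<^sub>R b)) + (\<Sum>b\<in>B. ((g b x - g b y) - l b * \<phi> b ?v) *\<^sub>R b)"
      unfolding \<sigma>diff by (simp add: scaleR_diff_left sum_subtractf)
    then have "norm (\<sigma> x - \<sigma> y) \<le> norm (P ?v + (\<Sum>b\<in>B. (l b * \<phi> b ?v) *\<^sub>R b))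
        + norm (\<Sum>b\<in>B. ((g b x - g b y) - l b * \<phi> b ?v) *\<^sub>R b)"
      by (simp only: norm_triangle_ineq)
    also have "\<dots> \<le> Kc * norm ?v + real (card B) * (\<delta> * dist x y)"
    proof (rule add_mono)
      show "norm (P ?v + (\<Sum>b\<in>B. (l b * \<phi> b ?v) *\<^sub>R b)) \<le> Kc * norm ?v"
        unfolding \<phi>_def using l by (intro adm[rule_format]) auto
      show "norm (\<Sum>b\<in>B. ((g b x - g b y) - l b * \<phi> b ?v) *\<^sub>R b) \<le> real (card B) * (\<delta> * dist x y)"
        using l B(3) by (intro norm_sum_scaleR_le) auto
    qed
    also have "\<dots> \<le> Kc * (LF * dist x y) + real (card B) * (\<delta> * dist x y)"
      by (rule add_right_mono[OF mult_left_mono[OF F Kc]])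
    finally show ?thesis by (simp add: algebra_simps)
  qed
  have c3: "\<exists>w\<in>W. norm w \<le> Kd * LF * dist x y \<and> norm (\<sigma> x - \<sigma> y - w) \<le> real (card B) * \<delta> * dist x y"
    if "x \<in> K" "y \<in> K" "dist x y \<le> r0" for x y
  proof (intro bexI conjI)
    show "P (F x - F y) \<in> W" using P(3) by blast
    have "norm (P (F x - F y)) \<le> Kd * norm (F x - F y)" by (rule nP)
    also have "\<dots> \<le> Kd * (LF * dist x y)" using F Kd by (intro mult_left_mono) auto
    finally show "norm (P (F x - F y)) \<le> Kd * LF * dist x y" by simp
    have "norm (\<Sum>b\<in>B. (g b x - g b y) *\<^sub>R b) \<le> real (card B) * (\<delta> * dist x y)"
    proof (rule norm_sum_scaleR_le)
      fix b assume b: "b \<in> B"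
      then have "dist x y \<le> r b" using r0(2) that(3) by (meson order_trans)
      then show "\<bar>g b x - g b y\<bar> \<le> \<delta> * dist x y" by (rule g_flat[OF b that(1,2)])
    qed (use B in auto)
    then show "norm (\<sigma> x - \<sigma> y - P (F x - F y)) \<le> real (card B) * \<delta> * dist x y"
      by (simp add: \<sigma>diff mult.assoc)
  qed
  have "flat_along W K (Kd * LF) (real (card B) * \<delta>) \<sigma>"
    unfolding flat_along_def using r0(1) by (intro exI[of _ r0] conjI ballI impI c3)
  then show ?thesis by (intro exI[of _ \<sigma>] conjI allI c1 c2)
qed

section \<open>Gluing perturbations with disjoint supports\<close>

lemma infdist_less_imp_close:
  assumes "K \<noteq> {}" "infdist x K < r"
  obtains a where "a \<in> K" "dist x a < r"
  using cInf_lessD[of "dist x ` K" r] assms by (auto simp: infdist_notempty)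

lemma disjoint_compact_separated:
  fixes S T :: "'a::metric_space set"
  assumes "compact S" "compact T" "S \<inter> T = {}"
  shows "\<exists>r>0. \<forall>x\<in>S. \<forall>y\<in>T. r \<le> dist x y"
proof (cases "S \<times> T = {}")
  case True
  then have "\<forall>x\<in>S. \<forall>y\<in>T. (1::real) \<le> dist x y" by auto
  then show ?thesis by (intro exI[of _ 1]) simp
next
  case False
  have "continuous_on (S \<times> T) (\<lambda>p. dist (fst p) (snd p))" by (intro continuous_intros)
  then obtain p where p: "p \<in> S \<times> T" "\<forall>q\<in>S \<times> T. dist (fst p) (snd p) \<le> dist (fst q) (snd q)"
    using continuous_attains_inf[OF compact_Times[OF assms(1,2)] False] by blast
  have "fst p \<noteq> snd p" using p(1) assms(3) by (metis IntI empty_iff mem_Times_iff)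
  then have "dist (fst p) (snd p) > 0" by simp
  moreover have "dist (fst p) (snd p) \<le> dist x y" if "x \<in> S" "y \<in> T" for x y
    using bspec[OF p(2), of "(x, y)"] that by simp
  ultimately show ?thesis by blast
qed

lemma compact_family_separated:
  fixes K :: "nat \<Rightarrow> 'a::metric_space set"
  assumes K: "\<And>i. i < M \<Longrightarrow> compact (K i)"
    and disj: "\<And>i j. i < M \<Longrightarrow> j < M \<Longrightarrow> i \<noteq> j \<Longrightarrow> K i \<inter> K j = {}"
  obtains r where "r > 0" "\<And>i j x y. i < M \<Longrightarrow> j < M \<Longrightarrow> i \<noteq> j \<Longrightarrow> x \<in> K i \<Longrightarrow> y \<in> K j \<Longrightarrow> r \<le> dist x y"
proof -
  define I where "I = {p. fst p < M \<and> snd p < M \<and> fst p \<noteq> snd p}"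
  have "\<forall>p\<in>I. \<exists>r>0. \<forall>x\<in>K (fst p). \<forall>y\<in>K (snd p). r \<le> dist x y"
  proof
    fix p assume "p \<in> I"
    then have p: "fst p < M" "snd p < M" "fst p \<noteq> snd p" by (auto simp: I_def)
    show "\<exists>r>0. \<forall>x\<in>K (fst p). \<forall>y\<in>K (snd p). r \<le> dist x y"
      by (rule disjoint_compact_separated[OF K[OF p(1)] K[OF p(2)] disj[OF p]])
  qed
  from bchoice[OF this] obtain r where r: "\<forall>p\<in>I. r p > 0 \<and> (\<forall>x\<in>K (fst p). \<forall>y\<in>K (snd p). r p \<le> dist x y)" ..
  have fin: "finite I" by (rule finite_subset[of _ "{..<M} \<times> {..<M}"]) (auto simp: I_def)
  show ?thesis
  proof (rule that[of "Min (insert 1 (r ` I))"])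
    show "Min (insert 1 (r ` I)) > 0" using r fin by auto
    fix i j x y assume *: "i < M" "j < M" "i \<noteq> j" "x \<in> K i" "y \<in> K j"
    then have "(i, j) \<in> I" by (simp add: I_def)
    then have "Min (insert 1 (r ` I)) \<le> r (i, j)" using fin by (intro Min_le) auto
    also have "\<dots> \<le> dist x y" using bspec[OF r \<open>(i, j) \<in> I\<close>] * by auto
    finally show "Min (insert 1 (r ` I)) \<le> dist x y" .
  qed
qed

text \<open>
  The correction of \<open>F\<close> towards the \<open>i\<close>-th perturbation is multiplied by a cut-off function of slope \<open>1 / r\<close> around
  \<open>K i\<close>. Points at distance less than \<open>r\<close> see the same cut-off function, and there the increment is a convex combination
  of increments of \<open>F\<close> and of the perturbation. Everything else is of order \<open>\<eta> / r\<close> times the distance,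
  where \<open>\<eta>\<close> is the uniform size of the perturbations, chosen after \<open>r\<close>.
\<close>

lemma glue_perturbations:
  fixes F :: "'a::metric_space \<Rightarrow> 'v::real_normed_vector" and K :: "nat \<Rightarrow> 'a set"
  assumes F: "\<And>x y. norm (F x - F y) \<le> \<Lambda> * dist x y"
    and K: "\<And>i. i < M \<Longrightarrow> compact (K i)"
    and disj: "\<And>i j. i < M \<Longrightarrow> j < M \<Longrightarrow> i \<noteq> j \<Longrightarrow> K i \<inter> K j = {}"
    and \<rho>: "\<rho> > 0" and \<epsilon>: "\<epsilon> > 0"
    and ex: "\<And>i \<eta>. i < M \<Longrightarrow> \<eta> > 0 \<Longrightarrow> \<exists>\<sigma>. (\<forall>x. norm (\<sigma> x - F x) \<le> \<eta>) \<and>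
        (\<forall>x y. norm (\<sigma> x - \<sigma> y) \<le> \<Lambda> * dist x y) \<and> Pr i \<sigma>"
    and Pr: "\<And>i \<sigma> \<tau>. i < M \<Longrightarrow> Pr i \<sigma> \<Longrightarrow> (\<And>x. x \<in> K i \<Longrightarrow> \<tau> x = \<sigma> x) \<Longrightarrow> Pr i \<tau>"
  shows "\<exists>\<sigma>. (\<forall>x y. norm (\<sigma> x - \<sigma> y) \<le> (\<Lambda> + \<epsilon>) * dist x y) \<and> (\<forall>x. norm (\<sigma> x - F x) < \<epsilon>) \<and>
     (\<forall>x. (\<forall>i<M. K i \<noteq> {} \<longrightarrow> \<rho> \<le> infdist x (K i)) \<longrightarrow> \<sigma> x = F x) \<and> (\<forall>i<M. Pr i \<sigma>)"
proof -
  obtain d0 where d0: "d0 > 0" "\<And>i j x y. i < M \<Longrightarrow> j < M \<Longrightarrow> i \<noteq> j \<Longrightarrow> x \<in> K i \<Longrightarrow> y \<in> K j \<Longrightarrow> d0 \<le> dist x y"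
    using compact_family_separated[of M K] K disj by blast
  define r where "r = min \<rho> (d0 / 3)"
  have r: "r > 0" "r \<le> \<rho>" "3 * r \<le> d0" using \<rho> d0(1) by (auto simp: r_def)
  \<comment> \<open>at distance at least \<open>r\<close> both values may be off by \<open>\<eta>\<close>, whence \<open>2 * \<eta> / r \<le> \<epsilon>\<close>\<close>
  define \<eta> where "\<eta> = min (\<epsilon> / 2) (\<epsilon> * r / 2)"
  have \<eta>: "\<eta> > 0" "\<eta> < \<epsilon>" "2 * \<eta> / r \<le> \<epsilon>"
    using \<epsilon> r(1) by (auto simp: \<eta>_def divide_le_eq)
  have "\<forall>i\<in>{..<M}. \<exists>\<sigma>. (\<forall>x. norm (\<sigma> x - F x) \<le> \<eta>) \<and> (\<forall>x y. norm (\<sigma> x - \<sigma> y) \<le> \<Lambda> * dist x y) \<and> Pr i \<sigma>"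
    using ex \<eta>(1) by simp
  from bchoice[OF this] obtain \<tau> where
    \<tau>: "\<forall>i\<in>{..<M}. (\<forall>x. norm (\<tau> i x - F x) \<le> \<eta>) \<and> (\<forall>x y. norm (\<tau> i x - \<tau> i y) \<le> \<Lambda> * dist x y) \<and> Pr i (\<tau> i)" ..
  have \<tau>1: "norm (\<tau> i x - F x) \<le> \<eta>" and \<tau>2: "norm (\<tau> i x - \<tau> i y) \<le> \<Lambda> * dist x y" and \<tau>3: "Pr i (\<tau> i)"
    if "i < M" for i x y
    using bspec[OF \<tau>, of i] that by simp_all
  define \<phi> where "\<phi> i x = (if K i = {} then 0 else max 0 (1 - infdist x (K i) / r))" for i x
  have \<phi>01: "0 \<le> \<phi> i x" "\<phi> i x \<le> 1" for i x
    using infdist_nonneg[of x "K i"] r(1) by (auto simp: \<phi>_def)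
  have \<phi>L: "\<bar>\<phi> i x - \<phi> i y\<bar> \<le> dist x y / r" for i x y
  proof -
    have "\<bar>infdist x (K i) - infdist y (K i)\<bar> \<le> dist x y" by (rule infdist_triangle_abs)
    then have "\<bar>infdist x (K i) / r - infdist y (K i) / r\<bar> \<le> dist x y / r"
      using r(1) by (simp add: diff_divide_distrib[symmetric] divide_right_mono)
    moreover have "\<bar>max 0 (1 - u) - max 0 (1 - v)\<bar> \<le> \<bar>u - v\<bar>" for u v :: real
      by (simp add: max_def abs_if)
    ultimately have "\<bar>max 0 (1 - infdist x (K i) / r) - max 0 (1 - infdist y (K i) / r)\<bar> \<le> dist x y / r"
      by (rule order_trans[rotated])
    moreover have "dist x y / r \<ge> 0" using r(1) by simp
    ultimately show ?thesis by (cases "K i = {}") (simp_all only: \<phi>_def if_True if_False simp_thms diff_self abs_zero)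
  qed
  have \<phi>K: "\<phi> i x = 1" if "x \<in> K i" for i x using that by (auto simp: \<phi>_def)
  have act: "\<exists>a\<in>K i. dist x a < r" if "\<phi> i x \<noteq> 0" for i x
  proof -
    have ne: "K i \<noteq> {}" and "1 - infdist x (K i) / r > 0" using that by (auto simp: \<phi>_def max_def split: if_splits)
    then have "infdist x (K i) < r" using r(1) by (simp add: divide_less_eq)
    then show ?thesis using infdist_less_imp_close[OF ne] by blast
  qed
  have uniq: "i = j" if ij: "i < M" "j < M" "\<phi> i x \<noteq> 0" "\<phi> j y \<noteq> 0" "dist x y < r" for i j x y
  proof (rule ccontr)
    assume "i \<noteq> j"
    obtain a b where a: "a \<in> K i" "dist x a < r" and b: "b \<in> K j" "dist y b < r"
      using act[OF ij(3)] act[OF ij(4)] by blast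
    have "dist a b \<le> dist x a + dist x y + dist y b"
      using dist_triangle[of a b x] dist_triangle[of x b y] by (simp add: dist_commute)
    then have "dist a b < 3 * r" using a b ij(5) by linarith
    then show False using d0(2)[OF ij(1,2) \<open>i \<noteq> j\<close> a(1) b(1)] r(3) by linarith
  qed
  define \<sigma> where "\<sigma> x = F x + (\<Sum>i<M. \<phi> i x *\<^sub>R (\<tau> i x - F x))" for x
  have single: "\<sigma> x = F x + \<phi> i x *\<^sub>R (\<tau> i x - F x)" if "i < M" "\<And>j. j < M \<Longrightarrow> j \<noteq> i \<Longrightarrow> \<phi> j x = 0" for i x
  proof -
    have "(\<Sum>j<M. \<phi> j x *\<^sub>R (\<tau> j x - F x)) = (\<Sum>j\<in>{i}. \<phi> j x *\<^sub>R (\<tau> j x - F x))"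
      by (rule sum.mono_neutral_right) (use that in auto)
    then show ?thesis by (simp add: \<sigma>_def)
  qed
  have none: "\<sigma> x = F x" if "\<And>j. j < M \<Longrightarrow> \<phi> j x = 0" for x
    using that by (simp add: \<sigma>_def)
  \<comment> \<open>nearby points are affected by at most one common perturbation\<close>
  have close: "(\<sigma> x = F x \<and> \<sigma> y = F y) \<or> (\<exists>i<M. \<sigma> x = F x + \<phi> i x *\<^sub>R (\<tau> i x - F x) \<and> \<sigma> y = F y + \<phi> i y *\<^sub>R (\<tau> i y - F y))"
    if xy: "dist x y < r" for x y
  proof (cases "\<exists>i<M. \<phi> i x \<noteq> 0 \<or> \<phi> i y \<noteq> 0")
    case False
    then show ?thesis using none by blast
  next
    case True
    then obtain i where i: "i < M" "\<phi> i x \<noteq> 0 \<or> \<phi> i y \<noteq> 0" by blast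
    have yx: "dist y x < r" using xy by (simp add: dist_commute)
    have rr: "dist z z < r" for z using r(1) by simp
    have "\<phi> j x = 0" "\<phi> j y = 0" if "j < M" "j \<noteq> i" for j
      using i(2) uniq[OF i(1) that(1), of x x] uniq[OF i(1) that(1), of x y] uniq[OF i(1) that(1), of y x]
        uniq[OF i(1) that(1), of y y] that(2) xy yx rr by auto
    then show ?thesis using single[OF i(1)] i(1) by blast
  qed
  have near: "norm (\<sigma> x - F x) \<le> \<eta>" for x
  proof -
    have "dist x x < r" using r(1) by simp
    from close[OF this] show ?thesis
    proof (elim disjE exE conjE)
      fix i assume i: "i < M" "\<sigma> x = F x + \<phi> i x *\<^sub>R (\<tau> i x - F x)"
      have "norm (\<sigma> x - F x) = \<phi> i x * norm (\<tau> i x - F x)" using i(2) \<phi>01(1)[of i x] by simp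
      also have "\<dots> \<le> 1 * \<eta>" using \<phi>01[of i x] \<tau>1[OF i(1), of x] by (intro mult_mono) auto
      finally show ?thesis by simp
    qed (use \<eta> in simp)
  qed
  have lip: "norm (\<sigma> x - \<sigma> y) \<le> (\<Lambda> + \<epsilon>) * dist x y" for x y
  proof (cases "dist x y < r")
    case False
    have "\<sigma> x - \<sigma> y = (\<sigma> x - F x) - (\<sigma> y - F y) + (F x - F y)" by simp
    then have "norm (\<sigma> x - \<sigma> y) \<le> norm (\<sigma> x - F x) + norm (\<sigma> y - F y) + norm (F x - F y)"
      by (metis add_right_mono norm_triangle_ineq norm_triangle_ineq4 order_trans)
    also have "\<dots> \<le> \<eta> + \<eta> + \<Lambda> * dist x y" by (intro add_mono near F)
    also have "\<eta> + \<eta> = (2 * \<eta> / r) * r" using r(1) by simp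
    also have "\<dots> \<le> \<epsilon> * dist x y" using \<eta>(1,3) r(1) False \<epsilon> by (intro mult_mono) auto
    finally show ?thesis by (simp add: algebra_simps)
  next
    case True
    have F': "norm (F x - F y) \<le> (\<Lambda> + \<epsilon>) * dist x y"
      using F[of x y] \<epsilon> zero_le_dist[of x y] by (simp add: distrib_right add_increasing2)
    from close[OF True] show ?thesis
    proof (elim disjE exE conjE)
      fix i assume i: "i < M" and sx: "\<sigma> x = F x + \<phi> i x *\<^sub>R (\<tau> i x - F x)" and sy: "\<sigma> y = F y + \<phi> i y *\<^sub>R (\<tau> i y - F y)"
      let ?t = "\<phi> i x"
      have "\<sigma> x - \<sigma> y = (1 - ?t) *\<^sub>R (F x - F y) + ?t *\<^sub>R (\<tau> i x - \<tau> i y) + (?t - \<phi> i y) *\<^sub>R (\<tau> i y - F y)"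
        unfolding sx sy by (simp add: algebra_simps)
      then have "norm (\<sigma> x - \<sigma> y) \<le> norm ((1 - ?t) *\<^sub>R (F x - F y)) + norm (?t *\<^sub>R (\<tau> i x - \<tau> i y))
          + norm ((?t - \<phi> i y) *\<^sub>R (\<tau> i y - F y))"
        by (metis add_right_mono norm_triangle_ineq order_trans)
      also have "\<dots> \<le> (1 - ?t) * (\<Lambda> * dist x y) + ?t * (\<Lambda> * dist x y) + (dist x y / r) * \<eta>"
      proof (intro add_mono)
        show "norm ((1 - ?t) *\<^sub>R (F x - F y)) \<le> (1 - ?t) * (\<Lambda> * dist x y)"
          using \<phi>01[of i x] F[of x y] by (simp add: mult_left_mono)
        show "norm (?t *\<^sub>R (\<tau> i x - \<tau> i y)) \<le> ?t * (\<Lambda> * dist x y)"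
          using \<phi>01[of i x] \<tau>2[OF i, of x y] by (simp add: mult_left_mono)
        have "\<bar>?t - \<phi> i y\<bar> * norm (\<tau> i y - F y) \<le> (dist x y / r) * \<eta>"
          using \<phi>L[of i x y] \<tau>1[OF i, of y] r(1) by (intro mult_mono) auto
        then show "norm ((?t - \<phi> i y) *\<^sub>R (\<tau> i y - F y)) \<le> (dist x y / r) * \<eta>" by simp
      qed
      also have "(1 - ?t) * (\<Lambda> * dist x y) + ?t * (\<Lambda> * dist x y) = \<Lambda> * dist x y" by (simp add: algebra_simps)
      also have "(dist x y / r) * \<eta> = (\<eta> / r) * dist x y" by simp
      also have "\<dots> \<le> \<epsilon> * dist x y"
      proof (intro mult_right_mono)
        have "\<eta> / r \<le> 2 * \<eta> / r" using \<eta>(1) r(1) by (simp add: divide_right_mono)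
        then show "\<eta> / r \<le> \<epsilon>" using \<eta>(3) by linarith
      qed simp
      finally show ?thesis by (simp add: distrib_right)
    qed (use F' in simp)
  qed
  have away: "\<sigma> x = F x" if "\<forall>i<M. K i \<noteq> {} \<longrightarrow> \<rho> \<le> infdist x (K i)" for x
  proof (rule none)
    fix j assume j: "j < M"
    show "\<phi> j x = 0"
    proof (cases "K j = {}")
      case False
      then have "r \<le> infdist x (K j)" using that j r(2) by fastforce
      then have "1 \<le> infdist x (K j) / r" using r(1) by simp
      then show ?thesis by (simp add: \<phi>_def)
    qed (simp add: \<phi>_def)
  qed
  have prp: "Pr i \<sigma>" if i: "i < M" for i
  proof (rule Pr[OF i \<tau>3[OF i]])
    fix x assume x: "x \<in> K i"
    have "\<phi> j x = 0" if "j < M" "j \<noteq> i" for j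
      using uniq[OF that(1) i, of x x] \<phi>K[OF x] that(2) r(1) by auto
    from single[OF i this] show "\<sigma> x = \<tau> i x" using \<phi>K[OF x] by simp
  qed
  show ?thesis
    by (rule exI[of _ \<sigma>], intro conjI allI impI) (rule lip, rule le_less_trans[OF near \<eta>(2)], rule away, assumption, rule prp, assumption)
qed

section \<open>Images that are nearly flat at small scales\<close>

text \<open>
  The nearby vectors of \<open>W\<close> are sorted into the cells of a grid of mesh \<open>\<eta> * h\<close>, in coordinates with respect to a basis
  of \<open>W\<close> with bounded coordinates. There are of the order of \<open>\<eta>\<close> to the power \<open>- dim W\<close> cells, each of diameter
  comparable to \<open>\<eta> * h\<close>.
\<close>

lemma hausdorff_content_near_subspace:
  fixes W A :: "'v::real_normed_vector set" and \<eta> R h s \<rho> :: real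
  assumes fd: "finite_dimensional TYPE('v)" and W: "subspace W"
    and \<eta>: "0 < \<eta>" "\<eta> \<le> 1" and R: "R \<ge> 0" and h: "h \<ge> 0" and s: "s > 0"
    and A: "\<And>z. z \<in> A \<Longrightarrow> \<exists>w\<in>W. norm w \<le> R * h \<and> norm (z - a - w) \<le> \<eta> * h"
    and \<rho>: "(real (dim W) + 2) * h \<le> \<rho>"
  shows "hausdorff_content s \<rho> A \<le> ennreal ((2 * (3 ^ dim W * R) + 3) ^ dim W * (real (dim W) + 2) powr s * \<eta> powr (s - real (dim W)) * h powr s)"
proof (cases "h = 0")
  case True
  have "A \<subseteq> {a}"
  proof
    fix z assume "z \<in> A"
    then obtain w where "norm w \<le> R * h" "norm (z - a - w) \<le> \<eta> * h" using A by blast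
    then show "z \<in> {a}" using True by simp
  qed
  then have "hausdorff_content s \<rho> A \<le> hausdorff_content s \<rho> {a}" by (rule hausdorff_content_mono)
  also have "\<dots> \<le> ennreal (diameter {a} powr s)"
    using \<rho> True by (intro hausdorff_content_single_le) auto
  finally show ?thesis using True by simp
next
  case False
  then have h: "h > 0" using h by simp
  define d where "d = dim W"
  obtain B where B: "B \<subseteq> W" "independent B" "span B = W" "card B = d" "finite B" "\<forall>b\<in>B. norm b = 1"
    "coords_bounded B (3 ^ d)"
    unfolding d_def by (rule exists_bounded_basis[OF fd W])
  let ?C = "3 ^ d :: real"
  obtain w where w: "\<And>z. z \<in> A \<Longrightarrow> w z \<in> W \<and> norm (w z) \<le> R * h \<and> norm (z - a - w z) \<le> \<eta> * h"
    using A by metis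
  define c where "c z b = representation B (w z) b" for z b
  have wz: "w z = (\<Sum>b\<in>B. c z b *\<^sub>R b)" if "z \<in> A" for z
    unfolding c_def using sum_representation_eq[OF B(2) _ B(5) order_refl] w[OF that] B(3) by simp
  have cb: "\<bar>c z b\<bar> \<le> ?C * (R * h)" if "z \<in> A" "b \<in> B" for z b
  proof -
    have "\<bar>c z b\<bar> \<le> ?C * norm (w z)"
      unfolding c_def using coords_bounded_representation[OF B(7,2,5) _ that(2)] w[OF that(1)] B(3) by simp
    also have "\<dots> \<le> ?C * (R * h)" using w[OF that(1)] by (intro mult_left_mono) auto
    finally show ?thesis .
  qed
  \<comment> \<open>each coordinate, measured in units of the mesh, lies between \<open>- q\<close> and \<open>q\<close>\<close>
  define q where "q = \<lceil>?C * R / \<eta>\<rceil>"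
  have q: "?C * R / \<eta> \<le> of_int q" "of_int q \<le> ?C * R / \<eta> + 1" unfolding q_def by linarith+
  have "0 \<le> ?C * R / \<eta>" using R \<eta> by simp
  then have q0: "q \<ge> 0" using q(1) by (metis of_int_0_le_iff order_trans)
  define I where "I = PiE B (\<lambda>_. {- q..q})"
  define k where "k z = (\<lambda>b\<in>B. \<lfloor>c z b / (\<eta> * h)\<rfloor>)" for z
  have \<eta>h: "\<eta> * h > 0" using \<eta> h by simp
  have kI: "k z \<in> I" if z: "z \<in> A" for z
    unfolding I_def k_def
  proof (rule restrict_PiE_iff[THEN iffD2], rule ballI)
    fix b assume b: "b \<in> B"
    have "\<bar>c z b / (\<eta> * h)\<bar> \<le> ?C * R / \<eta>"
      using cb[OF z b] \<eta>h \<eta> h by (simp add: abs_mult field_simps)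
    then have "- of_int q \<le> c z b / (\<eta> * h) \<and> c z b / (\<eta> * h) < of_int q + 1" using q(1) by linarith
    then show "\<lfloor>c z b / (\<eta> * h)\<rfloor> \<in> {- q..q}" by (simp add: le_floor_iff floor_le_iff)
  qed
  have finI: "finite I" unfolding I_def using B(5) by (intro finite_PiE) auto
  define cell where "cell j = {z \<in> A. k z = j}" for j
  let ?D = "(real d + 2) * (\<eta> * h)"
  have cell: "dist z z' \<le> ?D" if "z \<in> cell j" "z' \<in> cell j" for z z' j
  proof -
    have zA: "z \<in> A" "z' \<in> A" "k z = k z'" using that by (auto simp: cell_def)
    have "norm (w z - w z') = norm (\<Sum>b\<in>B. (c z b - c z' b) *\<^sub>R b)"
      by (simp add: wz zA scaleR_diff_left sum_subtractf)
    also have "\<dots> \<le> real (card B) * (\<eta> * h)"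
    proof (rule norm_sum_scaleR_le)
      fix b assume b: "b \<in> B"
      have "\<lfloor>c z b / (\<eta> * h)\<rfloor> = \<lfloor>c z' b / (\<eta> * h)\<rfloor>" using fun_cong[OF zA(3), of b] b by (simp add: k_def)
      then have "\<bar>c z b / (\<eta> * h) - c z' b / (\<eta> * h)\<bar> \<le> 1" by linarith
      then show "\<bar>c z b - c z' b\<bar> \<le> \<eta> * h" using \<eta>h by (simp add: diff_divide_distrib[symmetric] divide_le_eq)
    qed (use B in auto)
    finally have ww: "norm (w z - w z') \<le> real d * (\<eta> * h)" using B(4) by simp
    have "dist z z' = norm ((z - a - w z) - (z' - a - w z') + (w z - w z'))" by (simp add: dist_norm)
    also have "\<dots> \<le> norm (z - a - w z) + norm (z' - a - w z') + norm (w z - w z')"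
      by (meson norm_triangle_ineq norm_triangle_ineq4 add_right_mono order_trans)
    also have "\<dots> \<le> \<eta> * h + \<eta> * h + real d * (\<eta> * h)" using w[OF zA(1)] w[OF zA(2)] ww by (intro add_mono) auto
    finally show ?thesis by (simp add: algebra_simps)
  qed
  have D\<rho>: "?D \<le> \<rho>"
  proof -
    have "\<eta> * h \<le> 1 * h" using \<eta> h by (intro mult_right_mono) auto
    then have "?D \<le> (real d + 2) * h" by (intro mult_left_mono) auto
    from order_trans[OF this \<rho>[folded d_def]] show ?thesis .
  qed
  have D0: "?D > 0" using \<eta>h by (simp add: add_nonneg_pos)
  have "A = (\<Union>j\<in>I. cell j)" using kI by (auto simp: cell_def)
  then have "hausdorff_content s \<rho> A \<le> (\<Sum>j\<in>I. hausdorff_content s \<rho> (cell j))"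
    using hausdorff_content_finite_UN_le[OF finI, of \<rho> s cell] D0 D\<rho> by simp
  also have "\<dots> \<le> (\<Sum>j\<in>I. ennreal (?D powr s))"
  proof (rule sum_mono)
    fix j assume "j \<in> I"
    have b: "bounded (cell j)" unfolding bounded_two_points using cell by blast
    have dm: "diameter (cell j) \<le> ?D" using cell D0 by (intro diameter_le_if) auto
    have "hausdorff_content s \<rho> (cell j) \<le> ennreal (diameter (cell j) powr s)"
      using b dm D\<rho> D0 by (intro hausdorff_content_single_le) auto
    also have "\<dots> \<le> ennreal (?D powr s)"
      using dm diameter_ge_0[OF b] s by (intro ennreal_leI powr_mono2) auto
    finally show "hausdorff_content s \<rho> (cell j) \<le> ennreal (?D powr s)" .
  qed
  also have "\<dots> = ennreal (real (card I) * ?D powr s)"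
    by (simp add: ennreal_mult ennreal_of_nat_eq_real_of_nat)
  also have "\<dots> \<le> ennreal (((2 * (?C * R) + 3) / \<eta>) ^ d * ?D powr s)"
  proof (intro ennreal_leI mult_right_mono)
    have "card I = (card {- q..q}) ^ d" unfolding I_def using B(4,5) by (simp add: card_PiE)
    also have "card {- q..q} = nat (2 * q + 1)" by simp
    finally have "real (card I) = (2 * of_int q + 1) ^ d" using q0 by simp
    also have "\<dots> \<le> ((2 * (?C * R) + 3) / \<eta>) ^ d"
    proof (rule power_mono)
      have "3 \<le> 3 / \<eta>" using \<eta> by (simp add: le_divide_eq)
      moreover have "2 * of_int q + 1 \<le> 2 * (?C * R / \<eta>) + 3" using q(2) by simp
      moreover have "(2 * (?C * R) + 3) / \<eta> = 2 * (?C * R / \<eta>) + 3 / \<eta>" by (simp add: add_divide_distrib)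
      ultimately show "2 * of_int q + 1 \<le> (2 * (?C * R) + 3) / \<eta>" by linarith
    qed (use q0 in simp)
    finally show "real (card I) \<le> ((2 * (?C * R) + 3) / \<eta>) ^ d" .
  qed simp
  also have "((2 * (?C * R) + 3) / \<eta>) ^ d * ?D powr s =
      (2 * (?C * R) + 3) ^ d * (real d + 2) powr s * \<eta> powr (s - real d) * h powr s"
  proof -
    have "?D powr s = (real d + 2) powr s * (\<eta> powr s * h powr s)"
      using \<eta> h by (simp add: powr_mult)
    moreover have "\<eta> powr s = \<eta> powr (s - real d) * \<eta> ^ d"
      using \<eta> by (simp add: powr_diff powr_realpow)
    ultimately show ?thesis using \<eta> by (simp add: power_divide)
  qed
  finally show ?thesis by (simp add: d_def)
qed

text \<open>
  The compact sets are at positive distance from each other, so a subset of their union of small diameter lies in a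
  single one and its image lies near a translate of the corresponding subspace.
\<close>

lemma hausdorff_measure_locally_flat_image:
  fixes \<sigma> :: "'a::metric_space \<Rightarrow> 'v::real_normed_vector" and K :: "nat \<Rightarrow> 'a set"
  assumes fd: "finite_dimensional TYPE('v)"
    and K: "\<And>i. i < M \<Longrightarrow> compact (K i)"
    and disj: "\<And>i j. i < M \<Longrightarrow> j < M \<Longrightarrow> i \<noteq> j \<Longrightarrow> K i \<inter> K j = {}"
    and W: "\<And>i. i < M \<Longrightarrow> subspace (W i) \<and> dim (W i) = d"
    and \<eta>: "0 < \<eta>" "\<eta> \<le> 1" and R: "R \<ge> 0" and s: "s > 0"
    and flat: "\<And>i. i < M \<Longrightarrow> flat_along (W i) (K i) R \<eta> \<sigma>"
  shows "hausdorff_measure s (\<sigma> ` (\<Union>i<M. K i)) \<le>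
    ennreal ((2 * (3 ^ d * R) + 3) ^ d * (real d + 2) powr s * \<eta> powr (s - real d)) * hausdorff_measure s (\<Union>i<M. K i)"
proof (rule hausdorff_measure_image_le)
  define c where "c = (2 * (3 ^ d * R) + 3) ^ d * (real d + 2) powr s * \<eta> powr (s - real d)"
  have "2 * (3 ^ d * R) + 3 > 0" using R by (simp add: add_nonneg_pos)
  then show "(2 * (3 ^ d * R) + 3) ^ d * (real d + 2) powr s * \<eta> powr (s - real d) > 0"
    using \<eta> by (simp add: add_nonneg_pos)
  show "s \<ge> 0" using s by simp
  obtain d0 where d0: "d0 > 0" "\<And>i j x y. i < M \<Longrightarrow> j < M \<Longrightarrow> i \<noteq> j \<Longrightarrow> x \<in> K i \<Longrightarrow> y \<in> K j \<Longrightarrow> d0 \<le> dist x y"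
    using compact_family_separated[of M K] K disj by blast
  have "\<forall>i\<in>{..<M}. \<exists>r. r > 0 \<and> (\<forall>x\<in>K i. \<forall>y\<in>K i. dist x y \<le> r \<longrightarrow>
        (\<exists>w\<in>W i. norm w \<le> R * dist x y \<and> norm (\<sigma> x - \<sigma> y - w) \<le> \<eta> * dist x y))"
    using flat unfolding flat_along_def by simp
  from bchoice[OF this] obtain r where r: "\<forall>i\<in>{..<M}. r i > 0 \<and> (\<forall>x\<in>K i. \<forall>y\<in>K i. dist x y \<le> r i \<longrightarrow>
        (\<exists>w\<in>W i. norm w \<le> R * dist x y \<and> norm (\<sigma> x - \<sigma> y - w) \<le> \<eta> * dist x y))" ..
  have rpos: "r i > 0" if "i < M" for i using bspec[OF r, of i] that by simp
  have rflat: "\<exists>w\<in>W i. norm w \<le> R * dist x y \<and> norm (\<sigma> x - \<sigma> y - w) \<le> \<eta> * dist x y"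
    if "i < M" "x \<in> K i" "y \<in> K i" "dist x y \<le> r i" for i x y using bspec[OF r, of i] that by simp
  \<comment> \<open>half of \<open>d0\<close>, so that sets of diameter at most \<open>r0\<close> cannot meet two of the compact sets\<close>
  define r0 where "r0 = Min (insert (d0 / 2) (r ` {..<M}))"
  have r0: "r0 > 0" "r0 < d0" "\<And>i. i < M \<Longrightarrow> r0 \<le> r i"
  proof -
    show "r0 > 0" using rpos d0(1) by (auto simp: r0_def)
    have "r0 \<le> d0 / 2" unfolding r0_def by (rule Min_le) auto
    then show "r0 < d0" using d0(1) by linarith
  qed (simp add: r0_def)
  fix \<rho> :: real assume \<rho>: "\<rho> > 0"
  define \<delta> where "\<delta> = min r0 (\<rho> / (real d + 2))"
  have \<delta>: "\<delta> > 0" "\<delta> \<le> r0" "\<delta> \<le> \<rho> / (real d + 2)" using r0 \<rho> by (auto simp: \<delta>_def)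
  have "hausdorff_content s \<rho> (\<sigma> ` A) \<le> ennreal (c * diameter A powr s)"
    if A: "A \<subseteq> (\<Union>i<M. K i)" "bounded A" "diameter A \<le> \<delta>" for A
  proof (cases "A = {}")
    case True
    then show ?thesis using \<rho> by simp
  next
    case False
    then obtain a where a: "a \<in> A" by blast
    then obtain i where i: "i < M" "a \<in> K i" using A(1) by blast
    have dA: "dist x y \<le> diameter A" if "x \<in> A" "y \<in> A" for x y
      by (rule diameter_bounded_bound[OF A(2) that])
    have AK: "x \<in> K i" if x: "x \<in> A" for x
    proof (rule ccontr)
      assume "x \<notin> K i"
      obtain j where j: "j < M" "x \<in> K j" using A(1) x by blast
      then have "i \<noteq> j" using \<open>x \<notin> K i\<close> by auto
      from d0(2)[OF i(1) j(1) this i(2) j(2)] show False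
        using dA[OF a x] A(3) \<delta>(2) r0(2) by linarith
    qed
    have h0: "diameter A \<ge> 0" by (rule diameter_ge_0[OF A(2)])
    have "hausdorff_content s \<rho> (\<sigma> ` A) \<le> ennreal ((2 * (3 ^ dim (W i) * R) + 3) ^ dim (W i) * (real (dim (W i)) + 2) powr s
        * \<eta> powr (s - real (dim (W i))) * diameter A powr s)"
    proof (rule hausdorff_content_near_subspace[OF fd _ \<eta> R h0 s, where a = "\<sigma> a"])
      show "subspace (W i)" using W[OF i(1)] by simp
      have "(real d + 2) * diameter A \<le> (real d + 2) * (\<rho> / (real d + 2))"
        using A(3) \<delta>(3) by (intro mult_left_mono) auto
      then show "(real (dim (W i)) + 2) * diameter A \<le> \<rho>" using W[OF i(1)] by simp
      fix z assume "z \<in> \<sigma> ` A"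
      then obtain x where x: "x \<in> A" "z = \<sigma> x" by blast
      have "dist x a \<le> r i" using dA[OF x(1) a] A(3) \<delta>(2) r0(3)[OF i(1)] by linarith
      then obtain w where w: "w \<in> W i" "norm w \<le> R * dist x a" "norm (\<sigma> x - \<sigma> a - w) \<le> \<eta> * dist x a"
        using rflat[OF i(1) AK[OF x(1)] i(2)] by blast
      have "R * dist x a \<le> R * diameter A" using dA[OF x(1) a] R by (rule mult_left_mono)
      moreover have "\<eta> * dist x a \<le> \<eta> * diameter A" using dA[OF x(1) a] \<eta>(1) by (intro mult_left_mono) auto
      ultimately have "norm w \<le> R * diameter A" "norm (z - \<sigma> a - w) \<le> \<eta> * diameter A"
        using w(2,3) x(2) by auto
      then show "\<exists>w\<in>W i. norm w \<le> R * diameter A \<and> norm (z - \<sigma> a - w) \<le> \<eta> * diameter A" using w(1) by blast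
    qed
    then show ?thesis using W[OF i(1)] by (simp add: c_def)
  qed
  then show "\<exists>\<delta>>0. \<forall>A\<subseteq>(\<Union>i<M. K i). bounded A \<longrightarrow> diameter A \<le> \<delta> \<longrightarrow> hausdorff_content s \<rho> (\<sigma> ` A)
      \<le> ennreal ((2 * (3 ^ d * R) + 3) ^ d * (real d + 2) powr s * \<eta> powr (s - real d) * diameter A powr s)"
    using \<delta>(1) unfolding c_def by (intro exI[of _ \<delta>]) simp
qed

section \<open>The perturbation theorem\<close>

text \<open>
  The pieces of the Borel decomposition are made disjoint and then approximated from inside. Subsets inherit
  nullity along curves.
\<close>

lemma A_tilde_theta_compact_pieces:
  fixes F :: "'a::complete_space \<Rightarrow> 'v::real_normed_vector"
  assumes S: "S \<in> A_tilde_theta F d \<theta>" and s: "s \<ge> 0" and fin: "hausdorff_measure s S < top" and e: "e > 0"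
  shows "\<exists>(M::nat) (K :: nat \<Rightarrow> 'a set) (W :: nat \<Rightarrow> 'v set).
    (\<forall>i<M. compact (K i) \<and> K i \<subseteq> S \<and> subspace (W i) \<and> dim (W i) = d) \<and>
    (\<forall>i<M. \<forall>j<M. i \<noteq> j \<longrightarrow> K i \<inter> K j = {}) \<and>
    (\<forall>i<M. \<forall>D \<gamma>. biLipschitz_curve D \<gamma> \<longrightarrow> in_direction F (cone_off (W i) \<theta>) D \<gamma> \<longrightarrow>
        hausdorff_measure 1 (\<gamma> ` D \<inter> K i) = 0) \<and>
    hausdorff_measure s (S - (\<Union>i<M. K i)) \<le> ennreal e"
proof -
  obtain M :: nat and T :: "nat \<Rightarrow> 'a set" and W :: "nat \<Rightarrow> 'v set" where ST: "S = (\<Union>i<M. T i)" and TW: "\<forall>i<M. T i \<in> sets borel \<and> subspace (W i) \<and> dim (W i) = d \<and>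
      (\<forall>D \<gamma>. biLipschitz_curve D \<gamma> \<longrightarrow> in_direction F (cone_off (W i) \<theta>) D \<gamma> \<longrightarrow> hausdorff_measure 1 (\<gamma> ` D \<inter> T i) = 0)"
    using S unfolding A_tilde_theta_def mem_Collect_eq by (elim exE conjE)
  note TWi = TW[THEN spec, THEN mp]
  have Tb: "T i \<in> sets borel" if "i < M" for i by (rule TWi[OF that, THEN conjunct1])
  have Ws: "subspace (W i) \<and> dim (W i) = d" if "i < M" for i
    by (intro conjI TWi[OF that, THEN conjunct2, THEN conjunct1]
        TWi[OF that, THEN conjunct2, THEN conjunct2, THEN conjunct1])
  have Tn: "hausdorff_measure 1 (\<gamma> ` D \<inter> T i) = 0"
    if "i < M" "biLipschitz_curve D \<gamma>" "in_direction F (cone_off (W i) \<theta>) D \<gamma>" for i D \<gamma>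
    by (rule TWi[OF that(1), THEN conjunct2, THEN conjunct2, THEN conjunct2, rule_format, OF that(2,3)])
  define T' where "T' i = T i - (\<Union>j<i. T j)" for i
  have T'b: "T' i \<in> sets borel" if "i < M" for i
    unfolding T'_def using Tb that by (intro sets.Diff sets.finite_UN) auto
  have T'S: "T' i \<subseteq> S" if "i < M" for i using that unfolding T'_def ST by blast
  have ST': "S \<subseteq> (\<Union>i<M. T' i)"
  proof
    fix x assume "x \<in> S"
    then obtain i where i: "i < M" "x \<in> T i" unfolding ST by blast
    define k where "k = (LEAST i. x \<in> T i)"
    have "x \<in> T k" unfolding k_def by (rule LeastI[of "\<lambda>i. x \<in> T i", OF i(2)])
    moreover have "x \<notin> T j" if "j < k" for j using not_less_Least[of j "\<lambda>i. x \<in> T i"] that by (simp add: k_def)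
    moreover have "k < M" using Least_le[of "\<lambda>i. x \<in> T i", OF i(2)] i(1) by (simp add: k_def)
    ultimately show "x \<in> (\<Union>i<M. T' i)" unfolding T'_def by blast
  qed
  have disj: "T' i \<inter> T' j = {}" if "i \<noteq> j" for i j
    using that by (cases i j rule: linorder_cases) (auto simp: T'_def)
  have e': "e / (real M + 1) > 0" using e by simp
  have "\<forall>i\<in>{..<M}. \<exists>K. compact K \<and> K \<subseteq> T' i \<and> hausdorff_measure s (T' i - K) < ennreal (e / (real M + 1))"
  proof
    fix i assume "i \<in> {..<M}"
    then have i: "i < M" by simp
    have "hausdorff_measure s (T' i) < top"
      by (rule le_less_trans[OF hausdorff_measure_mono[OF T'S[OF i]] fin])
    from hausdorff_measure_inner_compact[OF s T'b[OF i] this e']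
    show "\<exists>K. compact K \<and> K \<subseteq> T' i \<and> hausdorff_measure s (T' i - K) < ennreal (e / (real M + 1))" by metis
  qed
  from bchoice[OF this] obtain K where "\<forall>i\<in>{..<M}. compact (K i) \<and> K i \<subseteq> T' i \<and> hausdorff_measure s (T' i - K i) < ennreal (e / (real M + 1))" ..
  then have K: "compact (K i)" "K i \<subseteq> T' i" "hausdorff_measure s (T' i - K i) < ennreal (e / (real M + 1))" if "i < M" for i
    using that by auto
  show ?thesis
  proof (rule exI[of _ M], rule exI[of _ K], rule exI[of _ W], intro conjI allI impI)
    fix i assume i: "i < M"
    show "compact (K i)" by (rule K(1)[OF i])
    show "K i \<subseteq> S" using K(2)[OF i] T'S[OF i] by blast
    show "subspace (W i)" "dim (W i) = d" using Ws[OF i] by simp_all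
  next
    show "K i \<inter> K j = {}" if "i < M" "j < M" "i \<noteq> j" for i j
      using K(2)[OF that(1)] K(2)[OF that(2)] disj[OF that(3)] by blast
  next
    show "hausdorff_measure 1 (\<gamma> ` D \<inter> K i) = 0"
      if *: "i < M" "biLipschitz_curve D \<gamma>" "in_direction F (cone_off (W i) \<theta>) D \<gamma>" for i D \<gamma>
    proof -
      have "K i \<subseteq> T i" using K(2)[OF *(1)] by (auto simp: T'_def)
      then have "hausdorff_measure 1 (\<gamma> ` D \<inter> K i) \<le> hausdorff_measure 1 (\<gamma> ` D \<inter> T i)"
        by (intro hausdorff_measure_mono) auto
      then show ?thesis using Tn[OF *] by simp
    qed
  next
    have "S - (\<Union>i<M. K i) \<subseteq> (\<Union>i\<in>{..<M}. T' i - K i)" using ST' by blast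
    then have "hausdorff_measure s (S - (\<Union>i<M. K i)) \<le> hausdorff_measure s (\<Union>i\<in>{..<M}. T' i - K i)"
      by (rule hausdorff_measure_mono)
    also have "\<dots> \<le> (\<Sum>i<M. hausdorff_measure s (T' i - K i))" by (rule hausdorff_measure_finite_UN_le) simp
    also have "\<dots> \<le> (\<Sum>i<M. ennreal (e / (real M + 1)))" using K(3) by (intro sum_mono less_imp_le) auto
    also have "\<dots> = ennreal (real M * (e / (real M + 1)))" using e by (simp add: ennreal_of_nat_eq_real_of_nat ennreal_mult[symmetric])
    also have "\<dots> \<le> ennreal e"
    proof (rule ennreal_leI)
      show "real M * (e / (real M + 1)) \<le> e" using e by (simp add: field_simps)
    qed
    finally show "hausdorff_measure s (S - (\<Union>i<M. K i)) \<le> ennreal e" .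
  qed
qed

lemma lip_const_lipschitz:
  fixes F :: "'a::metric_space \<Rightarrow> 'v::real_normed_vector"
  assumes "\<exists>L. L-lipschitz_on UNIV F"
  shows "lip_const F \<ge> 0" "norm (F x - F y) \<le> lip_const F * dist x y"
proof -
  let ?S = "{L. L-lipschitz_on UNIV F}"
  have ne: "?S \<noteq> {}" using assms by blast
  show "lip_const F \<ge> 0"
    unfolding lip_const_def using ne by (intro cInf_greatest) (auto dest: lipschitz_on_nonneg)
  show "norm (F x - F y) \<le> lip_const F * dist x y"
  proof (cases "x = y")
    case False
    have "norm (F x - F y) / dist x y \<le> lip_const F"
      unfolding lip_const_def using ne
    proof (rule cInf_greatest)
      fix L assume "L \<in> ?S"
      then have "dist (F x) (F y) \<le> L * dist x y" by (auto dest: lipschitz_onD)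
      then show "norm (F x - F y) / dist x y \<le> L" using False by (simp add: divide_le_eq dist_norm)
    qed
    then show ?thesis using False by (simp add: divide_le_eq)
  qed simp
qed

lemma K_tilde_approx:
  assumes fd: "finite_dimensional TYPE('v::real_normed_vector)" and e: "e > 0"
  obtains K where "K \<ge> 1" "K_tilde_admissible TYPE('v) d K" "K < K_tilde TYPE('v) d + e"
proof -
  let ?S = "{K. K \<ge> 1 \<and> K_tilde_admissible TYPE('v) d K}"
  have "?S \<noteq> {}" using K_tilde_admissible_exists[OF fd, of d] by blast
  moreover have "Inf ?S < K_tilde TYPE('v) d + e" using e by (simp add: K_tilde_def)
  ultimately obtain K where "K \<in> ?S" "K < K_tilde TYPE('v) d + e" using cInf_lessD by meson
  then show ?thesis using that[of K] by simp
qed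

lemma K_tilde_ge_1:
  assumes fd: "finite_dimensional TYPE('v::real_normed_vector)"
  shows "K_tilde TYPE('v) d \<ge> 1"
proof -
  have "{K. K \<ge> 1 \<and> K_tilde_admissible TYPE('v) d K} \<noteq> {}" using K_tilde_admissible_exists[OF fd, of d] by blast
  then show ?thesis unfolding K_tilde_def by (rule cInf_greatest) simp
qed

lemma exists_small_powr:
  fixes a t m :: real
  assumes "a > 0" "t > 0" "m > 0"
  obtains \<eta> where "0 < \<eta>" "\<eta> \<le> m" "\<eta> powr a \<le> t"
proof (rule that[of "min m (t powr (1 / a))"])
  have "min m (t powr (1 / a)) powr a \<le> (t powr (1 / a)) powr a"
    using assms by (intro powr_mono2) auto
  also have "\<dots> = t" using assms by (simp add: powr_powr)
  finally show "min m (t powr (1 / a)) powr a \<le> t" .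
qed (use assms in auto)

theorem theorem4p9:
  fixes F :: "'x::complete_space \<Rightarrow> 'v::banach"
    and d :: nat and s :: real and S :: "'x set" and \<epsilon> :: real
  assumes "finite_dimensional TYPE('v)"
    and "\<exists>L. L-lipschitz_on UNIV F"
    and "d \<le> dim (UNIV :: 'v set)"
    and "s > real d"
    and "S \<in> A_tilde F d"
    and "hausdorff_measure s S < \<infinity>"
    and "\<epsilon> > 0"
  shows "\<exists>\<sigma> :: 'x \<Rightarrow> 'v.
           (K_tilde TYPE('v) d * lip_const F + \<epsilon>)-lipschitz_on UNIV \<sigma> \<and>
           (\<forall>x. norm (\<sigma> x - F x) < \<epsilon>) \<and>
           (\<forall>x. S = {} \<or> infdist x S > \<epsilon> \<longrightarrow> \<sigma> x = F x) \<and>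
           hausdorff_measure s (\<sigma> ` S) < ennreal \<epsilon>"
proof -
  note fd = assms(1) and \<epsilon> = assms(7)
  have s: "s > 0" using assms(4) by linarith
  define LF where "LF = lip_const F"
  have LF0: "LF \<ge> 0" and F: "norm (F x - F y) \<le> LF * dist x y" for x y
    using lip_const_lipschitz[OF assms(2)] by (simp_all add: LF_def)
  define \<Lambda> where "\<Lambda> = K_tilde TYPE('v) d * LF + \<epsilon>"
  have "LF \<le> K_tilde TYPE('v) d * LF" using mult_right_mono[OF K_tilde_ge_1[OF fd, of d] LF0] by simp
  then have \<Lambda>: "\<Lambda> > 0" "LF \<le> \<Lambda>" using LF0 \<epsilon> by (auto simp: \<Lambda>_def)
  have lipI: "\<Lambda>-lipschitz_on UNIV \<sigma>" if "\<And>x y. norm (\<sigma> x - \<sigma> y) \<le> \<Lambda> * dist x y" for \<sigma> :: "'x \<Rightarrow> 'v"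
    by (rule lipschitz_onI) (use that \<Lambda>(1) in \<open>auto simp: dist_norm\<close>)
  show ?thesis
  proof (cases "S = {}")
    case True
    have "norm (F x - F y) \<le> \<Lambda> * dist x y" for x y
      using order_trans[OF F mult_right_mono[OF \<Lambda>(2)]] by simp
    from lipI[OF this] show ?thesis
      using True \<epsilon> by (intro exI[of _ F]) (simp add: \<Lambda>_def LF_def)
  next
    case False
    define m where "m = dim (UNIV :: 'v set)"
    have "\<epsilon> / (4 * (LF + 1)) > 0" using \<epsilon> LF0 by simp
    then obtain Kc where Kc: "Kc \<ge> 1" "K_tilde_admissible TYPE('v) d Kc" "Kc < K_tilde TYPE('v) d + \<epsilon> / (4 * (LF + 1))"
      by (rule K_tilde_approx[OF fd])
    have Kc0: "Kc \<ge> 0" using Kc(1) by simp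
    have KcLF: "Kc * LF \<le> K_tilde TYPE('v) d * LF + \<epsilon> / 4"
    proof -
      have "Kc * LF \<le> K_tilde TYPE('v) d * LF + \<epsilon> / (4 * (LF + 1)) * LF"
        unfolding distrib_right[symmetric] using Kc(3) LF0 by (intro mult_right_mono) auto
      moreover have "\<epsilon> / (4 * (LF + 1)) * LF \<le> \<epsilon> / 4" using \<epsilon> LF0 by (simp add: field_simps)
      ultimately show ?thesis by linarith
    qed
    obtain Kd Kp where KdKp: "Kd > 0" "Kp > 0"
      and adm: "\<forall>W::'v set. subspace W \<and> dim W = d \<longrightarrow> (\<exists>B P Q. adapted_splitting W Kd Kp Kc B P Q)"
      using Kc(2) unfolding K_tilde_admissible_iff by (elim exE conjE)
    define R where "R = Kd * LF"
    have R0: "R \<ge> 0" using KdKp LF0 by (simp add: R_def)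
    \<comment> \<open>the factor by which a locally flat image multiplies the measure is \<open>c0 * \<eta> powr (s - d)\<close>\<close>
    define c0 where "c0 = (2 * (3 ^ d * R) + 3) ^ d * (real d + 2) powr s"
    have c0: "c0 \<ge> 0" using R0 by (simp add: c0_def)
    define H where "H = enn2real (hausdorff_measure s S)"
    have H: "hausdorff_measure s S = ennreal H" "H \<ge> 0"
      using assms(6) by (simp_all add: H_def)
    have "s - real d > 0" "\<epsilon> / (4 * (c0 * H + 1)) > 0" "min 1 (\<epsilon> / 4) > 0"
      using assms(4) \<epsilon> c0 H(2) by (auto intro!: divide_pos_pos add_nonneg_pos)
    then obtain \<eta> where \<eta>: "0 < \<eta>" "\<eta> \<le> min 1 (\<epsilon> / 4)" "\<eta> powr (s - real d) \<le> \<epsilon> / (4 * (c0 * H + 1))"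
      by (rule exists_small_powr)
    have small: "c0 * \<eta> powr (s - real d) * H \<le> \<epsilon> / 4"
    proof -
      have "c0 * \<eta> powr (s - real d) * H = (c0 * H) * \<eta> powr (s - real d)" by simp
      also have "\<dots> \<le> (c0 * H) * (\<epsilon> / (4 * (c0 * H + 1)))" using \<eta>(3) c0 H(2) by (intro mult_left_mono) auto
      also have "\<dots> \<le> \<epsilon> / 4"
      proof -
        have "c0 * H \<ge> 0" using c0 H(2) by simp
        then show ?thesis using \<epsilon> by (simp add: field_simps)
      qed
      finally show ?thesis .
    qed
    \<comment> \<open>\<open>m\<close> coordinates, each with error \<open>\<delta>\<close>, stay within \<open>\<eta>\<close>; adding \<open>1\<close> covers the trivial space\<close>
    define \<delta> where "\<delta> = \<eta> / (real m + 1)"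
    have \<delta>: "\<delta> > 0" "real m * \<delta> \<le> \<eta>"
      using \<eta>(1) by (auto simp: \<delta>_def field_simps)
    \<comment> \<open>\<open>1 - \<theta>\<close> is so small that \<open>(1 - \<theta>) * (Kp * Kd) * LF \<le> \<delta>\<close>; the minimum keeps \<open>\<theta>\<close> positive\<close>
    define \<theta> where "\<theta> = 1 - min (1 / 2) (\<delta> / (Kp * Kd * LF + 1))"
    have den: "Kp * Kd * LF + 1 > 0" using KdKp LF0 by (simp add: add_nonneg_pos)
    have \<theta>: "0 < \<theta>" "\<theta> < 1" "(1 - \<theta>) * (Kp * Kd) * LF \<le> \<delta>"
    proof -
      show "0 < \<theta>"
        using min.cobounded1[of "1 / 2" "\<delta> / (Kp * Kd * LF + 1)"] unfolding \<theta>_def by linarith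
      show "\<theta> < 1" using den \<delta>(1) by (simp add: \<theta>_def)
      have "(1 - \<theta>) * (Kp * Kd * LF) \<le> \<delta> / (Kp * Kd * LF + 1) * (Kp * Kd * LF)"
        using KdKp LF0 by (intro mult_right_mono) (auto simp: \<theta>_def)
      also have "\<dots> \<le> \<delta>" using den \<delta>(1) by (simp add: field_simps)
      finally show "(1 - \<theta>) * (Kp * Kd) * LF \<le> \<delta>" by (simp add: mult.assoc)
    qed
    have "S \<in> A_tilde_theta F d \<theta>" using assms(5) \<theta> by (auto simp: A_tilde_def)
    moreover have "s \<ge> 0" "hausdorff_measure s S < top" using s assms(6) by auto
    moreover have "\<epsilon> / (4 * \<Lambda> powr s) > 0" using \<epsilon> \<Lambda>(1) by simp
    ultimately have "\<exists>(M::nat) (K :: nat \<Rightarrow> 'x set) (W :: nat \<Rightarrow> 'v set).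
      (\<forall>i<M. compact (K i) \<and> K i \<subseteq> S \<and> subspace (W i) \<and> dim (W i) = d) \<and>
      (\<forall>i<M. \<forall>j<M. i \<noteq> j \<longrightarrow> K i \<inter> K j = {}) \<and>
      (\<forall>i<M. \<forall>D \<gamma>. biLipschitz_curve D \<gamma> \<longrightarrow> in_direction F (cone_off (W i) \<theta>) D \<gamma> \<longrightarrow>
          hausdorff_measure 1 (\<gamma> ` D \<inter> K i) = 0) \<and>
      hausdorff_measure s (S - (\<Union>i<M. K i)) \<le> ennreal (\<epsilon> / (4 * \<Lambda> powr s))"
      by (rule A_tilde_theta_compact_pieces)
    then obtain M :: nat and K :: "nat \<Rightarrow> 'x set" and W :: "nat \<Rightarrow> 'v set" where
      KW: "\<forall>i<M. compact (K i) \<and> K i \<subseteq> S \<and> subspace (W i) \<and> dim (W i) = d"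
      and disj': "\<forall>i<M. \<forall>j<M. i \<noteq> j \<longrightarrow> K i \<inter> K j = {}"
      and null': "\<forall>i<M. \<forall>D \<gamma>. biLipschitz_curve D \<gamma> \<longrightarrow> in_direction F (cone_off (W i) \<theta>) D \<gamma> \<longrightarrow>
          hausdorff_measure 1 (\<gamma> ` D \<inter> K i) = 0"
      and rest: "hausdorff_measure s (S - (\<Union>i<M. K i)) \<le> ennreal (\<epsilon> / (4 * \<Lambda> powr s))"
      by (elim exE conjE)
    have K: "compact (K i)" and KS: "K i \<subseteq> S" and W: "subspace (W i) \<and> dim (W i) = d" if "i < M" for i
      using KW that by simp_all
    have disj: "K i \<inter> K j = {}" if "i < M" "j < M" "i \<noteq> j" for i j using disj' that by simp
    note null = null'[rule_format]
    define \<Lambda>0 where "\<Lambda>0 = Kc * LF + real m * \<delta>"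
    have \<Lambda>0: "\<Lambda>0 + \<epsilon> / 4 \<le> \<Lambda>" using KcLF \<delta>(2) \<eta>(2) \<epsilon> by (simp add: \<Lambda>0_def \<Lambda>_def)
    have "\<exists>\<sigma>. (\<forall>x y. norm (\<sigma> x - \<sigma> y) \<le> (\<Lambda>0 + \<epsilon> / 4) * dist x y) \<and> (\<forall>x. norm (\<sigma> x - F x) < \<epsilon> / 4) \<and>
     (\<forall>x. (\<forall>i<M. K i \<noteq> {} \<longrightarrow> \<epsilon> \<le> infdist x (K i)) \<longrightarrow> \<sigma> x = F x) \<and> (\<forall>i<M. flat_along (W i) (K i) R \<eta> \<sigma>)"
    proof (rule glue_perturbations[OF _ K disj \<epsilon>])
      show "norm (F x - F y) \<le> \<Lambda>0 * dist x y" for x y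
      proof -
        have "LF \<le> Kc * LF" using mult_right_mono[OF Kc(1) LF0] by simp
        then have "LF \<le> \<Lambda>0" using \<delta>(1) by (simp add: \<Lambda>0_def add_increasing2)
        from order_trans[OF F mult_right_mono[OF this]] show ?thesis by simp
      qed
      show "0 < \<epsilon> / 4" using \<epsilon> by simp
    next
      fix i and \<sigma> \<tau> :: "'x \<Rightarrow> 'v"
      assume "flat_along (W i) (K i) R \<eta> \<sigma>" "\<And>x. x \<in> K i \<Longrightarrow> \<tau> x = \<sigma> x"
      then show "flat_along (W i) (K i) R \<eta> \<tau>" unfolding flat_along_def by simp
    next
      fix i and t :: real assume i: "i < M" and t: "t > 0"
      obtain B P Q where split: "adapted_splitting (W i) Kd Kp Kc B P Q"
        using mp[OF spec[OF adm, of "W i"] W[OF i]] by (elim exE)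
      then have cardB: "card B = m"
        unfolding m_def adapted_splitting_def by (intro basis_card_eq_dim) auto
      have "t / (real m + 1) > 0" using t by simp
      then have "\<exists>\<sigma>. (\<forall>x. norm (\<sigma> x - F x) \<le> real (card B) * (t / (real m + 1))) \<and>
        (\<forall>x y. norm (\<sigma> x - \<sigma> y) \<le> (Kc * LF + real (card B) * \<delta>) * dist x y) \<and>
        flat_along (W i) (K i) (Kd * LF) (real (card B) * \<delta>) \<sigma>"
        by (rule vector_perturbation[OF fd F LF0 conjunct1[OF W[OF i]] split KdKp(2,1) Kc0 \<delta>(1) _ \<theta>(2,3) K[OF i] order_refl null[OF i]])
      then obtain \<sigma> where s1: "\<forall>x. norm (\<sigma> x - F x) \<le> real m * (t / (real m + 1))"
        and s2: "\<forall>x y. norm (\<sigma> x - \<sigma> y) \<le> \<Lambda>0 * dist x y"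
        and s3: "flat_along (W i) (K i) R (real m * \<delta>) \<sigma>"
        unfolding cardB \<Lambda>0_def R_def by (elim exE conjE)
      have "real m * (t / (real m + 1)) \<le> t" using t by (simp add: field_simps)
      then have s1': "\<forall>x. norm (\<sigma> x - F x) \<le> t" by (intro allI order_trans[OF s1[rule_format]])
      have "flat_along (W i) (K i) R \<eta> \<sigma>" by (rule flat_along_mono[OF s3 \<delta>(2)])
      then show "\<exists>\<sigma>. (\<forall>x. norm (\<sigma> x - F x) \<le> t) \<and> (\<forall>x y. norm (\<sigma> x - \<sigma> y) \<le> \<Lambda>0 * dist x y) \<and>
          flat_along (W i) (K i) R \<eta> \<sigma>"
        by (intro exI[of _ \<sigma>] conjI s1' s2)
    qed
    then obtain \<sigma> where \<sigma>1: "\<forall>x y. norm (\<sigma> x - \<sigma> y) \<le> (\<Lambda>0 + \<epsilon> / 4) * dist x y"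
      and \<sigma>2: "\<forall>x. norm (\<sigma> x - F x) < \<epsilon> / 4"
      and \<sigma>3: "\<forall>x. (\<forall>i<M. K i \<noteq> {} \<longrightarrow> \<epsilon> \<le> infdist x (K i)) \<longrightarrow> \<sigma> x = F x"
      and \<sigma>4: "\<forall>i<M. flat_along (W i) (K i) R \<eta> \<sigma>" by (elim exE conjE)
    have lip: "norm (\<sigma> x - \<sigma> y) \<le> \<Lambda> * dist x y" for x y
      using order_trans[OF \<sigma>1[rule_format] mult_right_mono[OF \<Lambda>0]] by simp
    have near: "norm (\<sigma> x - F x) < \<epsilon>" for x using spec[OF \<sigma>2, of x] \<epsilon> by linarith
    have away: "\<sigma> x = F x" if "infdist x S > \<epsilon>" for x
    proof (rule \<sigma>3[rule_format])
      fix i assume "i < M" "K i \<noteq> {}"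
      then have "infdist x S \<le> infdist x (K i)" using KS by (intro infdist_mono) auto
      then show "\<epsilon> \<le> infdist x (K i)" using that by linarith
    qed
    have "hausdorff_measure s (\<sigma> ` (\<Union>i<M. K i)) \<le> ennreal (\<epsilon> / 4)"
    proof -
      have "hausdorff_measure s (\<sigma> ` (\<Union>i<M. K i)) \<le>
        ennreal ((2 * (3 ^ d * R) + 3) ^ d * (real d + 2) powr s * \<eta> powr (s - real d)) * hausdorff_measure s (\<Union>i<M. K i)"
      proof (rule hausdorff_measure_locally_flat_image[OF fd K disj W \<eta>(1) _ R0 s])
        show "\<eta> \<le> 1" using \<eta>(2) by simp
        show "flat_along (W i) (K i) R \<eta> \<sigma>" if "i < M" for i using \<sigma>4 that by simp
      qed
      also have "\<dots> \<le> ennreal (c0 * \<eta> powr (s - real d)) * ennreal H"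
        unfolding c0_def H(1)[symmetric] using KS by (intro mult_left_mono hausdorff_measure_mono) auto
      also have "\<dots> = ennreal (c0 * \<eta> powr (s - real d) * H)"
        using c0 H(2) by (simp add: ennreal_mult)
      also have "\<dots> \<le> ennreal (\<epsilon> / 4)" using small by (rule ennreal_leI)
      finally show ?thesis .
    qed
    moreover have "hausdorff_measure s (\<sigma> ` (S - (\<Union>i<M. K i))) \<le> ennreal (\<epsilon> / 4)"
    proof -
      have "hausdorff_measure s (\<sigma> ` (S - (\<Union>i<M. K i))) \<le> ennreal (\<Lambda> powr s) * hausdorff_measure s (S - (\<Union>i<M. K i))"
        using lip s by (intro hausdorff_measure_lipschitz_image[OF \<Lambda>(1)]) (auto simp: dist_norm)
      also have "\<dots> \<le> ennreal (\<Lambda> powr s) * ennreal (\<epsilon> / (4 * \<Lambda> powr s))" using rest by (rule mult_left_mono) simp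
      also have "\<dots> = ennreal (\<epsilon> / 4)"
        using \<Lambda>(1) \<epsilon> by (subst ennreal_mult[symmetric]) auto
      finally show ?thesis .
    qed
    moreover have "hausdorff_measure s (\<sigma> ` S) \<le>
      hausdorff_measure s (\<sigma> ` (\<Union>i<M. K i)) + hausdorff_measure s (\<sigma> ` (S - (\<Union>i<M. K i)))"
      by (rule order_trans[OF hausdorff_measure_mono hausdorff_measure_Un_le]) auto
    ultimately have "hausdorff_measure s (\<sigma> ` S) \<le> ennreal (\<epsilon> / 4) + ennreal (\<epsilon> / 4)"
      by (meson add_mono order_trans)
    also have "\<dots> = ennreal (\<epsilon> / 2)" using \<epsilon> by (simp flip: ennreal_plus)
    also have "\<dots> < ennreal \<epsilon>" using \<epsilon> by (intro ennreal_lessI) auto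
    finally have meas: "hausdorff_measure s (\<sigma> ` S) < ennreal \<epsilon>" .
    show ?thesis
    proof (rule exI[of _ \<sigma>], intro conjI allI impI)
      show "(K_tilde TYPE('v) d * lip_const F + \<epsilon>)-lipschitz_on UNIV \<sigma>"
        using lipI[OF lip] by (simp add: \<Lambda>_def LF_def)
      show "norm (\<sigma> x - F x) < \<epsilon>" for x by (rule near)
      show "\<sigma> x = F x" if "S = {} \<or> infdist x S > \<epsilon>" for x using that False away by blast
      show "hausdorff_measure s (\<sigma> ` S) < ennreal \<epsilon>" by (rule meas)
    qed
  qed
qed

end
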